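(* Let $\Gamma$ be a group generated by a finite symmetric set $S$, acting by permutations on a countably infinite set $X$, and let $S_\Gamma$ be the Schreier graph of this action with respect to $S$. The following are equivalent: (1) The action is hyperfinite, i.e. there is a regular Borel probability measure $\nu$ on $\beta X$, invariant under the extended action, such that the extended action is hyperfinite with respect to $\nu$; (2) $S_\Gamma$ contains a hyperfinite Følner sequence; (3) there exists a $\Gamma$-invariant mean $\mu$ on $X$ such that for every $\varepsilon>0$ there exist $Y\subseteq X$ with $\mu(Y)<\varepsilon$ and $K>0$ such that every connected component of the subgraph of $S_\Gamma$ induced on $X\setminus Y$ has at most $K$ vertices.
   Context: A mean on $X$ is a finitely additive map $\mu:2^X\to[0,1]$ with $\mu(X)=1$; it is $\Gamma$-invariant if $\mu(\gamma A)=\mu(A)$ for all $\gamma\in\Gamma$, $A\subseteq X$. $\beta X$ is the Stone–Čech compactification, i.e. the space of ultrafilters on $X$ with basic clopen sets $U_A=\{\omega: A\in\omega\}$; each bijection $s$ of $X$ extends to the homeomorphism $\tilde s(\omega)=\{s(A):A\in\omega\}$, which gives the extended action of $\Gamma$ on $\beta X$. The Schreier graph $S_\Gamma$ has vertex set $X$ and an edge $\{x,y\}$ whenever $x\ne y$ and $s(x)=y$ for some $s\in S$ (no loops). The graphing $\mathcal G$ of the extended action is the graph on $\beta X$ with an edge $\{\omega,\omega'\}$ whenever $\omega\neq\omega'$ and $\tilde s(\omega)=\omega'$ for some $s\in S$. For a Borel probability $\nu$ on $\beta X$ and a Borel set of edges $W\subseteq E(\mathcal G)$, the edge measure is $\nu_E(W)=\frac12\int\deg_W\,d\nu$.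 The extended action is hyperfinite with respect to an invariant $\nu$ if for every $\varepsilon>0$ there exist $K$ and a Borel $W\subseteq E(\mathcal G)$ with $\nu_E(E(\mathcal G)\setminus W)<\varepsilon$ such that every connected component of $(\beta X,W)$ has at most $K$ vertices. A Følner sequence in a graph $G$ is a sequence of finite vertex sets (induced subgraphs) $F_n$ with $i(F_n)\to0$, where $i(F)$ is the number of edges between $F$ and its complement divided by $|F|$. A sequence of finite graphs $(G_n)$ of bounded degree is hyperfinite if for every $\varepsilon>0$ there are $K>0$ and $Y_n\subseteq V(G_n)$ with $|Y_n|<\varepsilon|V(G_n)|$ such that every component of the subgraph induced on $V(G_n)\setminus Y_n$ has at most $K$ vertices, for all $n$. *)

theory Defs
  imports "HOL-Analysis.Analysis" "HOL-Probability.Probability" "HOL-Algebra.Group_Action" "HOL-Algebra.Generated_Groups"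
begin

definition schreier_edge :: "('g \<Rightarrow> 'x \<Rightarrow> 'x) \<Rightarrow> 'g set \<Rightarrow> 'x \<Rightarrow> 'x \<Rightarrow> bool" where
  "schreier_edge phi S x y \<longleftrightarrow> x \<noteq> y \<and> (\<exists>s\<in>S. phi s x = y)"

definition induced_component :: "('x \<Rightarrow> 'x \<Rightarrow> bool) \<Rightarrow> 'x set \<Rightarrow> 'x \<Rightarrow> 'x set" where
  "induced_component E V x = {y. (x, y) \<in> {(a, b). a \<in> V \<and> b \<in> V \<and> E a b}\<^sup>*}"

definition iso_const :: "('x \<Rightarrow> 'x \<Rightarrow> bool) \<Rightarrow> 'x set \<Rightarrow> real" where
  "iso_const E F = real (card {(x, y). x \<in> F \<and> y \<notin> F \<and> E x y}) / real (card F)"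

definition folner_sequence :: "('x \<Rightarrow> 'x \<Rightarrow> bool) \<Rightarrow> (nat \<Rightarrow> 'x set) \<Rightarrow> bool" where
  "folner_sequence E F \<longleftrightarrow> (\<forall>n. finite (F n) \<and> F n \<noteq> {}) \<and> (\<lambda>n. iso_const E (F n)) \<longlonglongrightarrow> 0"

definition hyperfinite_graph_seq :: "('x \<Rightarrow> 'x \<Rightarrow> bool) \<Rightarrow> (nat \<Rightarrow> 'x set) \<Rightarrow> bool" where
  "hyperfinite_graph_seq E F \<longleftrightarrow>
     (\<forall>\<epsilon>>0. \<exists>K::nat. K > 0 \<and> (\<exists>Y. \<forall>n. Y n \<subseteq> F n \<and> real (card (Y n)) < \<epsilon> * real (card (F n)) \<and>
        (\<forall>x \<in> F n - Y n. finite (induced_component E (F n - Y n) x) \<and>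
                          card (induced_component E (F n - Y n) x) \<le> K)))"

definition mean :: "('x set \<Rightarrow> real) \<Rightarrow> bool" where
  "mean \<mu> \<longleftrightarrow> (\<forall>A. 0 \<le> \<mu> A \<and> \<mu> A \<le> 1) \<and> \<mu> UNIV = 1 \<and>
     (\<forall>A B. A \<inter> B = {} \<longrightarrow> \<mu> (A \<union> B) = \<mu> A + \<mu> B)"

definition invariant_mean :: "('g, 'b) monoid_scheme \<Rightarrow> ('g \<Rightarrow> 'x \<Rightarrow> 'x) \<Rightarrow> ('x set \<Rightarrow> real) \<Rightarrow> bool" where
  "invariant_mean G phi \<mu> \<longleftrightarrow> mean \<mu> \<and> (\<forall>g \<in> carrier G. \<forall>A. \<mu> (phi g ` A) = \<mu> A)"

section \<open>Stone-Cech compactification as the space of ultrafilters\<close>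

definition ultrafilter_on :: "'x set set \<Rightarrow> bool" where
  "ultrafilter_on U \<longleftrightarrow> UNIV \<in> U \<and> {} \<notin> U \<and>
     (\<forall>A B. A \<in> U \<longrightarrow> A \<subseteq> B \<longrightarrow> B \<in> U) \<and>
     (\<forall>A B. A \<in> U \<longrightarrow> B \<in> U \<longrightarrow> A \<inter> B \<in> U) \<and>
     (\<forall>A. A \<in> U \<or> - A \<in> U)"

definition betaX :: "'x set set set" where
  "betaX = {U. ultrafilter_on U}"

definition basic_clopen :: "'x set \<Rightarrow> 'x set set set" where
  "basic_clopen A = {\<omega> \<in> betaX. A \<in> \<omega>}"

definition beta_topology :: "'x set set topology" where
  "beta_topology = topology_generated_by (range basic_clopen)"

text \<open>Extension of a bijection s of X to beta X.\<close>
definition ext_map :: "('x \<Rightarrow> 'x) \<Rightarrow> 'x set set \<Rightarrow> 'x set set" where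
  "ext_map s \<omega> = (\<lambda>A. s ` A) ` \<omega>"

definition borel_sets :: "'a topology \<Rightarrow> 'a set set" where
  "borel_sets T = sigma_sets (topspace T) {U. openin T U}"

definition regular_measure :: "'a topology \<Rightarrow> 'a measure \<Rightarrow> bool" where
  "regular_measure T \<nu> \<longleftrightarrow> (\<forall>A \<in> sets \<nu>.
     emeasure \<nu> A = (SUP K \<in> {K. compactin T K \<and> K \<subseteq> A}. emeasure \<nu> K) \<and>
     emeasure \<nu> A = (INF U \<in> {U. openin T U \<and> A \<subseteq> U}. emeasure \<nu> U))"

definition beta_borel_prob :: "'x set set measure \<Rightarrow> bool" where
  "beta_borel_prob \<nu> \<longleftrightarrow> prob_space \<nu> \<and> space \<nu> = betaX \<and>
     sets \<nu> = borel_sets beta_topology \<and> regular_measure beta_topology \<nu>"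

definition ext_invariant :: "('g, 'b) monoid_scheme \<Rightarrow> ('g \<Rightarrow> 'x \<Rightarrow> 'x) \<Rightarrow> 'x set set measure \<Rightarrow> bool" where
  "ext_invariant G phi \<nu> \<longleftrightarrow>
     (\<forall>g \<in> carrier G. \<forall>A \<in> sets \<nu>. emeasure \<nu> (ext_map (phi g) ` A) = emeasure \<nu> A)"

text \<open>Edges of the graphing of the extended action, as a symmetric set of ordered pairs
  (an unordered edge {w,w'} is represented by both (w,w') and (w',w)).\<close>
definition graphing_edges :: "('g \<Rightarrow> 'x \<Rightarrow> 'x) \<Rightarrow> 'g set \<Rightarrow> ('x set set \<times> 'x set set) set" where
  "graphing_edges phi S = {(\<omega>, \<omega>'). \<omega> \<in> betaX \<and> \<omega>' \<in> betaX \<and> \<omega> \<noteq> \<omega>' \<and>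
                             (\<exists>s\<in>S. ext_map (phi s) \<omega> = \<omega>')}"

definition degree_in :: "('a \<times> 'a) set \<Rightarrow> 'a \<Rightarrow> nat" where
  "degree_in W \<omega> = card {\<omega>'. (\<omega>, \<omega>') \<in> W}"

definition edge_measure :: "'a measure \<Rightarrow> ('a \<times> 'a) set \<Rightarrow> ennreal" where
  "edge_measure \<nu> W = (1/2) * (\<integral>\<^sup>+ \<omega>. ennreal (real (degree_in W \<omega>)) \<partial>\<nu>)"

definition ext_hyperfinite :: "('g \<Rightarrow> 'x \<Rightarrow> 'x) \<Rightarrow> 'g set \<Rightarrow> 'x set set measure \<Rightarrow> bool" where
  "ext_hyperfinite phi S \<nu> \<longleftrightarrow>
     (\<forall>\<epsilon>::real. \<epsilon> > 0 \<longrightarrow> (\<exists>K::nat. \<exists>W.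
        W \<subseteq> graphing_edges phi S \<and> sym W \<and>
        W \<in> borel_sets (prod_topology beta_topology beta_topology) \<and>
        edge_measure \<nu> (graphing_edges phi S - W) < ennreal \<epsilon> \<and>
        (\<forall>\<omega> \<in> betaX. finite {\<omega>'. (\<omega>, \<omega>') \<in> W\<^sup>*} \<and> card {\<omega>'. (\<omega>, \<omega>') \<in> W\<^sup>*} \<le> K)))"

end

theory Submission
  imports Defs
begin

text \<open>Everything passes through means that are invariant under the generators.

  A mean becomes a regular Borel measure on the space of ultrafilters by approximating open sets from
  inside by clopen ones; deleting the edges that meet the clopen set of \<open>Y\<close> leaves small components because
  finitely many relations between points of an orbit of an ultrafilter already hold at almost every point of \<open>X\<close>.
  Conversely a Borel subgraph is replaced by an open set \<open>Q\<close> of small measure containing its missing edges,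
  and compactness gives a clopen neighbourhood of the complement of \<open>Q\<close> with small components; this uses
  that the fixed points of an extended bijection are clopen.

  A Foelner sequence yields a mean as a limit of uniform distributions. For the other direction, if no finite
  set were almost invariant and almost disjoint from the exceptional sets, then by max-flow min-cut there would be
  a bounded flow with positive excess outside the exceptional sets, contradicting invariance of the mean.\<close>

section \<open>Ultrafilters\<close>

text \<open>Near an ultrafilter \<open>\<omega>\<close> the graphing is described by finitely many
  statements such as "these two words agree at \<open>\<omega>\<close>" or "this word leads into a
  given clopen set". Each must be witnessed by a member of \<open>\<omega>\<close>, so that a single
  point of X can realise all of them at once. For agreement of words this is not automatic, and it
  is the reason for the covering of moved points by three sets.

  A Foelner set built from a mean must nearly avoid many exceptional sets simultaneously. Weights
  2^k, set against sets \<open>Y k\<close> of mean below 4^-(k+1), combine these demands into one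
  inequality, and the failure of that inequality for all finite sets is literally a cut condition.
  As the mean is only finitely additive, the resulting flow is rounded to finitely many values
  before it is integrated.

  Conversely the exceptional sets of different Foelner sets must be glued into one subset of X. This
  needs sizes tending to infinity, which holds when no nonempty finite set is invariant; otherwise
  the uniform distribution on such a set is already the required mean.\<close>

lemma betaX_iff: "\<omega> \<in> betaX \<longleftrightarrow> ultrafilter_on \<omega>"
  by (simp add: betaX_def)

lemma betaX_UNIV: "\<omega> \<in> betaX \<Longrightarrow> UNIV \<in> \<omega>"
  by (simp add: betaX_def ultrafilter_on_def)

lemma betaX_mono: "\<omega> \<in> betaX \<Longrightarrow> A \<in> \<omega> \<Longrightarrow> A \<subseteq> B \<Longrightarrow> B \<in> \<omega>"
  unfolding betaX_def ultrafilter_on_def by blast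

lemma betaX_Int: "\<omega> \<in> betaX \<Longrightarrow> A \<in> \<omega> \<Longrightarrow> B \<in> \<omega> \<Longrightarrow> A \<inter> B \<in> \<omega>"
  by (simp add: betaX_def ultrafilter_on_def)

lemma betaX_Int_iff: "\<omega> \<in> betaX \<Longrightarrow> A \<inter> B \<in> \<omega> \<longleftrightarrow> A \<in> \<omega> \<and> B \<in> \<omega>"
  using betaX_Int betaX_mono Int_lower1 Int_lower2 by metis

lemma betaX_empty: "\<omega> \<in> betaX \<Longrightarrow> {} \<notin> \<omega>"
  by (simp add: betaX_def ultrafilter_on_def)

lemma betaX_Compl_iff:
  assumes "\<omega> \<in> betaX"
  shows "- A \<in> \<omega> \<longleftrightarrow> A \<notin> \<omega>"
proof -
  have "A \<in> \<omega> \<or> - A \<in> \<omega>"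
    using assms by (simp add: betaX_def ultrafilter_on_def)
  moreover have "\<not> (A \<in> \<omega> \<and> - A \<in> \<omega>)"
    using betaX_Int[OF assms, of A "- A"] betaX_empty[OF assms] by auto
  ultimately show ?thesis by blast
qed

lemma betaX_Un_iff:
  assumes "\<omega> \<in> betaX"
  shows "A \<union> B \<in> \<omega> \<longleftrightarrow> A \<in> \<omega> \<or> B \<in> \<omega>"
proof -
  have "A \<union> B \<notin> \<omega> \<longleftrightarrow> - A \<inter> - B \<in> \<omega>"
    by (simp add: assms flip: betaX_Compl_iff)
  then show ?thesis
    by (simp add: assms betaX_Int_iff betaX_Compl_iff) blast
qed

lemma betaX_INT:
  assumes "\<omega> \<in> betaX" "finite I" "\<And>i. i \<in> I \<Longrightarrow> A i \<in> \<omega>"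
  shows "(\<Inter>i\<in>I. A i) \<in> \<omega>"
  using assms(2,3) by (induction I rule: finite_induct) (auto simp: betaX_UNIV betaX_Int_iff assms(1))

lemma betaX_nonempty_mem: "\<omega> \<in> betaX \<Longrightarrow> A \<in> \<omega> \<Longrightarrow> \<exists>x. x \<in> A"
  using betaX_empty[of \<omega>] by (cases "A = {}") auto

text \<open>Ultrafilters are maximal: a set in \<open>\<omega>'\<close> but not in
  \<open>\<omega>\<close> would have its complement in \<open>\<omega>\<close>, hence also in
  \<open>\<omega>'\<close>.\<close>

lemma betaX_eqI:
  assumes "\<omega> \<in> betaX" "\<omega>' \<in> betaX" "\<omega> \<subseteq> \<omega>'"
  shows "\<omega> = \<omega>'"
proof -
  have "A \<in> \<omega>" if "A \<in> \<omega>'" for A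
    using that assms(3) betaX_Compl_iff[OF assms(1), of A] betaX_Compl_iff[OF assms(2), of A] by blast
  then show ?thesis using assms(3) by blast
qed

text \<open>Zorn's lemma for families with the finite intersection property. The compactness of
  \<open>betaX\<close> and, later, the ultrafilter of points in large components both rest on
  it.\<close>

lemma ultrafilter_extends:
  assumes fip: "\<And>F. finite F \<Longrightarrow> F \<subseteq> C \<Longrightarrow> \<Inter>F \<noteq> {}"
  shows "\<exists>\<omega>\<in>betaX. C \<subseteq> \<omega>"
proof -
  define P where "P = {D. C \<subseteq> D \<and> (\<forall>F. finite F \<longrightarrow> F \<subseteq> D \<longrightarrow> \<Inter>F \<noteq> {})}"
  have "C \<in> P" using fip by (auto simp: P_def)
  moreover have "\<Union>Z \<in> P" if Z: "Z \<noteq> {}" "subset.chain P Z" for Z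
  proof -
    have "\<Inter>F \<noteq> {}" if F: "finite F" "F \<subseteq> \<Union>Z" for F
    proof -
      obtain D where "D \<in> Z" "F \<subseteq> D"
        using finite_subset_Union_chain[OF F \<open>Z \<noteq> {}\<close> \<open>subset.chain P Z\<close>] by blast
      moreover have "D \<in> P"
        using Z(2) \<open>D \<in> Z\<close> by (auto simp: subset_chain_def)
      ultimately show ?thesis
        using F(1) unfolding P_def by blast
    qed
    moreover have "C \<subseteq> \<Union>Z"
    proof -
      obtain D where "D \<in> Z" using Z(1) by blast
      moreover from this have "C \<subseteq> D"
        using Z(2) by (auto simp: subset_chain_def P_def)
      ultimately show ?thesis by blast
    qed
    ultimately show ?thesis unfolding P_def by blast
  qed
  ultimately obtain M where M: "M \<in> P" and max: "\<And>D. D \<in> P \<Longrightarrow> M \<subseteq> D \<Longrightarrow> D = M"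
    using subset_Zorn_nonempty[of P] by blast
  have fipM: "\<Inter>F \<noteq> {}" if "finite F" "F \<subseteq> M" for F
    using M that unfolding P_def by blast
  \<comment> \<open>By maximality a set that meets all finite intersections of \<open>M\<close> is
    already in \<open>M\<close>. The closure properties below and the dichotomy between
    \<open>A\<close> and \<open>- A\<close> come from this.\<close>
  have add: "B \<in> M" if B: "\<And>F. finite F \<Longrightarrow> F \<subseteq> M \<Longrightarrow> \<Inter>F \<inter> B \<noteq> {}" for B
  proof -
    have "\<Inter>F \<noteq> {}" if "finite F" "F \<subseteq> insert B M" for F
    proof -
      have "\<Inter>(F - {B}) \<inter> B \<noteq> {}" using that by (intro B) auto
      then show ?thesis by auto
    qed
    then have "insert B M \<in> P" using M unfolding P_def by blast
    then show ?thesis using max by blast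
  qed
  have "ultrafilter_on M"
    unfolding ultrafilter_on_def
  proof (intro conjI allI impI)
    show "UNIV \<in> M" using fipM by (intro add) simp
    show "{} \<notin> M" using fipM[of "{{}}"] by auto
    show up: "B \<in> M" if "A \<in> M" "A \<subseteq> B" for A B
    proof (rule add)
      show "\<Inter>F \<inter> B \<noteq> {}" if "finite F" "F \<subseteq> M" for F
      proof -
        have "\<Inter>(insert A F) \<noteq> {}" using that \<open>A \<in> M\<close> by (intro fipM) auto
        then show ?thesis using \<open>A \<subseteq> B\<close> by auto
      qed
    qed
    show "A \<inter> B \<in> M" if "A \<in> M" "B \<in> M" for A B
    proof (rule add)
      show "\<Inter>F \<inter> (A \<inter> B) \<noteq> {}" if "finite F" "F \<subseteq> M" for F
      proof -
        have "\<Inter>(insert A (insert B F)) \<noteq> {}" using that \<open>A \<in> M\<close> \<open>B \<in> M\<close> by (intro fipM) auto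
        then show ?thesis by auto
      qed
    qed
    show "A \<in> M \<or> - A \<in> M" for A
    proof (rule ccontr)
      assume "\<not> (A \<in> M \<or> - A \<in> M)"
      then obtain F F' where "finite F" "F \<subseteq> M" "\<Inter>F \<inter> A = {}" "finite F'" "F' \<subseteq> M" "\<Inter>F' \<inter> - A = {}"
        using add by metis
      moreover have "\<Inter>(F \<union> F') \<noteq> {}"
        using calculation by (intro fipM) auto
      then obtain x where "x \<in> \<Inter>F" "x \<in> \<Inter>F'" by auto
      ultimately show False by blast
    qed
  qed
  moreover have "C \<subseteq> M" using M unfolding P_def by blast
  ultimately show ?thesis by (auto simp: betaX_def)
qed

subsection \<open>The topology of the space of ultrafilters\<close>

lemma mem_basic_clopen: "\<omega> \<in> basic_clopen A \<longleftrightarrow> \<omega> \<in> betaX \<and> A \<in> \<omega>"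
  by (simp add: basic_clopen_def)

lemma basic_clopen_subset_betaX: "basic_clopen A \<subseteq> betaX"
  by (auto simp: basic_clopen_def)

lemma basic_clopen_UNIV: "basic_clopen UNIV = betaX"
  by (auto simp: basic_clopen_def betaX_UNIV)

lemma basic_clopen_empty: "basic_clopen {} = {}"
  by (auto simp: basic_clopen_def betaX_empty)

lemma basic_clopen_Int: "basic_clopen (A \<inter> B) = basic_clopen A \<inter> basic_clopen B"
  by (auto simp: basic_clopen_def betaX_Int_iff)

lemma basic_clopen_Un: "basic_clopen (A \<union> B) = basic_clopen A \<union> basic_clopen B"
  by (auto simp: basic_clopen_def betaX_Un_iff)

lemma basic_clopen_Compl: "basic_clopen (- A) = betaX - basic_clopen A"
  by (auto simp: basic_clopen_def betaX_Compl_iff)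

lemma basic_clopen_mono: "A \<subseteq> B \<Longrightarrow> basic_clopen A \<subseteq> basic_clopen B"
  by (intro subsetI) (metis betaX_mono mem_basic_clopen)

lemma basic_clopen_UN: "finite I \<Longrightarrow> basic_clopen (\<Union>i\<in>I. A i) = (\<Union>i\<in>I. basic_clopen (A i))"
  by (induction I rule: finite_induct) (auto simp: basic_clopen_empty basic_clopen_Un)

text \<open>Otherwise \<open>A\<close> and the complements of the members of \<open>\<B>\<close>
  have the finite intersection property, and an ultrafilter containing them is an uncovered point.
  Compactness is thus available as a finite cover among subsets of X, the form in which finite
  additivity can use it.\<close>

lemma basic_clopen_cover:
  assumes "basic_clopen A \<subseteq> (\<Union>B\<in>\<B>. basic_clopen B)"
  shows "\<exists>F. finite F \<and> F \<subseteq> \<B> \<and> A \<subseteq> \<Union>F"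
proof (rule ccontr)
  assume neg: "\<not> ?thesis"
  have "\<Inter>F \<noteq> {}" if F: "finite F" "F \<subseteq> insert A (uminus ` \<B>)" for F
  proof -
    have "uminus ` (F - {A}) \<subseteq> \<B>" using F by auto
    then have "\<not> A \<subseteq> \<Union>(uminus ` (F - {A}))"
      using neg F(1) by (meson finite_Diff finite_imageI)
    then obtain x where x: "x \<in> A" "x \<notin> \<Union>(uminus ` (F - {A}))" by blast
    have "x \<in> B" if "B \<in> F" for B
      using x that by (cases "B = A") auto
    then show ?thesis by blast
  qed
  then have "\<exists>\<omega>\<in>betaX. insert A (uminus ` \<B>) \<subseteq> \<omega>"
    by (rule ultrafilter_extends)
  then obtain \<omega> where w: "\<omega> \<in> betaX" "A \<in> \<omega>" "uminus ` \<B> \<subseteq> \<omega>" by auto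
  then obtain B where B: "B \<in> \<B>" "B \<in> \<omega>"
    using assms by (auto simp: basic_clopen_def)
  then have "- B \<in> \<omega>" using w(3) by blast
  then show False
    using betaX_Compl_iff[OF w(1), of B] B(2) by simp
qed

lemma basic_clopen_subset_iff: "basic_clopen A \<subseteq> basic_clopen B \<longleftrightarrow> A \<subseteq> B"
proof
  assume "basic_clopen A \<subseteq> basic_clopen B"
  then show "A \<subseteq> B"
    using basic_clopen_cover[of A "{B}"] by (auto simp: subset_singleton_iff)
qed (rule basic_clopen_mono)

lemma openin_basic_clopen: "openin beta_topology (basic_clopen A)"
  unfolding beta_topology_def by (rule topology_generated_by_Basis) simp

lemma topspace_beta: "topspace beta_topology = betaX"
  unfolding beta_topology_def topology_generated_by_topspace
  using basic_clopen_UNIV basic_clopen_subset_betaX by blast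

text \<open>The generating family is closed under finite intersections, so it is a base and not
  merely a subbase.\<close>

lemma openin_beta_nbhd:
  assumes "openin beta_topology O'" "\<omega> \<in> O'"
  shows "\<exists>A\<in>\<omega>. basic_clopen A \<subseteq> O'"
proof -
  have "generate_topology_on (range basic_clopen) O'"
    using assms(1) unfolding beta_topology_def by (rule openin_topology_generated_by)
  then have "\<forall>\<omega>\<in>O'. \<exists>A\<in>\<omega>. basic_clopen A \<subseteq> O'"
  proof induction
    case (Int a b)
    show ?case
    proof
      fix \<omega> assume w: "\<omega> \<in> a \<inter> b"
      obtain A B where AB: "A \<in> \<omega>" "basic_clopen A \<subseteq> a" "B \<in> \<omega>" "basic_clopen B \<subseteq> b"
        using Int.IH w by (meson IntD1 IntD2)
      have "openin beta_topology a"
        using Int.hyps(1) by (simp add: beta_topology_def openin_topology_generated_by_iff)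
      then have "\<omega> \<in> betaX"
        using w openin_subset[of beta_topology a] by (auto simp: topspace_beta)
      then have "A \<inter> B \<in> \<omega>" using betaX_Int AB(1,3) by blast
      moreover have "basic_clopen (A \<inter> B) \<subseteq> a \<inter> b"
        unfolding basic_clopen_Int using AB(2,4) by (rule Int_mono)
      ultimately show "\<exists>A\<in>\<omega>. basic_clopen A \<subseteq> a \<inter> b" by (rule bexI[rotated])
    qed
  next
    case (UN K)
    show ?case
    proof
      fix \<omega> assume "\<omega> \<in> \<Union>K"
      then obtain k where k: "k \<in> K" "\<omega> \<in> k" by auto
      then obtain A where "A \<in> \<omega>" "basic_clopen A \<subseteq> k" using UN.IH[OF k(1)] by auto
      then show "\<exists>A\<in>\<omega>. basic_clopen A \<subseteq> \<Union>K" using k(1) by auto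
    qed
  next
    case (Basis s) then show ?case by (auto simp: mem_basic_clopen)
  qed simp
  then show ?thesis using assms(2) by blast
qed

lemma openin_beta_eq_UN:
  assumes "openin beta_topology O'"
  shows "O' = (\<Union>A\<in>{A. basic_clopen A \<subseteq> O'}. basic_clopen A)"
proof (intro equalityI subsetI)
  fix \<omega> assume w: "\<omega> \<in> O'"
  then have "\<omega> \<in> betaX"
    using openin_subset[OF assms] by (auto simp: topspace_beta)
  moreover obtain A where "A \<in> \<omega>" "basic_clopen A \<subseteq> O'"
    using openin_beta_nbhd[OF assms w] by blast
  ultimately show "\<omega> \<in> (\<Union>A\<in>{A. basic_clopen A \<subseteq> O'}. basic_clopen A)"
    by (auto simp: mem_basic_clopen)
qed blast

lemma compact_space_beta: "compact_space (beta_topology :: 'x set set topology)"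
  unfolding compact_space_alt topspace_beta
proof (intro allI impI)
  fix \<U> :: "'x set set set set" assume "(\<forall>U\<in>\<U>. openin beta_topology U) \<and> betaX \<subseteq> \<Union>\<U>"
  then have \<U>: "\<forall>U\<in>\<U>. openin beta_topology U" and cov: "betaX \<subseteq> \<Union>\<U>" by auto
  define \<B> where "\<B> = {B. \<exists>U\<in>\<U>. basic_clopen B \<subseteq> U}"
  have "basic_clopen UNIV \<subseteq> (\<Union>B\<in>\<B>. basic_clopen B)"
  proof
    fix \<omega> assume "\<omega> \<in> basic_clopen (UNIV :: 'x set)"
    then have w: "\<omega> \<in> betaX" by (simp add: basic_clopen_UNIV)
    then obtain U where U: "U \<in> \<U>" "\<omega> \<in> U" using cov by blast
    have "openin beta_topology U" using U \<U> by blast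
    then obtain A where "A \<in> \<omega>" "basic_clopen A \<subseteq> U"
      using openin_beta_nbhd[OF _ U(2)] by blast
    then have "A \<in> \<B>" "\<omega> \<in> basic_clopen A"
      using w U(1) by (auto simp: \<B>_def mem_basic_clopen)
    then show "\<omega> \<in> (\<Union>B\<in>\<B>. basic_clopen B)" by blast
  qed
  then obtain F where F: "finite F" "F \<subseteq> \<B>" "UNIV \<subseteq> \<Union>F"
    using basic_clopen_cover[of UNIV \<B>] by metis
  have "\<forall>B\<in>F. \<exists>U. U \<in> \<U> \<and> basic_clopen B \<subseteq> U"
    using F(2) unfolding \<B>_def by blast
  then obtain u where u: "\<And>B. B \<in> F \<Longrightarrow> u B \<in> \<U> \<and> basic_clopen B \<subseteq> u B"
    by metis
  have "(\<Union>B\<in>F. B) = UNIV" using F(3) by auto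
  then have "betaX = basic_clopen (\<Union>B\<in>F. B)"
    by (simp only: basic_clopen_UNIV)
  also have "\<dots> \<subseteq> \<Union>(u ` F)"
    unfolding basic_clopen_UN[OF F(1)] using u by blast
  finally show "\<exists>\<F>. finite \<F> \<and> \<F> \<subseteq> \<U> \<and> betaX \<subseteq> \<Union>\<F>"
    using u F(1) by (intro exI[of _ "u ` F"] conjI) blast+
qed

lemma Hausdorff_space_beta: "Hausdorff_space (beta_topology :: 'x set set topology)"
  unfolding Hausdorff_space_def topspace_beta
proof (intro allI impI)
  fix \<omega> \<omega>' :: "'x set set" assume "\<omega> \<in> betaX \<and> \<omega>' \<in> betaX \<and> \<omega> \<noteq> \<omega>'"
  then have w: "\<omega> \<in> betaX" "\<omega>' \<in> betaX" and "\<omega> \<noteq> \<omega>'" by auto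
  then have "\<not> \<omega> \<subseteq> \<omega>'" using betaX_eqI[OF w] by blast
  then obtain A where "A \<in> \<omega>" "A \<notin> \<omega>'" by blast
  then show "\<exists>U V. openin beta_topology U \<and> openin beta_topology V \<and> \<omega> \<in> U \<and> \<omega>' \<in> V \<and> disjnt U V"
    by (rule_tac x = "basic_clopen A" in exI, rule_tac x = "basic_clopen (- A)" in exI)
      (use w in \<open>auto simp: openin_basic_clopen disjnt_def mem_basic_clopen betaX_Compl_iff\<close>)
qed

subsection \<open>Extensions of bijections\<close>

text \<open>Preimages commute with all Boolean operations, which makes this form easier to use than
  the images in the definition.\<close>

lemma mem_ext_map:
  assumes "bij s"
  shows "A \<in> ext_map s \<omega> \<longleftrightarrow> s -` A \<in> \<omega>"
proof -
  have "s -` (s ` B) = B" "s ` (s -` A) = A" for B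
    using assms by (auto simp: bij_def inj_vimage_image_eq surj_image_vimage_eq)
  then show ?thesis
    unfolding ext_map_def by (metis image_iff)
qed

lemma ext_map_in_betaX:
  assumes s: "bij s" and w: "\<omega> \<in> betaX"
  shows "ext_map s \<omega> \<in> betaX"
  unfolding betaX_iff ultrafilter_on_def mem_ext_map[OF s]
proof (intro conjI allI impI)
  show "s -` UNIV \<in> \<omega>" "s -` {} \<notin> \<omega>"
    using betaX_UNIV[OF w] betaX_empty[OF w] by simp_all
  show "s -` B \<in> \<omega>" if "s -` A \<in> \<omega>" "A \<subseteq> B" for A B
    using betaX_mono[OF w that(1)] that(2) by (simp add: vimage_mono)
  show "s -` (A \<inter> B) \<in> \<omega>" if "s -` A \<in> \<omega>" "s -` B \<in> \<omega>" for A B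
    using that by (simp add: betaX_Int_iff[OF w])
  show "s -` A \<in> \<omega> \<or> s -` (- A) \<in> \<omega>" for A
    by (simp add: vimage_Compl betaX_Compl_iff[OF w])
qed

lemma ext_map_comp: "ext_map s (ext_map t \<omega>) = ext_map (s \<circ> t) \<omega>"
  by (simp add: ext_map_def image_comp comp_def image_image)

lemma ext_map_id: "ext_map id \<omega> = \<omega>"
  by (simp add: ext_map_def)

lemma ext_map_cong_set:
  assumes "bij s" "bij t" "\<omega> \<in> betaX" "{x. s x = t x} \<in> \<omega>"
  shows "ext_map s \<omega> = ext_map t \<omega>"
proof (rule betaX_eqI)
  show "ext_map s \<omega> \<subseteq> ext_map t \<omega>"
  proof
    fix A assume "A \<in> ext_map s \<omega>"
    then have "s -` A \<inter> {x. s x = t x} \<in> \<omega>"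
      using assms by (simp add: mem_ext_map betaX_Int_iff)
    then have "t -` A \<in> \<omega>"
      by (rule betaX_mono[OF assms(3)]) auto
    then show "A \<in> ext_map t \<omega>" using assms by (simp add: mem_ext_map)
  qed
qed (use assms in \<open>simp_all add: ext_map_in_betaX\<close>)

lemma ext_map_image_basic_clopen:
  assumes "bij s"
  shows "ext_map s ` basic_clopen A = basic_clopen (s ` A)"
proof
  show "ext_map s ` basic_clopen A \<subseteq> basic_clopen (s ` A)"
    using assms by (auto simp: basic_clopen_def ext_map_in_betaX mem_ext_map bij_def inj_vimage_image_eq)
  show "basic_clopen (s ` A) \<subseteq> ext_map s ` basic_clopen A"
  proof
    fix \<omega> assume w: "\<omega> \<in> basic_clopen (s ` A)"
    have i: "bij (inv_into UNIV s)" "s \<circ> inv_into UNIV s = id"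
      using assms by (simp_all add: bij_imp_bij_inv bij_is_surj flip: surj_iff)
    have "ext_map s (ext_map (inv_into UNIV s) \<omega>) = \<omega>"
      by (simp add: ext_map_comp i ext_map_id)
    moreover have "ext_map (inv_into UNIV s) \<omega> \<in> basic_clopen A"
      using w i assms bij_vimage_eq_inv_image[OF i(1)]
      by (simp add: basic_clopen_def ext_map_in_betaX mem_ext_map inv_inv_eq)
    ultimately show "\<omega> \<in> ext_map s ` basic_clopen A" by (metis imageI)
  qed
qed

lemma bij_betw_ext_map:
  assumes "bij s"
  shows "bij_betw (ext_map s) betaX betaX"
proof -
  have "inv_into UNIV s \<circ> s = id" using assms by (simp add: bij_is_inj)
  then have "inj_on (ext_map s) betaX"
    by (metis ext_map_comp ext_map_id inj_on_inverseI)
  moreover have "ext_map s ` betaX = betaX"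
    using ext_map_image_basic_clopen[OF assms, of UNIV]
    by (simp only: bij_is_surj[OF assms] basic_clopen_UNIV)
  ultimately show ?thesis by (simp add: bij_betw_def)
qed

lemma openin_ext_map_image:
  assumes "bij s" "openin beta_topology O'"
  shows "openin beta_topology (ext_map s ` O')"
  using assms openin_basic_clopen
  by (subst openin_beta_eq_UN[OF assms(2)]) (auto simp: image_UN ext_map_image_basic_clopen)

lemma continuous_map_ext_map:
  assumes "bij s"
  shows "continuous_map beta_topology beta_topology (ext_map s)"
  unfolding continuous_map_def topspace_beta
proof (intro conjI allI impI)
  show "ext_map s \<in> betaX \<rightarrow> betaX" using ext_map_in_betaX[OF assms] by auto
  fix U :: "'a set set set" assume U: "openin beta_topology U"
  have i: "bij (inv_into UNIV s)" using assms by (rule bij_imp_bij_inv)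
  have "s \<circ> inv_into UNIV s = id" "inv_into UNIV s \<circ> s = id"
    using assms by (simp_all add: bij_is_inj bij_is_surj flip: surj_iff)
  then have c: "ext_map s (ext_map (inv_into UNIV s) \<omega>) = \<omega>" "ext_map (inv_into UNIV s) (ext_map s \<omega>) = \<omega>" for \<omega>
    by (simp_all add: ext_map_comp ext_map_id)
  have "U \<subseteq> betaX" using openin_subset[OF U] by (simp add: topspace_beta)
  have "{x \<in> betaX. ext_map s x \<in> U} = ext_map (inv_into UNIV s) ` U"
  proof (intro equalityI subsetI)
    fix x assume "x \<in> {x \<in> betaX. ext_map s x \<in> U}"
    then show "x \<in> ext_map (inv_into UNIV s) ` U" using c(2)[of x] by (metis (mono_tags) imageI mem_Collect_eq)
  next
    fix x assume "x \<in> ext_map (inv_into UNIV s) ` U"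
    then show "x \<in> {x \<in> betaX. ext_map s x \<in> U}"
      using \<open>U \<subseteq> betaX\<close> c(1) ext_map_in_betaX[OF i] by auto
  qed
  then show "openin beta_topology {x \<in> betaX. ext_map s x \<in> U}"
    using openin_ext_map_image[OF i U] by simp
qed

text \<open>A maximal set \<open>A\<close> disjoint from its image yields three sets covering the points moved by \<open>s\<close>.
  Hence the fixed points of the extension of \<open>s\<close> form a clopen set.\<close>

lemma moved_points_cover:
  "\<exists>A. A \<inter> s ` A = {} \<and> {x. s x \<noteq> x} \<subseteq> A \<union> s ` A \<union> s -` A"
proof -
  define P where "P = {A. A \<inter> s ` A = {}}"
  have "{} \<in> P" by (simp add: P_def)
  moreover have "\<Union>Z \<in> P" if "Z \<noteq> {}" "subset.chain P Z" for Z
  proof -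
    have "x \<noteq> s y" if "x \<in> A" "y \<in> B" "A \<in> Z" "B \<in> Z" for x y A B
    proof -
      have "A \<subseteq> B \<or> B \<subseteq> A"
        using \<open>subset.chain P Z\<close> that(3,4) by (auto simp: subset_chain_def)
      moreover have "A \<inter> s ` A = {}" "B \<inter> s ` B = {}"
        using \<open>subset.chain P Z\<close> that(3,4) by (auto simp: subset_chain_def P_def)
      ultimately show ?thesis using that by blast
    qed
    then show ?thesis by (auto simp: P_def)
  qed
  ultimately obtain A where A: "A \<in> P" and max: "\<And>B. B \<in> P \<Longrightarrow> A \<subseteq> B \<Longrightarrow> B = A"
    using subset_Zorn_nonempty[of P] by blast
  have "x \<in> A \<union> s ` A \<union> s -` A" if "s x \<noteq> x" for x
  proof (rule ccontr)
    assume *: "x \<notin> A \<union> s ` A \<union> s -` A"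
    then have "insert x A \<in> P"
      using A that by (auto simp: P_def)
    then show False using max * by blast
  qed
  then show ?thesis using A by (auto simp: P_def)
qed

text \<open>If \<open>\<omega>\<close> is fixed, then \<open>A\<close>, its image and its preimage
  are either all in \<open>\<omega>\<close> or all outside. The first is impossible because
  \<open>A\<close> is disjoint from its image, so the moved points, covered by the three sets, are
  not in \<open>\<omega>\<close>.\<close>

lemma ext_map_fixed_iff:
  assumes s: "bij s" and w: "\<omega> \<in> betaX"
  shows "ext_map s \<omega> = \<omega> \<longleftrightarrow> {x. s x = x} \<in> \<omega>"
proof
  assume "{x. s x = x} \<in> \<omega>"
  then show "ext_map s \<omega> = \<omega>"
    using ext_map_cong_set[OF s bij_id w] by (simp add: ext_map_id)
next
  assume fix_w: "ext_map s \<omega> = \<omega>"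
  then have iff: "s -` B \<in> \<omega> \<longleftrightarrow> B \<in> \<omega>" for B
    using mem_ext_map[OF s, of B \<omega>] by (simp only: fix_w)
  obtain A where A: "A \<inter> s ` A = {}" "{x. s x \<noteq> x} \<subseteq> A \<union> s ` A \<union> s -` A"
    using moved_points_cover[of s] by auto
  have "s -` s ` A = A"
    using s by (simp add: bij_is_inj inj_vimage_image_eq)
  then have "A \<union> s ` A \<union> s -` A \<notin> \<omega>"
    using A(1) iff[of A] iff[of "s ` A"] betaX_Int[OF w, of A "s ` A"] betaX_empty[OF w]
    by (auto simp: betaX_Un_iff[OF w])
  then have "{x. s x \<noteq> x} \<notin> \<omega>"
    using A(2) betaX_mono[OF w, of "{x. s x \<noteq> x}"] by metis
  then show "{x. s x = x} \<in> \<omega>"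
    using betaX_Compl_iff[OF w, of "{x. s x = x}"] by (simp add: Compl_eq)
qed

text \<open>Reduction to the fixed points of \<open>s\<close> followed by the inverse of
  \<open>t\<close>. The direction from left to right makes a coincidence at \<open>\<omega>\<close>
  visible on a member of \<open>\<omega>\<close>.\<close>

lemma ext_map_eq_iff:
  assumes s: "bij s" and t: "bij t" and w: "\<omega> \<in> betaX"
  shows "ext_map s \<omega> = ext_map t \<omega> \<longleftrightarrow> {x. s x = t x} \<in> \<omega>"
proof
  have it: "bij (inv_into UNIV t)" "inv_into UNIV t \<circ> t = id"
    using t by (simp_all add: bij_imp_bij_inv bij_is_inj)
  assume "ext_map s \<omega> = ext_map t \<omega>"
  then have "ext_map (inv_into UNIV t \<circ> s) \<omega> = \<omega>"
    by (metis ext_map_comp ext_map_id it(2))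
  moreover have "{x. (inv_into UNIV t \<circ> s) x = x} = {x. s x = t x}"
    using t by (metis (no_types, opaque_lifting) bij_inv_eq_iff comp_apply)
  ultimately show "{x. s x = t x} \<in> \<omega>"
    using ext_map_fixed_iff[OF bij_comp[OF s it(1)] w] by simp
qed (rule ext_map_cong_set[OF s t w])

section \<open>Finitely additive means\<close>

lemma mean_nonneg: "mean \<mu> \<Longrightarrow> 0 \<le> \<mu> A"
  by (simp add: mean_def)

lemma mean_le_1: "mean \<mu> \<Longrightarrow> \<mu> A \<le> 1"
  by (simp add: mean_def)

lemma mean_UNIV: "mean \<mu> \<Longrightarrow> \<mu> UNIV = 1"
  by (simp add: mean_def)

lemma mean_Un: "mean \<mu> \<Longrightarrow> A \<inter> B = {} \<Longrightarrow> \<mu> (A \<union> B) = \<mu> A + \<mu> B"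
  by (simp add: mean_def)

lemma mean_empty: "mean \<mu> \<Longrightarrow> \<mu> {} = 0"
  using mean_Un[of \<mu> "{}" "{}"] by simp

lemma mean_mono:
  assumes "mean \<mu>" "A \<subseteq> B"
  shows "\<mu> A \<le> \<mu> B"
proof -
  have "\<mu> (A \<union> (B - A)) = \<mu> A + \<mu> (B - A)" using assms(1) by (rule mean_Un) auto
  moreover have "A \<union> (B - A) = B" using assms(2) by auto
  ultimately show ?thesis using mean_nonneg[OF assms(1), of "B - A"] by simp
qed

lemma mean_Un_le:
  assumes "mean \<mu>"
  shows "\<mu> (A \<union> B) \<le> \<mu> A + \<mu> B"
proof -
  have "\<mu> (A \<union> (B - A)) = \<mu> A + \<mu> (B - A)" using assms by (rule mean_Un) auto
  moreover have "\<mu> (B - A) \<le> \<mu> B" using assms by (rule mean_mono) auto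
  ultimately show ?thesis by simp
qed

lemma mean_UN_le:
  assumes "mean \<mu>" "finite I"
  shows "\<mu> (\<Union>i\<in>I. A i) \<le> (\<Sum>i\<in>I. \<mu> (A i))"
  using assms(2)
proof (induction I rule: finite_induct)
  case empty then show ?case by (simp add: mean_empty[OF assms(1)])
next
  case (insert i I)
  then show ?case
    using mean_Un_le[OF assms(1), of "A i" "\<Union>i\<in>I. A i"] by simp
qed

lemma mean_UN_disjoint:
  assumes "mean \<mu>" "finite I" "disjoint_family_on A I"
  shows "\<mu> (\<Union>i\<in>I. A i) = (\<Sum>i\<in>I. \<mu> (A i))"
  using assms(2,3)
proof (induction I rule: finite_induct)
  case empty then show ?case by (simp add: mean_empty[OF assms(1)])
next
  case (insert i I)
  have "A i \<inter> (\<Union>j\<in>I. A j) = {}"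
    using insert.prems insert.hyps by (auto simp: disjoint_family_on_def)
  then show ?case
    using mean_Un[OF assms(1), of "A i" "\<Union>j\<in>I. A j"] insert
    by (simp add: disjoint_family_on_insert)
qed

section \<open>The Borel measure extending a mean\<close>

text \<open>On open sets this is the only value compatible with a regular measure giving
  \<open>basic_clopen A\<close> the mass \<open>\<mu> A\<close>, because a compact subset of an open
  set lies in a clopen one.\<close>

definition beta_content :: "('x set \<Rightarrow> real) \<Rightarrow> 'x set set set \<Rightarrow> ennreal" where
  "beta_content \<mu> O' = (SUP A\<in>{A. basic_clopen A \<subseteq> O'}. ennreal (\<mu> A))"

definition beta_outer :: "('x set \<Rightarrow> real) \<Rightarrow> 'x set set set \<Rightarrow> ennreal" where
  "beta_outer \<mu> E = (INF O'\<in>{O'. openin beta_topology O' \<and> E \<subseteq> O'}. beta_content \<mu> O')"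

lemma beta_content_mono: "E \<subseteq> F \<Longrightarrow> beta_content \<mu> E \<le> beta_content \<mu> F"
  unfolding beta_content_def by (rule SUP_subset_mono) auto

lemma beta_content_upper: "basic_clopen A \<subseteq> E \<Longrightarrow> ennreal (\<mu> A) \<le> beta_content \<mu> E"
  unfolding beta_content_def by (rule SUP_upper) simp

lemma beta_content_basic_clopen:
  assumes "mean \<mu>"
  shows "beta_content \<mu> (basic_clopen A) = ennreal (\<mu> A)"
proof (rule antisym)
  show "beta_content \<mu> (basic_clopen A) \<le> ennreal (\<mu> A)"
    unfolding beta_content_def
    using assms by (intro SUP_least) (auto simp: basic_clopen_subset_iff intro: mean_mono ennreal_leI)
qed (rule beta_content_upper, simp)

text \<open>Here compactness turns finite additivity into countable subadditivity: a clopen set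
  inside the union is covered by finitely many clopen sets, each lying in a single
  \<open>Q i\<close>.\<close>

lemma beta_content_UN:
  fixes Q :: "nat \<Rightarrow> 'x set set set"
  assumes \<mu>: "mean \<mu>" and op: "\<And>i. openin beta_topology (Q i)"
  shows "beta_content \<mu> (\<Union>i. Q i) \<le> (\<Sum>i. beta_content \<mu> (Q i))"
  unfolding beta_content_def[of \<mu> "\<Union>i. Q i"]
proof (rule SUP_least)
  fix A assume "A \<in> {A. basic_clopen A \<subseteq> (\<Union>i. Q i)}"
  then have A: "basic_clopen A \<subseteq> (\<Union>i. Q i)" by simp
  define \<B> where "\<B> = {B. \<exists>i. basic_clopen B \<subseteq> Q i}"
  have "basic_clopen A \<subseteq> (\<Union>B\<in>\<B>. basic_clopen B)"
  proof
    fix \<omega> assume w: "\<omega> \<in> basic_clopen A"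
    then obtain i where i: "\<omega> \<in> Q i" using A by (meson UN_E subsetD)
    obtain B where B: "B \<in> \<omega>" "basic_clopen B \<subseteq> Q i"
      using openin_beta_nbhd[OF op i] by (elim bexE)
    have "B \<in> \<B>" using B(2) unfolding \<B>_def by (intro CollectI exI)
    moreover have "\<omega> \<in> basic_clopen B" using w B(1) by (simp add: mem_basic_clopen)
    ultimately show "\<omega> \<in> (\<Union>B\<in>\<B>. basic_clopen B)" by (rule UN_I)
  qed
  then have "\<exists>F. finite F \<and> F \<subseteq> \<B> \<and> A \<subseteq> \<Union>F" by (rule basic_clopen_cover)
  then obtain F where F: "finite F" "F \<subseteq> \<B>" "A \<subseteq> \<Union>F"
    by (elim exE conjE)
  have "\<exists>i. basic_clopen B \<subseteq> Q i" if "B \<in> F" for B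
    using subsetD[OF F(2) that] by (simp only: \<B>_def mem_Collect_eq)
  then obtain k where k: "\<And>B. B \<in> F \<Longrightarrow> basic_clopen B \<subseteq> Q (k B)" by metis
  \<comment> \<open>The finite cover is regrouped by the chosen index, so that each
    \<open>Q i\<close> is charged only once even if it contains several members of
    \<open>F\<close>.\<close>
  define C where "C i = \<Union>{B\<in>F. k B = i}" for i
  have C: "basic_clopen (C i) \<subseteq> Q i" for i
  proof -
    have "finite {B\<in>F. k B = i}" using F(1) by simp
    from basic_clopen_UN[OF this, of "\<lambda>B. B"]
    have "basic_clopen (\<Union>B\<in>{B\<in>F. k B = i}. B) \<subseteq> Q i"
      using k by (simp only:) (intro UN_least, simp, metis)
    then show ?thesis by (simp add: C_def)
  qed
  have "A \<subseteq> (\<Union>i\<in>k ` F. C i)"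
  proof
    fix x assume "x \<in> A"
    then obtain B where "B \<in> F" "x \<in> B" using F(3) by (meson UnionE subsetD)
    then have "x \<in> C (k B)" by (auto simp: C_def)
    then show "x \<in> (\<Union>i\<in>k ` F. C i)" using \<open>B \<in> F\<close> by (intro UN_I[of "k B"] imageI)
  qed
  then have "\<mu> A \<le> \<mu> (\<Union>i\<in>k ` F. C i)" by (rule mean_mono[OF \<mu>])
  also have "\<dots> \<le> (\<Sum>i\<in>k ` F. \<mu> (C i))" using \<mu> F(1) by (intro mean_UN_le) auto
  finally have "ennreal (\<mu> A) \<le> ennreal (\<Sum>i\<in>k ` F. \<mu> (C i))" by (rule ennreal_leI)
  also have "\<dots> = (\<Sum>i\<in>k ` F. ennreal (\<mu> (C i)))"
    by (simp add: mean_nonneg[OF \<mu>])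
  also have "\<dots> \<le> (\<Sum>i\<in>k ` F. beta_content \<mu> (Q i))"
    by (intro sum_mono beta_content_upper C)
  also have "\<dots> \<le> (\<Sum>i. beta_content \<mu> (Q i))"
    using F(1) by (intro sum_le_suminf) auto
  finally show "ennreal (\<mu> A) \<le> (\<Sum>i. beta_content \<mu> (Q i))" .
qed

lemma beta_outer_open:
  assumes "openin beta_topology O'"
  shows "beta_outer \<mu> O' = beta_content \<mu> O'"
  unfolding beta_outer_def
  using assms by (intro antisym INF_lower INF_greatest) (auto intro: beta_content_mono)

lemma beta_outer_le: "openin beta_topology O' \<Longrightarrow> E \<subseteq> O' \<Longrightarrow> beta_outer \<mu> E \<le> beta_content \<mu> O'"
  unfolding beta_outer_def by (rule INF_lower) simp

lemma beta_outer_mono: "E \<subseteq> F \<Longrightarrow> beta_outer \<mu> E \<le> beta_outer \<mu> F"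
  unfolding beta_outer_def by (rule INF_superset_mono) auto

lemma beta_outer_empty: "mean \<mu> \<Longrightarrow> beta_outer \<mu> {} = 0"
  using beta_content_basic_clopen[of \<mu> "{}"] openin_basic_clopen[of "{}"]
  by (simp add: beta_outer_open basic_clopen_empty mean_empty)

lemma beta_outer_approx:
  assumes "beta_outer \<mu> E < c"
  obtains Q where "openin beta_topology Q" "E \<subseteq> Q" "beta_content \<mu> Q < c"
  using assms unfolding beta_outer_def INF_less_iff by auto

lemma outer_measure_space_beta:
  assumes \<mu>: "mean \<mu>"
  shows "outer_measure_space (Pow betaX) (beta_outer \<mu>)"
  unfolding outer_measure_space_def
proof (intro conjI)
  show "positive (Pow betaX) (beta_outer \<mu>)"
    by (simp add: positive_def beta_outer_empty[OF \<mu>])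
  show "increasing (Pow betaX) (beta_outer \<mu>)"
    by (simp add: increasing_def beta_outer_mono)
  show "countably_subadditive (Pow betaX) (beta_outer \<mu>)"
    unfolding countably_subadditive_def
  proof (intro allI impI)
    fix A :: "nat \<Rightarrow> 'a set set set"
    show "beta_outer \<mu> (\<Union>i. A i) \<le> (\<Sum>n. beta_outer \<mu> (A n))"
    proof (rule ennreal_le_epsilon)
      fix e :: real assume e: "0 < e" and fin: "(\<Sum>n. beta_outer \<mu> (A n)) < top_class.top"
      \<comment> \<open>Finiteness of the sum makes every term finite, so adding a share is a strict
        increase; the shares e/2^(n+1) add up to \<open>e\<close>.\<close>
      then have *: "beta_outer \<mu> (A n) < beta_outer \<mu> (A n) + e * (1/2)^Suc n" for n
        by (auto simp add: less_top dest!: ennreal_suminf_lessD)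
      have "\<exists>Q. openin beta_topology Q \<and> A n \<subseteq> Q \<and> beta_content \<mu> Q < beta_outer \<mu> (A n) + e * (1/2)^Suc n" for n
        using beta_outer_approx[OF *[of n]] by metis
      then obtain Q where Q: "\<And>n. openin beta_topology (Q n)" "\<And>n. A n \<subseteq> Q n"
        "\<And>n. beta_content \<mu> (Q n) < beta_outer \<mu> (A n) + e * (1/2)^Suc n" by metis
      have "beta_outer \<mu> (\<Union>i. A i) \<le> beta_content \<mu> (\<Union>i. Q i)"
        using Q(1,2) by (intro beta_outer_le openin_Union UN_mono) auto
      also have "\<dots> \<le> (\<Sum>i. beta_content \<mu> (Q i))"
        by (rule beta_content_UN[OF \<mu> Q(1)])
      also have "\<dots> \<le> (\<Sum>n. beta_outer \<mu> (A n) + e * (1/2) ^ Suc n)"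
        using Q(3) by (intro suminf_le allI less_imp_le) auto
      also have "... = (\<Sum>n. beta_outer \<mu> (A n)) + (\<Sum>n. ennreal e * ennreal ((1/2) ^ Suc n))"
        using e by (subst suminf_add[symmetric])
                   (auto simp del: ennreal_suminf_cmult simp add: ennreal_mult[symmetric])
      also have "\<dots> = (\<Sum>n. beta_outer \<mu> (A n)) + e"
        unfolding ennreal_suminf_cmult
        by (subst suminf_ennreal_eq[OF zero_le_power power_half_series]) auto
      finally show "beta_outer \<mu> (\<Union>i. A i) \<le> (\<Sum>n. beta_outer \<mu> (A n)) + e" .
    qed
  qed
qed

lemma beta_outer_Un_le:
  assumes \<mu>: "mean \<mu>" and "A \<subseteq> betaX" "B \<subseteq> betaX"
  shows "beta_outer \<mu> (A \<union> B) \<le> beta_outer \<mu> A + beta_outer \<mu> B"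
proof -
  have "subadditive (Pow betaX) (beta_outer \<mu>)"
    using outer_measure_space_beta[OF \<mu>] unfolding outer_measure_space_def
    by (intro ring_of_sets.countably_subadditive_subadditive[OF algebra.axioms(1)[OF sigma_algebra.axioms(1)[OF sigma_algebra_Pow]]]) auto
  then have "beta_outer \<mu> (A \<union> (B - A)) \<le> beta_outer \<mu> A + beta_outer \<mu> (B - A)"
    using assms(2,3) by (intro subadditiveD) auto
  also have "\<dots> \<le> beta_outer \<mu> A + beta_outer \<mu> B"
    by (intro add_left_mono beta_outer_mono Diff_subset)
  finally show ?thesis by simp
qed

text \<open>An open set is split off a test set in two stages, approximating first
  the part inside and then the remaining open set from within by basic clopen sets.\<close>

lemma beta_content_split:
  assumes \<mu>: "mean \<mu>" and T: "openin beta_topology T" and O': "openin beta_topology O'"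
  shows "beta_outer \<mu> (T \<inter> O') + beta_outer \<mu> (T - O') \<le> beta_content \<mu> T"
proof -
  have ne: "{B. basic_clopen B \<subseteq> E} \<noteq> {}" for E :: "'a set set set"
    using basic_clopen_empty by (metis (mono_tags) empty_Collect_eq empty_subsetI)
  have "ennreal (\<mu> A) + beta_outer \<mu> (T - O') \<le> beta_content \<mu> T" if A: "basic_clopen A \<subseteq> T \<inter> O'" for A
  proof -
    have T': "openin beta_topology (T \<inter> basic_clopen (- A))"
      using T openin_basic_clopen by (rule openin_Int)
    have "T \<subseteq> betaX" using openin_subset[OF T] by (simp add: topspace_beta)
    then have "T - O' \<subseteq> T \<inter> basic_clopen (- A)"
      using A unfolding basic_clopen_Compl by auto
    then have "ennreal (\<mu> A) + beta_outer \<mu> (T - O') \<le> ennreal (\<mu> A) + beta_content \<mu> (T \<inter> basic_clopen (- A))"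
      by (intro add_left_mono beta_outer_le T')
    also have "\<dots> = (SUP B\<in>{B. basic_clopen B \<subseteq> T \<inter> basic_clopen (- A)}. ennreal (\<mu> A) + ennreal (\<mu> B))"
      unfolding beta_content_def by (rule ennreal_SUP_add_right[OF ne])
    also have "\<dots> \<le> beta_content \<mu> T"
    proof (rule SUP_least)
      fix B assume "B \<in> {B. basic_clopen B \<subseteq> T \<inter> basic_clopen (- A)}"
      then have "basic_clopen B \<subseteq> T \<inter> basic_clopen (- A)" by simp
      then have "basic_clopen B \<subseteq> T" "basic_clopen B \<subseteq> basic_clopen (- A)" by simp_all
      then have B: "basic_clopen B \<subseteq> T" "B \<subseteq> - A" by (simp_all only: basic_clopen_subset_iff)
      have "ennreal (\<mu> A) + ennreal (\<mu> B) = ennreal (\<mu> (A \<union> B))"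
        using B(2) by (subst mean_Un[OF \<mu>]) (auto simp: mean_nonneg[OF \<mu>])
      also have "\<dots> \<le> beta_content \<mu> T"
        using A B(1) by (intro beta_content_upper) (simp add: basic_clopen_Un)
      finally show "ennreal (\<mu> A) + ennreal (\<mu> B) \<le> beta_content \<mu> T" .
    qed
    finally show ?thesis .
  qed
  then have "(SUP A\<in>{A. basic_clopen A \<subseteq> T \<inter> O'}. ennreal (\<mu> A) + beta_outer \<mu> (T - O')) \<le> beta_content \<mu> T"
    by (intro SUP_least) simp
  moreover have "(SUP A\<in>{A. basic_clopen A \<subseteq> T \<inter> O'}. ennreal (\<mu> A) + beta_outer \<mu> (T - O'))
      = beta_content \<mu> (T \<inter> O') + beta_outer \<mu> (T - O')"
    unfolding beta_content_def by (rule ennreal_SUP_add_left[OF ne])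
  ultimately show ?thesis
    by (simp add: beta_outer_open[OF openin_Int[OF T O']])
qed

text \<open>Caratheodory's condition need only be checked on open test sets, since the outer measure
  of \<open>E\<close> is an infimum over its open supersets.\<close>

lemma openin_lambda_system:
  assumes \<mu>: "mean \<mu>" and O': "openin beta_topology O'"
  shows "O' \<in> lambda_system betaX (Pow betaX) (beta_outer \<mu>)"
proof -
  have sub: "O' \<subseteq> betaX" using openin_subset[OF O'] by (simp add: topspace_beta)
  have "beta_outer \<mu> (E \<inter> O') + beta_outer \<mu> (E - O') = beta_outer \<mu> E" if E: "E \<subseteq> betaX" for E
  proof (rule antisym)
    show "beta_outer \<mu> (E \<inter> O') + beta_outer \<mu> (E - O') \<le> beta_outer \<mu> E"
      unfolding beta_outer_def[of \<mu> E]
    proof (rule INF_greatest)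
      fix T assume "T \<in> {T. openin beta_topology T \<and> E \<subseteq> T}"
      then have T: "openin beta_topology T" "E \<subseteq> T" by auto
      have "beta_outer \<mu> (E \<inter> O') + beta_outer \<mu> (E - O') \<le> beta_outer \<mu> (T \<inter> O') + beta_outer \<mu> (T - O')"
        using T(2) by (intro add_mono beta_outer_mono Int_mono Diff_mono) auto
      also have "\<dots> \<le> beta_content \<mu> T" by (rule beta_content_split[OF \<mu> T(1) O'])
      finally show "beta_outer \<mu> (E \<inter> O') + beta_outer \<mu> (E - O') \<le> beta_content \<mu> T" .
    qed
    have "beta_outer \<mu> ((E \<inter> O') \<union> (E - O')) \<le> beta_outer \<mu> (E \<inter> O') + beta_outer \<mu> (E - O')"
      using E by (intro beta_outer_Un_le[OF \<mu>]) auto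
    then show "beta_outer \<mu> E \<le> beta_outer \<mu> (E \<inter> O') + beta_outer \<mu> (E - O')"
      by (simp add: Int_Diff_Un)
  qed
  then show ?thesis
    using sub by (simp add: algebra.lambda_system_eq[OF sigma_algebra.axioms(1)[OF sigma_algebra_Pow]])
qed

section \<open>The Borel measure of a mean, its regularity and its invariance\<close>

definition beta_measure :: "('x set \<Rightarrow> real) \<Rightarrow> 'x set set measure" where
  "beta_measure \<mu> = measure_of betaX (borel_sets beta_topology) (beta_outer \<mu>)"

lemma sigma_algebra_borel_sets: "sigma_algebra (topspace T) (borel_sets T)"
  unfolding borel_sets_def using openin_subset by (intro sigma_algebra_sigma_sets) auto

lemma sigma_algebra_borel_sets_beta: "sigma_algebra betaX (borel_sets beta_topology)"
  using sigma_algebra_borel_sets[of beta_topology] by (simp add: topspace_beta)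

lemma borel_sets_beta_subset: "borel_sets beta_topology \<subseteq> Pow betaX"
  unfolding borel_sets_def topspace_beta
  using sigma_sets_into_sp[of "{U. openin beta_topology U}" betaX] openin_subset[of beta_topology]
  by (auto simp: topspace_beta)

lemma space_beta_measure: "space (beta_measure \<mu>) = betaX"
  unfolding beta_measure_def by (rule space_measure_of[OF borel_sets_beta_subset])

lemma sets_beta_measure: "sets (beta_measure \<mu>) = borel_sets beta_topology"
  unfolding beta_measure_def
  by (rule sigma_algebra.sets_measure_of_eq[OF sigma_algebra_borel_sets_beta])

lemma emeasure_beta_measure:
  assumes \<mu>: "mean \<mu>" and A: "A \<in> borel_sets beta_topology"
  shows "emeasure (beta_measure \<mu>) A = beta_outer \<mu> A"
proof -
  let ?L = "lambda_system betaX (Pow betaX) (beta_outer \<mu>)"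
  have ms: "measure_space betaX ?L (beta_outer \<mu>)"
    by (rule sigma_algebra.caratheodory_lemma[OF sigma_algebra_Pow outer_measure_space_beta[OF \<mu>]])
  have "borel_sets beta_topology \<subseteq> ?L"
    unfolding borel_sets_def topspace_beta
    using ms openin_lambda_system[OF \<mu>]
    by (intro sigma_algebra.sigma_sets_subset) (auto simp: measure_space_def)
  then have "measure_space betaX (borel_sets beta_topology) (beta_outer \<mu>)"
    by (rule measure_down[OF ms sigma_algebra_borel_sets_beta])
  then show ?thesis
    unfolding beta_measure_def using A
    by (intro emeasure_measure_of_sigma) (auto simp: measure_space_def)
qed

lemma openin_imp_borel_sets: "openin T U \<Longrightarrow> U \<in> borel_sets T"
  unfolding borel_sets_def by (rule sigma_sets.Basic) simp

lemma emeasure_beta_measure_basic_clopen: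
  assumes "mean \<mu>"
  shows "emeasure (beta_measure \<mu>) (basic_clopen A) = ennreal (\<mu> A)"
  using emeasure_beta_measure[OF assms openin_imp_borel_sets[OF openin_basic_clopen]]
  by (simp add: beta_outer_open openin_basic_clopen beta_content_basic_clopen[OF assms])

lemma prob_space_beta_measure:
  assumes "mean \<mu>"
  shows "prob_space (beta_measure \<mu>)"
  using emeasure_beta_measure_basic_clopen[OF assms, of UNIV] mean_UNIV[OF assms]
  by (intro prob_spaceI) (simp add: space_beta_measure basic_clopen_UNIV)

text \<open>Outer regularity is built into \<open>beta_outer\<close>. Inner regularity follows by
  passing to complements, as the measure is finite and closed subsets of \<open>betaX\<close> are
  compact.\<close>

lemma beta_borel_prob_beta_measure:
  assumes \<mu>: "mean \<mu>"
  shows "beta_borel_prob (beta_measure \<mu>)"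
proof -
  interpret prob_space "beta_measure \<mu>" by (rule prob_space_beta_measure[OF \<mu>])
  let ?M = "beta_measure \<mu>"
  have outer: "emeasure ?M A = (INF U \<in> {U. openin beta_topology U \<and> A \<subseteq> U}. emeasure ?M U)"
    if "A \<in> sets ?M" for A
  proof -
    have "emeasure ?M A = beta_outer \<mu> A"
      using that by (simp add: sets_beta_measure emeasure_beta_measure[OF \<mu>])
    also have "\<dots> = (INF U \<in> {U. openin beta_topology U \<and> A \<subseteq> U}. emeasure ?M U)"
      unfolding beta_outer_def
      by (intro INF_cong refl)
        (auto simp: emeasure_beta_measure[OF \<mu>] openin_imp_borel_sets beta_outer_open)
    finally show ?thesis .
  qed
  have inner: "emeasure ?M A = (SUP K \<in> {K. compactin beta_topology K \<and> K \<subseteq> A}. emeasure ?M K)"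
    if A: "A \<in> sets ?M" for A
  proof (rule antisym)
    show "(SUP K \<in> {K. compactin beta_topology K \<and> K \<subseteq> A}. emeasure ?M K) \<le> emeasure ?M A"
      using A by (intro SUP_least) (auto intro: emeasure_mono)
    show "emeasure ?M A \<le> (SUP K \<in> {K. compactin beta_topology K \<and> K \<subseteq> A}. emeasure ?M K)"
    proof (rule ennreal_le_epsilon)
      fix e :: real assume e: "0 < e"
      have D: "betaX - A \<in> sets ?M" using sets.compl_sets[OF A] by (simp add: space_beta_measure)
      have "emeasure ?M (betaX - A) < emeasure ?M (betaX - A) + ennreal e"
        using e by (simp add: emeasure_eq_measure ennreal_less_iff flip: ennreal_plus)
      then obtain U where U: "openin beta_topology U" "betaX - A \<subseteq> U"
          "emeasure ?M U < emeasure ?M (betaX - A) + ennreal e"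
        unfolding outer[OF D] INF_less_iff by auto
      define K where "K = betaX - U"
      have Um: "U \<in> sets ?M" using U(1) by (simp add: sets_beta_measure openin_imp_borel_sets)
      have "closedin beta_topology K"
        using U(1) unfolding K_def by (metis closedin_diff closedin_topspace topspace_beta)
      then have K: "compactin beta_topology K" "K \<subseteq> A"
        using U(2) compact_space_beta by (auto simp: K_def intro: closedin_compact_space)
      have "measure ?M U \<le> measure ?M (betaX - A) + e"
        using U(3) e by (simp add: emeasure_eq_measure ennreal_less_iff flip: ennreal_plus)
      moreover have "measure ?M (betaX - A) = 1 - measure ?M A"
        using prob_compl[OF A] by (simp add: space_beta_measure)
      moreover have "measure ?M K = 1 - measure ?M U"
        using prob_compl[OF Um] by (simp add: space_beta_measure K_def)
      ultimately have "emeasure ?M A \<le> emeasure ?M K + ennreal e"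
        using e by (simp add: emeasure_eq_measure flip: ennreal_plus)
      also have "emeasure ?M K \<le> (SUP K \<in> {K. compactin beta_topology K \<and> K \<subseteq> A}. emeasure ?M K)"
        using K by (intro SUP_upper) simp
      finally show "emeasure ?M A \<le> (SUP K \<in> {K. compactin beta_topology K \<and> K \<subseteq> A}. emeasure ?M K) + ennreal e"
        by (simp add: add_right_mono)
    qed
  qed
  show ?thesis
    unfolding beta_borel_prob_def regular_measure_def
    using outer inner by (simp add: prob_space_axioms space_beta_measure sets_beta_measure)
qed

text \<open>\<open>ext_map s\<close> carries clopen sets to clopen sets of the same mean. One
  inequality suffices, since the inverse of \<open>s\<close> preserves \<open>\<mu>\<close> as
  well.\<close>

lemma beta_outer_ext_map_le:
  assumes s: "bij s" and inv: "\<And>A. \<mu> (s ` A) = \<mu> A" and E: "E \<subseteq> betaX"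
  shows "beta_outer \<mu> (ext_map s ` E) \<le> beta_outer \<mu> E"
  unfolding beta_outer_def[of \<mu> E]
proof (rule INF_greatest)
  fix Q assume "Q \<in> {Q. openin beta_topology Q \<and> E \<subseteq> Q}"
  then have Q: "openin beta_topology Q" "E \<subseteq> Q" by auto
  have QX: "Q \<subseteq> betaX" using openin_subset[OF Q(1)] by (simp add: topspace_beta)
  have inj: "inj_on (ext_map s) betaX" using bij_betw_ext_map[OF s] by (simp add: bij_betw_def)
  have "beta_outer \<mu> (ext_map s ` E) \<le> beta_content \<mu> (ext_map s ` Q)"
    using Q by (intro beta_outer_le openin_ext_map_image[OF s] image_mono) auto
  also have "\<dots> \<le> beta_content \<mu> Q"
    unfolding beta_content_def[of \<mu> "ext_map s ` Q"]
  proof (rule SUP_least)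
    fix A assume "A \<in> {A. basic_clopen A \<subseteq> ext_map s ` Q}"
    then have A: "basic_clopen A \<subseteq> ext_map s ` Q" by simp
    have eq: "s ` (s -` A) = A" using s by (simp add: bij_is_surj surj_image_vimage_eq)
    have "ext_map s ` basic_clopen (s -` A) \<subseteq> ext_map s ` Q"
      unfolding ext_map_image_basic_clopen[OF s] eq by (rule A)
    then have "basic_clopen (s -` A) \<subseteq> Q"
      using inj_on_image_subset_iff[OF inj basic_clopen_subset_betaX QX] by simp
    then have "ennreal (\<mu> (s -` A)) \<le> beta_content \<mu> Q" by (rule beta_content_upper)
    then show "ennreal (\<mu> A) \<le> beta_content \<mu> Q" using inv[of "s -` A"] by (simp only: eq)
  qed
  finally show "beta_outer \<mu> (ext_map s ` E) \<le> beta_content \<mu> Q" .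
qed

lemma emeasure_beta_measure_ext_map:
  assumes \<mu>: "mean \<mu>" and s: "bij s" and inv: "\<And>A. \<mu> (s ` A) = \<mu> A"
    and E: "E \<in> borel_sets beta_topology" and E': "ext_map s ` E \<in> borel_sets beta_topology"
  shows "emeasure (beta_measure \<mu>) (ext_map s ` E) = emeasure (beta_measure \<mu>) E"
proof -
  have EX: "E \<subseteq> betaX" "ext_map s ` E \<subseteq> betaX" using E E' borel_sets_beta_subset by auto
  have c: "inv_into UNIV s \<circ> s = id" using s by (simp add: bij_is_inj)
  have "ext_map (inv_into UNIV s) ` ext_map s ` E = E"
    by (simp add: image_image ext_map_comp c ext_map_id)
  moreover have "\<mu> (inv_into UNIV s ` A) = \<mu> A" for A
    using inv[of "inv_into UNIV s ` A"] s by (simp add: image_f_inv_f bij_is_surj)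
  ultimately have "beta_outer \<mu> E \<le> beta_outer \<mu> (ext_map s ` E)"
    using beta_outer_ext_map_le[OF bij_imp_bij_inv[OF s], of \<mu> "ext_map s ` E"] EX by simp
  then show ?thesis
    using beta_outer_ext_map_le[OF s _ EX(1), of \<mu>] inv E E'
    by (simp add: emeasure_beta_measure[OF \<mu>])
qed

lemma ext_map_image_borel_sets:
  assumes s: "bij s" and E: "E \<in> borel_sets beta_topology"
  shows "ext_map s ` E \<in> borel_sets beta_topology"
  using E unfolding borel_sets_def topspace_beta
proof (induction rule: sigma_sets.induct)
  case (Basic U)
  then show ?case using openin_ext_map_image[OF s] by (intro sigma_sets.Basic) simp
next
  case Empty then show ?case by (simp add: sigma_sets.Empty)
next
  case (Compl a)
  have "a \<subseteq> betaX"
    using Compl.hyps borel_sets_beta_subset by (auto simp: borel_sets_def topspace_beta)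
  then have "ext_map s ` (betaX - a) = betaX - ext_map s ` a"
    using bij_betw_ext_map[OF s] inj_on_image_set_diff[of "ext_map s" betaX betaX a]
    by (simp add: bij_betw_def)
  then show ?case using Compl.IH by (simp add: sigma_sets.Compl)
next
  case (Union a)
  then show ?case by (simp add: image_UN sigma_sets.Union)
qed

section \<open>Integrals of finitely valued functions against a mean\<close>

text \<open>Intended for functions with finite range: a sum over an infinite index set is 0 by
  convention, so the rules below that need it assume finiteness.\<close>

definition mean_int :: "('x set \<Rightarrow> real) \<Rightarrow> ('x \<Rightarrow> real) \<Rightarrow> real" where
  "mean_int \<mu> f = (\<Sum>v\<in>range f. v * \<mu> (f -` {v}))"

text \<open>The level sets of \<open>g\<close> refine those of its composition with
  \<open>\<phi>\<close>, and values that are not attained contribute nothing. With \<open>g\<close>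
  a pair of functions this supplies the common refinement behind additivity and
  monotonicity.\<close>

lemma mean_int_comp:
  assumes \<mu>: "mean \<mu>" and R: "finite R" "range g \<subseteq> R"
  shows "mean_int \<mu> (\<lambda>x. \<phi> (g x)) = (\<Sum>z\<in>R. \<phi> z * \<mu> (g -` {z}))"
proof -
  let ?T = "range (\<lambda>x. \<phi> (g x))"
  have fin: "finite (range g)" using R by (rule finite_subset[rotated])
  have T: "?T = \<phi> ` range g" by auto
  have "\<mu> ((\<lambda>x. \<phi> (g x)) -` {v}) = (\<Sum>z\<in>{z\<in>range g. \<phi> z = v}. \<mu> (g -` {z}))" for v
  proof -
    have "(\<lambda>x. \<phi> (g x)) -` {v} = (\<Union>z\<in>{z\<in>range g. \<phi> z = v}. g -` {z})" by auto
    then show ?thesis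
      using mean_UN_disjoint[OF \<mu>, of "{z\<in>range g. \<phi> z = v}" "\<lambda>z. g -` {z}"] fin
      by (simp add: disjoint_family_on_def disjoint_iff)
  qed
  then have "mean_int \<mu> (\<lambda>x. \<phi> (g x)) = (\<Sum>v\<in>\<phi> ` range g. \<Sum>z\<in>{z\<in>range g. \<phi> z = v}. \<phi> z * \<mu> (g -` {z}))"
    unfolding mean_int_def T by (simp add: sum_distrib_left)
  also have "\<dots> = (\<Sum>z\<in>range g. \<phi> z * \<mu> (g -` {z}))"
    using sum.image_gen[OF fin, of "\<lambda>z. \<phi> z * \<mu> (g -` {z})" \<phi>] by simp
  also have "\<dots> = (\<Sum>z\<in>R. \<phi> z * \<mu> (g -` {z}))"
  proof (rule sum.mono_neutral_left)
    show "\<forall>z\<in>R - range g. \<phi> z * \<mu> (g -` {z}) = 0"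
    proof
      fix z assume "z \<in> R - range g"
      then have "g -` {z} = {}" by auto
      then show "\<phi> z * \<mu> (g -` {z}) = 0" by (simp add: mean_empty[OF \<mu>])
    qed
  qed (use R in auto)
  finally show ?thesis .
qed

lemma mean_int_combine:
  assumes \<mu>: "mean \<mu>" and f: "finite (range f)" "finite (range h)"
  shows "mean_int \<mu> (\<lambda>x. \<phi> (f x) (h x)) = (\<Sum>z\<in>range f \<times> range h. \<phi> (fst z) (snd z) * \<mu> ((\<lambda>x. (f x, h x)) -` {z}))"
  using mean_int_comp[OF \<mu>, of "range f \<times> range h" "\<lambda>x. (f x, h x)" "\<lambda>z. \<phi> (fst z) (snd z)"] f
  by auto

lemma mean_int_add:
  assumes "mean \<mu>" "finite (range f)" "finite (range h)"
  shows "mean_int \<mu> (\<lambda>x. f x + h x) = mean_int \<mu> f + mean_int \<mu> h"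
  using mean_int_combine[OF assms, of "\<lambda>a b. a + b"] mean_int_combine[OF assms, of "\<lambda>a b. a"]
    mean_int_combine[OF assms, of "\<lambda>a b. b"]
  by (simp add: sum.distrib distrib_right)

lemma mean_int_diff:
  assumes "mean \<mu>" "finite (range f)" "finite (range h)"
  shows "mean_int \<mu> (\<lambda>x. f x - h x) = mean_int \<mu> f - mean_int \<mu> h"
  using mean_int_combine[OF assms, of "\<lambda>a b. a - b"] mean_int_combine[OF assms, of "\<lambda>a b. a"]
    mean_int_combine[OF assms, of "\<lambda>a b. b"]
  by (simp add: sum_subtractf left_diff_distrib)

lemma mean_int_mono:
  assumes \<mu>: "mean \<mu>" and f: "finite (range f)" "finite (range h)" and le: "\<And>x. f x \<le> h x"
  shows "mean_int \<mu> f \<le> mean_int \<mu> h"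
proof -
  have "(\<Sum>z\<in>range f \<times> range h. fst z * \<mu> ((\<lambda>x. (f x, h x)) -` {z}))
      \<le> (\<Sum>z\<in>range f \<times> range h. snd z * \<mu> ((\<lambda>x. (f x, h x)) -` {z}))"
  proof (rule sum_mono)
    fix z
    show "fst z * \<mu> ((\<lambda>x. (f x, h x)) -` {z}) \<le> snd z * \<mu> ((\<lambda>x. (f x, h x)) -` {z})"
    proof (cases "(\<lambda>x. (f x, h x)) -` {z} = {}")
      case True then show ?thesis by (simp add: mean_empty[OF \<mu>])
    next
      case False
      then have "fst z \<le> snd z" using le by auto
      then show ?thesis using mean_nonneg[OF \<mu>] by (rule mult_right_mono)
    qed
  qed
  then show ?thesis
    using mean_int_combine[OF \<mu> f, of "\<lambda>a b. a"] mean_int_combine[OF \<mu> f, of "\<lambda>a b. b"] by simp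
qed

lemma mean_int_const: "mean \<mu> \<Longrightarrow> mean_int \<mu> (\<lambda>x. k) = k"
  by (simp add: mean_int_def mean_UNIV)

lemma mean_int_cmult:
  assumes "mean \<mu>" "finite (range f)"
  shows "mean_int \<mu> (\<lambda>x. k * f x) = k * mean_int \<mu> f"
  using mean_int_comp[OF assms subset_refl, of "\<lambda>v. k * v"] mean_int_comp[OF assms subset_refl, of "\<lambda>v. v"]
  by (simp add: sum_distrib_left mult.assoc)

lemma mean_int_indicator:
  assumes "mean \<mu>"
  shows "mean_int \<mu> (indicat_real A) = \<mu> A"
proof -
  have "mean_int \<mu> (\<lambda>x. of_bool (x \<in> A)) = (\<Sum>z\<in>UNIV. of_bool z * \<mu> ((\<lambda>x. x \<in> A) -` {z}))"
    using assms by (intro mean_int_comp[where \<phi> = of_bool]) auto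
  also have "\<dots> = \<mu> A"
    by (simp add: UNIV_bool vimage_def)
  finally show ?thesis by (simp add: indicator_def[abs_def] of_bool_def)
qed

lemma finite_range_sum:
  assumes "finite I" "\<And>i. i \<in> I \<Longrightarrow> finite (range (f i))"
  shows "finite (range (\<lambda>x. \<Sum>i\<in>I. (f i x :: real)))"
  using assms
proof (induction I rule: finite_induct)
  case empty
  have "range (\<lambda>x. \<Sum>i\<in>{}. f i x) \<subseteq> {0}" by auto
  then show ?case by (rule finite_subset) simp
next
  case (insert i I)
  have "range (\<lambda>x. \<Sum>j\<in>insert i I. f j x) \<subseteq> (\<lambda>(a, b). a + b) ` (range (f i) \<times> range (\<lambda>x. \<Sum>j\<in>I. f j x))"
    using insert.hyps by (auto simp: image_iff)
  then show ?case
    by (rule finite_subset) (use insert in simp)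
qed

lemma mean_int_sum:
  assumes \<mu>: "mean \<mu>" and "finite I" "\<And>i. i \<in> I \<Longrightarrow> finite (range (f i))"
  shows "mean_int \<mu> (\<lambda>x. \<Sum>i\<in>I. f i x) = (\<Sum>i\<in>I. mean_int \<mu> (f i))"
  using assms(2,3)
proof (induction I rule: finite_induct)
  case empty then show ?case by (simp add: mean_int_const[OF \<mu>])
next
  case (insert i I)
  have "mean_int \<mu> (\<lambda>x. f i x + (\<Sum>j\<in>I. f j x)) = mean_int \<mu> (f i) + mean_int \<mu> (\<lambda>x. \<Sum>j\<in>I. f j x)"
    using insert.prems insert.hyps by (intro mean_int_add[OF \<mu>] finite_range_sum) auto
  then show ?case using insert by simp
qed

lemma mean_int_comp_bij:
  assumes s: "bij s" and inv: "\<And>A. \<mu> (s ` A) = \<mu> A"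
  shows "mean_int \<mu> (\<lambda>x. f (s x)) = mean_int \<mu> f"
proof -
  have "range (\<lambda>x. f (s x)) = range f"
    using bij_is_surj[OF s] by (metis image_image)
  moreover have "\<mu> ((\<lambda>x. f (s x)) -` {v}) = \<mu> (f -` {v})" for v
  proof -
    have "s ` ((\<lambda>x. f (s x)) -` {v}) = f -` {v}"
      using surj_image_vimage_eq[OF bij_is_surj[OF s], of "f -` {v}"] by (simp add: vimage_def)
    then show ?thesis using inv[of "(\<lambda>x. f (s x)) -` {v}"] by simp
  qed
  ultimately show ?thesis by (simp add: mean_int_def)
qed

section \<open>Flows\<close>

text \<open>The value \<open>\<theta> (x, s)\<close> is the amount sent from \<open>x\<close> along \<open>s\<close>.\<close>

definition flow_excess ::
  "('g \<Rightarrow> 'x \<Rightarrow> 'x) \<Rightarrow> 'g set \<Rightarrow> ('x \<Rightarrow> real) \<Rightarrow> ('x \<times> 'g \<Rightarrow> real) \<Rightarrow> 'x \<Rightarrow> real" where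
  "flow_excess act S c \<theta> x =
     c x - 1 + (\<Sum>s\<in>S. \<theta> (inv_into UNIV (act s) x, s) - \<theta> (x, s))"

text \<open>Only the summand \<open>s0\<close> changes, at the source and at the target of the edge.
  If \<open>act s0\<close> fixes \<open>x0\<close>, the two changes cancel.\<close>

lemma flow_excess_update:
  assumes "finite S" "s0 \<in> S" and bij: "bij (act s0)"
  shows "flow_excess act S c (\<theta>((x0, s0) := \<theta> (x0, s0) + \<delta>)) x
    = flow_excess act S c \<theta> x + \<delta> * (of_bool (x = act s0 x0) - of_bool (x = x0))"
proof -
  let ?i = "\<lambda>s. inv_into UNIV (act s)"
  have upd: "(\<theta>((x0, s0) := \<theta> (x0, s0) + \<delta>)) p = \<theta> p + \<delta> * of_bool (p = (x0, s0))" for p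
    by simp
  have "?i s0 x = x0 \<longleftrightarrow> x = act s0 x0"
    using bij by (metis bij_inv_eq_iff)
  then have eq: "of_bool ((?i s x, s) = (x0, s0)) = of_bool (s = s0) * (of_bool (x = act s0 x0) :: real)" for s
    by auto
  have "(\<Sum>s\<in>S. \<delta> * of_bool ((?i s x, s) = (x0, s0)) - \<delta> * of_bool ((x, s) = (x0, s0)))
      = (\<Sum>s\<in>S. of_bool (s = s0) * (\<delta> * (of_bool (x = act s0 x0) - of_bool (x = x0))))"
    unfolding eq by (intro sum.cong) (auto simp: algebra_simps)
  also have "\<dots> = \<delta> * (of_bool (x = act s0 x0) - of_bool (x = x0))"
    using assms(1,2) by (simp add: of_bool_def if_distrib[of "\<lambda>b. b * _"] cong: if_cong)
  finally have *: "(\<Sum>s\<in>S. \<delta> * of_bool ((?i s x, s) = (x0, s0)) - \<delta> * of_bool ((x, s) = (x0, s0)))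
      = \<delta> * (of_bool (x = act s0 x0) - of_bool (x = x0))" .
  have "(\<Sum>s\<in>S. (\<theta>((x0, s0) := \<theta> (x0, s0) + \<delta>)) (?i s x, s) - (\<theta>((x0, s0) := \<theta> (x0, s0) + \<delta>)) (x, s))
     = (\<Sum>s\<in>S. \<theta> (?i s x, s) - \<theta> (x, s)) +
       (\<Sum>s\<in>S. \<delta> * of_bool ((?i s x, s) = (x0, s0)) - \<delta> * of_bool ((x, s) = (x0, s0)))"
    unfolding upd sum.distrib[symmetric] by (intro sum.cong) auto
  then show ?thesis unfolding flow_excess_def * by simp
qed

lemma abs_flow_excess_le:
  fixes C :: real
  assumes "\<And>x. 0 \<le> c x" "\<And>x. c x \<le> B" "\<And>p. 0 \<le> \<theta> p" "\<And>p. \<theta> p \<le> C"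
  shows "\<bar>flow_excess act S c \<theta> x\<bar> \<le> B + 1 + card S * C"
proof -
  have "\<bar>\<theta> p - \<theta> q\<bar> \<le> C" for p q
    using assms(3)[of p] assms(3)[of q] assms(4)[of p] assms(4)[of q] by linarith
  then have "\<bar>\<Sum>s\<in>S. \<theta> (inv_into UNIV (act s) x, s) - \<theta> (x, s)\<bar> \<le> (\<Sum>s\<in>S. C)"
    by (intro order_trans[OF sum_abs] sum_mono)
  then show ?thesis
    using assms(1)[of x] assms(2)[of x] unfolding flow_excess_def by simp
qed

text \<open>For small steps the linear term wins. The witness is the minimiser \<open>p / w\<close>
  of the quadratic, capped by the room \<open>d\<close> that is left.\<close>

lemma quadratic_negative:
  fixes d p w :: real
  assumes "d > 0" "p > 0" "w > 0"
  shows "\<exists>\<delta>. 0 < \<delta> \<and> \<delta> \<le> d \<and> \<delta>\<^sup>2 * w - 2 * \<delta> * p < 0"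
proof -
  define \<delta> where "\<delta> = min d (p / w)"
  have "0 < \<delta>" "\<delta> \<le> d" "\<delta> \<le> p / w" using assms by (auto simp: \<delta>_def)
  then have "\<delta> * w \<le> p" using assms by (simp add: pos_le_divide_eq)
  then have "\<delta> * (\<delta> * w - 2 * p) < 0"
    using \<open>0 < \<delta>\<close> assms by (intro mult_pos_neg) auto
  then show ?thesis using \<open>0 < \<delta>\<close> \<open>\<delta> \<le> d\<close>
    by (intro exI[of _ \<delta>]) (simp add: algebra_simps power2_eq_square)
qed

text \<open>Tychonoff's theorem, used for flows with capacity \<open>C\<close> and again for means
  as points of a cube.\<close>

lemma compact_PiE_Icc: "compact (PiE UNIV (\<lambda>_. {0..C::real}) :: ('i \<Rightarrow> real) set)"
proof -
  have "compactin (product_topology (\<lambda>_::'i. euclidean) UNIV) (PiE UNIV (\<lambda>_. {0..C::real}))"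
    by (subst compactin_PiE) simp
  then show ?thesis by (simp add: euclidean_product_topology)
qed

text \<open>A max-flow min-cut argument on an infinite graph. The flow minimises a weighted sum of squared excesses, with
  summable weights. If some excess is negative, the points of very negative weighted excess form a finite set;
  by minimality the flow into it is maximal and the flow out of it is zero, which contradicts the cut condition.\<close>

theorem exists_flow:
  fixes act :: "'g \<Rightarrow> 'x \<Rightarrow> 'x"
  assumes S: "finite S" and bij: "\<And>s. s \<in> S \<Longrightarrow> bij (act s)"
    and X: "countable (UNIV :: 'x set)" "infinite (UNIV :: 'x set)"
    and c: "\<And>x. 0 \<le> c x" "\<And>x. c x \<le> B" and C: "0 \<le> C"
    and cut: "\<And>A. finite A \<Longrightarrow> A \<noteq> {} \<Longrightarrow>
       real (card A) \<le> C * (\<Sum>s\<in>S. real (card {x\<in>A. act s x \<notin> A})) + (\<Sum>x\<in>A. c x)"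
  shows "\<exists>\<theta>. (\<forall>p. 0 \<le> \<theta> p \<and> \<theta> p \<le> C) \<and> (\<forall>x. 0 \<le> flow_excess act S c \<theta> x)"
proof -
  define e where "e = flow_excess act S c"
  define num where "num = from_nat_into (UNIV :: 'x set)"
  define idx where "idx = to_nat_on (UNIV :: 'x set)"
  have idx: "num (idx x) = x" "idx (num n) = n" for x n
    using X by (simp_all add: num_def idx_def)
  \<comment> \<open>Summable weights make the total squared excess finite and continuous although X
    is infinite.\<close>
  define W where "W x = (1/2 :: real) ^ idx x" for x
  have Wpos: "0 < W x" for x by (simp add: W_def)
  define K where "K = (PiE UNIV (\<lambda>_. {0..C}) :: ('x \<times> 'g \<Rightarrow> real) set)"
  have K: "\<theta> \<in> K \<longleftrightarrow> (\<forall>p. 0 \<le> \<theta> p \<and> \<theta> p \<le> C)" for \<theta>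
    by (auto simp: K_def)
  define D where "D = B + 1 + card S * C"
  have eD: "\<bar>e \<theta> x\<bar> \<le> D" if "\<theta> \<in> K" for \<theta> x
    unfolding e_def D_def using c that by (intro abs_flow_excess_le) (auto simp: K)
  have "0 \<le> B" using order_trans[OF c(1) c(2)] .
  then have D0: "0 < D" using mult_nonneg_nonneg[of "real (card S)" C] C unfolding D_def by linarith
  define f where "f n \<theta> = W (num n) * (e \<theta> (num n))\<^sup>2" for n \<theta>
  have fD: "norm (f n \<theta>) \<le> (1/2)^n * D\<^sup>2" if "\<theta> \<in> K" for n \<theta>
  proof -
    have "(e \<theta> (num n))\<^sup>2 \<le> D\<^sup>2"
      using eD[OF that, of "num n"] D0 by (simp add: abs_le_square_iff[symmetric])
    then show ?thesis by (simp add: f_def W_def idx mult_left_mono)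
  qed
  have summ: "summable (\<lambda>n. (1/2)^n * D\<^sup>2 :: real)"
    by (intro summable_mult2 summable_geometric) simp
  have sumf: "summable (\<lambda>n. f n \<theta>)" if "\<theta> \<in> K" for \<theta>
    by (rule summable_comparison_test'[OF summ, of 0]) (rule fD[OF that])
  define J where "J \<theta> = (\<Sum>n. f n \<theta>)" for \<theta>
  have cont_f: "continuous_on K (f n)" for n
    unfolding f_def e_def flow_excess_def
    by (intro continuous_intros continuous_on_subset[OF continuous_on_product_coordinates]) auto
  \<comment> \<open>Each \<open>f n\<close> depends on finitely many coordinates of the flow and
    hence is continuous for the product topology; the M-test passes this to \<open>J\<close>, which
    then attains a minimum on the compact cube.\<close>
  have "uniform_limit K (\<lambda>N \<theta>. \<Sum>i<N. f i \<theta>) J sequentially"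
    unfolding J_def[abs_def] using fD summ by (intro Weierstrass_m_test) auto
  then have "continuous_on K J"
    by (rule uniform_limit_theorem[rotated]) (auto intro!: always_eventually continuous_on_sum cont_f)
  moreover have "compact K" unfolding K_def by (rule compact_PiE_Icc)
  moreover have "K \<noteq> {}" using C by (auto simp: K intro!: exI[of _ "\<lambda>_. 0"])
  ultimately obtain \<theta> where \<theta>: "\<theta> \<in> K" and min: "\<And>\<theta>'. \<theta>' \<in> K \<Longrightarrow> J \<theta> \<le> J \<theta>'"
    using continuous_attains_inf[of K J] by blast
  \<comment> \<open>Changing the flow on one edge alters only two terms of \<open>J\<close>. The
    linear coefficient shows that a minimal flow cannot be improved by pushing from larger to
    smaller weighted excess.\<close>
  have perturb: "0 \<le> \<delta>\<^sup>2 * (W x + W (act s x)) + 2 * \<delta> * (W (act s x) * e \<theta> (act s x) - W x * e \<theta> x)"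
    if s: "s \<in> S" and \<delta>: "0 \<le> \<theta> (x, s) + \<delta>" "\<theta> (x, s) + \<delta> \<le> C" and ne: "act s x \<noteq> x" for x s \<delta>
  proof -
    define \<theta>' where "\<theta>' = \<theta>((x, s) := \<theta> (x, s) + \<delta>)"
    have \<theta>': "\<theta>' \<in> K" using \<theta> \<delta> by (auto simp: K \<theta>'_def)
    have e': "e \<theta>' y = e \<theta> y + \<delta> * (of_bool (y = act s x) - of_bool (y = x))" for y
      unfolding e_def \<theta>'_def using S s bij[OF s] by (rule flow_excess_update)
    have neq: "idx x \<noteq> idx (act s x)" using ne idx(1) by metis
    have "J \<theta>' - J \<theta> = (\<Sum>n. f n \<theta>' - f n \<theta>)"
      unfolding J_def by (rule suminf_diff[OF sumf sumf]) (use \<theta> \<theta>' in auto)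
    also have "\<dots> = (\<Sum>n\<in>{idx x, idx (act s x)}. f n \<theta>' - f n \<theta>)"
    proof (rule suminf_finite)
      fix n assume "n \<notin> {idx x, idx (act s x)}"
      then have "num n \<noteq> x" "num n \<noteq> act s x" using idx(2)[of n] by auto
      then show "f n \<theta>' - f n \<theta> = 0" by (simp add: f_def e')
    qed simp
    also have "\<dots> = \<delta>\<^sup>2 * (W x + W (act s x)) + 2 * \<delta> * (W (act s x) * e \<theta> (act s x) - W x * e \<theta> x)"
      using neq ne by (simp add: f_def e' idx power2_eq_square algebra_simps)
    finally show ?thesis using min[OF \<theta>'] by simp
  qed
  have "0 \<le> e \<theta> x0" for x0
  proof (rule ccontr)
    assume "\<not> 0 \<le> e \<theta> x0"
    define m where "m = - (W x0 * e \<theta> x0)"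
    have m: "0 < m" using \<open>\<not> 0 \<le> e \<theta> x0\<close> Wpos[of x0] by (simp add: m_def mult_pos_neg)
    \<comment> \<open>The cut is made by weighted excess, since this is what the variation of
      \<open>J\<close> compares. Bounded excess and vanishing weights make \<open>A\<close> finite,
      as the cut condition requires.\<close>
    define A where "A = {x. W x * e \<theta> x \<le> - m}"
    have "x0 \<in> A" by (simp add: A_def m_def)
    have "finite A"
    proof -
      have "(\<lambda>n. (1/2 :: real) ^ n) \<longlonglongrightarrow> 0" by (rule LIMSEQ_realpow_zero) auto
      then have "eventually (\<lambda>n. (1/2 :: real) ^ n < m / D) sequentially"
        using m D0 by (intro order_tendstoD) auto
      then obtain N where N: "\<And>n. n \<ge> N \<Longrightarrow> (1/2 :: real) ^ n < m / D"
        by (auto simp: eventually_sequentially)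
      have "idx x < N" if "x \<in> A" for x
      proof (rule ccontr)
        assume "\<not> idx x < N"
        then have "W x * D < m" using N[of "idx x"] D0 by (simp add: W_def pos_less_divide_eq)
        moreover have "W x * - D \<le> W x * e \<theta> x"
          using eD[OF \<theta>, of x] Wpos[of x] by (intro mult_left_mono) auto
        ultimately show False using that by (simp add: A_def)
      qed
      then have "A \<subseteq> num ` {..<N}" using idx(1) by (metis image_eqI lessThan_iff subsetI)
      then show ?thesis by (rule finite_subset) simp
    qed
    \<comment> \<open>Reducing a positive flow out of \<open>A\<close> would relieve a vertex of
      weighted excess at most \<open>- m\<close> at the expense of one above \<open>- m\<close>, and
      so lower \<open>J\<close>.\<close>
    have out0: "\<theta> (x, s) = 0" if "s \<in> S" "x \<in> A" "act s x \<notin> A" for x s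
    proof (rule ccontr)
      assume "\<theta> (x, s) \<noteq> 0"
      then have "0 < \<theta> (x, s)" using \<theta> by (auto simp: K less_le)
      moreover have "0 < W (act s x) * e \<theta> (act s x) - W x * e \<theta> x" using that by (auto simp: A_def)
      ultimately obtain d where d: "0 < d" "d \<le> \<theta> (x, s)"
        "d\<^sup>2 * (W x + W (act s x)) - 2 * d * (W (act s x) * e \<theta> (act s x) - W x * e \<theta> x) < 0"
        using quadratic_negative[of "\<theta> (x, s)" _ "W x + W (act s x)"] Wpos add_pos_pos by metis
      have "\<theta> (x, s) + - d \<le> C" using d \<theta> by (auto simp: K intro: order_trans[of _ "\<theta> (x, s)"])
      moreover have "act s x \<noteq> x" using that by metis
      ultimately show False
        using perturb[of s x "- d"] d that by simp
    qed
    \<comment> \<open>The dual variation: an unsaturated edge into \<open>A\<close> could carry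
      more.\<close>
    have inC: "\<theta> (x, s) = C" if "s \<in> S" "x \<notin> A" "act s x \<in> A" for x s
    proof (rule ccontr)
      assume "\<theta> (x, s) \<noteq> C"
      then have "0 < C - \<theta> (x, s)" using \<theta> by (auto simp: K less_le)
      moreover have "0 < W x * e \<theta> x - W (act s x) * e \<theta> (act s x)" using that by (auto simp: A_def)
      ultimately obtain d where d: "0 < d" "d \<le> C - \<theta> (x, s)"
        "d\<^sup>2 * (W x + W (act s x)) - 2 * d * (W x * e \<theta> x - W (act s x) * e \<theta> (act s x)) < 0"
        using quadratic_negative[of "C - \<theta> (x, s)" _ "W x + W (act s x)"] Wpos add_pos_pos by metis
      have "0 \<le> \<theta> (x, s) + d" using d \<theta> by (auto simp: K intro: add_nonneg_nonneg)
      moreover have "act s x \<noteq> x" using that by metis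
      moreover have "- 2 * d * (W x * e \<theta> x - W (act s x) * e \<theta> (act s x)) = 2 * d * (W (act s x) * e \<theta> (act s x) - W x * e \<theta> x)"
        by (simp add: algebra_simps)
      ultimately show False
        using perturb[of s x d] d that by simp
    qed
    \<comment> \<open>Flow inside \<open>A\<close> cancels. As \<open>act s\<close> is a bijection
      and \<open>A\<close> is finite, as many points enter \<open>A\<close> as leave it, so the
      saturated entering edges may be counted by exits.\<close>
    have net: "(\<Sum>x\<in>A. \<theta> (inv_into UNIV (act s) x, s)) - (\<Sum>x\<in>A. \<theta> (x, s)) = C * card {x\<in>A. act s x \<notin> A}"
      if s: "s \<in> S" for s
    proof -
      let ?i = "inv_into UNIV (act s)"
      let ?A = "?i ` A"
      have b: "act s (?i x) = x" "?i (act s x) = x" for x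
        using bij[OF s] by (simp_all add: bij_is_surj bij_is_inj surj_f_inv_f)
      have A': "y \<in> ?A \<longleftrightarrow> act s y \<in> A" for y
        using b by (metis image_iff)
      have inj: "inj_on ?i A" using b(1) by (metis inj_onI)
      have fin: "finite ?A" using \<open>finite A\<close> by simp
      have "(\<Sum>x\<in>A. \<theta> (?i x, s)) = (\<Sum>y\<in>?A. \<theta> (y, s))"
        by (simp add: sum.reindex[OF inj])
      also have "\<dots> = (\<Sum>y\<in>?A \<inter> A. \<theta> (y, s)) + (\<Sum>y\<in>?A - A. \<theta> (y, s))"
        using fin by (rule sum.Int_Diff)
      also have "(\<Sum>y\<in>?A - A. \<theta> (y, s)) = (\<Sum>y\<in>?A - A. C)"
        using A' s by (intro sum.cong refl inC) auto
      finally have 1: "(\<Sum>x\<in>A. \<theta> (?i x, s)) = (\<Sum>y\<in>?A \<inter> A. \<theta> (y, s)) + C * card (?A - A)" by simp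
      have "(\<Sum>x\<in>A. \<theta> (x, s)) = (\<Sum>y\<in>A \<inter> ?A. \<theta> (y, s)) + (\<Sum>y\<in>A - ?A. \<theta> (y, s))"
        using \<open>finite A\<close> by (rule sum.Int_Diff)
      also have "(\<Sum>y\<in>A - ?A. \<theta> (y, s)) = 0"
        using A' s out0 by (intro sum.neutral) auto
      finally have 2: "(\<Sum>x\<in>A. \<theta> (x, s)) = (\<Sum>y\<in>?A \<inter> A. \<theta> (y, s))" by (simp add: Int_commute)
      have "card ?A = card A" by (rule card_image[OF inj])
      then have "card (?A - A) = card (A - ?A)"
        using card_Int_Diff[OF fin, of A] card_Int_Diff[OF \<open>finite A\<close>, of ?A] by (simp add: Int_commute)
      moreover have "A - ?A = {x\<in>A. act s x \<notin> A}" using A' by auto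
      ultimately show ?thesis using 1 2 by simp
    qed
    \<comment> \<open>With these extremal flows the total excess on \<open>A\<close> is exactly the
      slack in the cut condition, hence nonnegative, while every single excess on \<open>A\<close>
      is negative.\<close>
    have "(\<Sum>x\<in>A. e \<theta> x) = (\<Sum>x\<in>A. c x) - card A +
        (\<Sum>s\<in>S. (\<Sum>x\<in>A. \<theta> (inv_into UNIV (act s) x, s)) - (\<Sum>x\<in>A. \<theta> (x, s)))"
      unfolding e_def flow_excess_def sum.distrib sum_subtractf
      by (simp add: sum.swap[of _ S A])
    also have "\<dots> = (\<Sum>x\<in>A. c x) - card A + C * (\<Sum>s\<in>S. real (card {x\<in>A. act s x \<notin> A}))"
      using net by (simp add: sum_distrib_left)
    also have "\<dots> \<ge> 0"
    proof -
      have "A \<noteq> {}" using \<open>x0 \<in> A\<close> by blast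
      then show ?thesis using cut[OF \<open>finite A\<close>] by (simp add: algebra_simps)
    qed
    finally have "0 \<le> (\<Sum>x\<in>A. e \<theta> x)" .
    moreover have "(\<Sum>x\<in>A. e \<theta> x) < (\<Sum>x\<in>A. 0)"
    proof (rule sum_strict_mono)
      show "finite A" "A \<noteq> {}" using \<open>finite A\<close> \<open>x0 \<in> A\<close> by auto
      fix x assume "x \<in> A"
      then have "W x * e \<theta> x < 0" using m by (simp add: A_def)
      then show "e \<theta> x < 0" using Wpos[of x] by (simp add: mult_less_0_iff)
    qed
    ultimately show False by simp
  qed
  then show ?thesis using \<theta> by (auto simp: K e_def)
qed

section \<open>Schreier graphs\<close>

lemma induced_component_mono: "V \<subseteq> V' \<Longrightarrow> induced_component E V x \<subseteq> induced_component E V' x"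
  unfolding induced_component_def by (auto elim: rtrancl_mono[THEN subsetD, rotated])

lemma induced_component_subset:
  assumes "x \<in> V"
  shows "induced_component E V x \<subseteq> V"
proof
  fix y assume "y \<in> induced_component E V x"
  then have "(x, y) \<in> {(a, b). a \<in> V \<and> b \<in> V \<and> E a b}\<^sup>*" by (simp add: induced_component_def)
  then show "y \<in> V" using assms by (induction rule: rtrancl_induct) auto
qed

text \<open>The group is forgotten: finitely many bijections closed under inverses are all that the
  graph arguments use.\<close>

locale symmetric_generators =
  fixes act :: "'g \<Rightarrow> 'x \<Rightarrow> 'x" and S :: "'g set"
  assumes finite_S: "finite S"
    and bij_act: "s \<in> S \<Longrightarrow> bij (act s)"
    and inverse_act: "s \<in> S \<Longrightarrow> \<exists>t\<in>S. \<forall>x. act t (act s x) = x"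
begin

abbreviation E :: "'x \<Rightarrow> 'x \<Rightarrow> bool" where "E \<equiv> schreier_edge act S"

abbreviation boundary :: "'x set \<Rightarrow> ('x \<times> 'x) set" where
  "boundary F \<equiv> {(x, y). x \<in> F \<and> y \<notin> F \<and> E x y}"

abbreviation exits :: "'g \<Rightarrow> 'x set \<Rightarrow> 'x set" where
  "exits s F \<equiv> {x \<in> F. act s x \<notin> F}"

definition hyperfinite_mean :: "('x set \<Rightarrow> real) \<Rightarrow> bool" where
  "hyperfinite_mean \<mu> \<longleftrightarrow> mean \<mu> \<and> (\<forall>s\<in>S. \<forall>A. \<mu> (act s ` A) = \<mu> A) \<and>
    (\<forall>\<epsilon>>0. \<exists>Y K. \<mu> Y < \<epsilon> \<and> K > (0::nat) \<and>
      (\<forall>x\<in>- Y. finite (induced_component E (- Y) x) \<and> card (induced_component E (- Y) x) \<le> K))"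

lemma hyperfinite_meanD:
  assumes "hyperfinite_mean \<mu>"
  shows "mean \<mu>" "s \<in> S \<Longrightarrow> \<mu> (act s ` A) = \<mu> A"
    "\<epsilon> > 0 \<Longrightarrow> \<exists>Y K. \<mu> Y < \<epsilon> \<and> K > (0::nat) \<and>
      (\<forall>x\<in>- Y. finite (induced_component E (- Y) x) \<and> card (induced_component E (- Y) x) \<le> K)"
  using assms unfolding hyperfinite_mean_def by simp_all

section \<open>Boundary edges and the points at which generators leave a set\<close>

lemma boundary_eq: "boundary F = (\<Union>s\<in>S. (\<lambda>x. (x, act s x)) ` exits s F)"
  by (auto simp: schreier_edge_def)

lemma finite_boundary: "finite F \<Longrightarrow> finite (boundary F)"
  unfolding boundary_eq using finite_S by auto

text \<open>Only an inequality, since different generators may produce the same edge.\<close>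

lemma card_boundary_le:
  assumes "finite F"
  shows "card (boundary F) \<le> (\<Sum>s\<in>S. card (exits s F))"
proof -
  have "card (boundary F) \<le> (\<Sum>s\<in>S. card ((\<lambda>x. (x, act s x)) ` exits s F))"
    unfolding boundary_eq by (rule card_UN_le[OF finite_S])
  also have "\<dots> \<le> (\<Sum>s\<in>S. card (exits s F))"
    using assms by (intro sum_mono card_image_le) auto
  finally show ?thesis .
qed

lemma card_exits_le:
  assumes "finite F" "s \<in> S"
  shows "card (exits s F) \<le> card (boundary F)"
proof -
  have "card (exits s F) = card ((\<lambda>x. (x, act s x)) ` exits s F)"
    by (rule card_image[symmetric]) (auto simp: inj_on_def)
  also have "\<dots> \<le> card (boundary F)"
    using assms(2) finite_boundary[OF assms(1)] by (intro card_mono) (auto simp: schreier_edge_def)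
  finally show ?thesis .
qed

section \<open>From means to Foelner sequences\<close>

text \<open>If no such \<open>F\<close> exists, the cut condition holds for the supply
  \<open>c\<close> that puts weight \<open>w i\<close> on \<open>Y i\<close>. The resulting flow
  satisfies: supply plus net inflow is at least 1 everywhere. Net inflow integrates to 0 against an
  invariant mean, so \<open>c\<close> would have integral at least 1, against
  \<open>small\<close>.\<close>

lemma exists_almost_invariant_set:
  fixes w :: "'i \<Rightarrow> real"
  assumes \<mu>: "mean \<mu>" and inv: "\<And>s A. s \<in> S \<Longrightarrow> \<mu> (act s ` A) = \<mu> A"
    and X: "countable (UNIV :: 'x set)" "infinite (UNIV :: 'x set)"
    and I: "finite I" and w: "\<And>i. i \<in> I \<Longrightarrow> 0 \<le> w i" and small: "(\<Sum>i\<in>I. w i * \<mu> (Y i)) < 1" and M: "0 \<le> M"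
  shows "\<exists>F. finite F \<and> F \<noteq> {} \<and>
    M * (\<Sum>s\<in>S. real (card (exits s F))) + (\<Sum>i\<in>I. w i * real (card (F \<inter> Y i))) < real (card F)"
proof (rule ccontr)
  assume neg: "\<not> ?thesis"
  define c where "c x = (\<Sum>i\<in>I. w i * indicat_real (Y i) x)" for x
  have cut: "real (card A) \<le> M * (\<Sum>s\<in>S. real (card (exits s A))) + (\<Sum>x\<in>A. c x)"
    if "finite A" "A \<noteq> {}" for A
  proof -
    have "(\<Sum>x\<in>A. c x) = (\<Sum>i\<in>I. w i * (\<Sum>x\<in>A. indicat_real (Y i) x))"
      unfolding c_def sum_distrib_left by (rule sum.swap)
    also have "\<dots> = (\<Sum>i\<in>I. w i * card (A \<inter> Y i))"
      using that(1) by (simp add: sum.If_cases indicator_def[abs_def] Int_def)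
    finally show ?thesis using neg that by force
  qed
  have c: "0 \<le> c x" "c x \<le> sum w I" for x
  proof -
    show "0 \<le> c x" unfolding c_def using w by (intro sum_nonneg) auto
    show "c x \<le> sum w I" unfolding c_def using w by (intro sum_mono) (auto simp: indicator_def)
  qed
  have "\<exists>\<theta>. (\<forall>p. 0 \<le> \<theta> p \<and> \<theta> p \<le> M) \<and> (\<forall>x. 0 \<le> flow_excess act S c \<theta> x)"
    by (rule exists_flow[where B = "sum w I"]) (use finite_S bij_act X M c cut in auto)
  then obtain \<theta> where \<theta>: "\<And>p. 0 \<le> \<theta> p" "\<And>p. \<theta> p \<le> M"
    and ex: "\<And>x. 0 \<le> flow_excess act S c \<theta> x"
    by metis
  define m where "m = (\<Sum>i\<in>I. w i * \<mu> (Y i))"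
  \<comment> \<open>The slack \<open>1 - m\<close>, scaled by \<open>N\<close>, must exceed the
    total rounding loss, which is at most 1 for each generator.\<close>
  obtain N :: nat where N: "real (card S) < real N * (1 - m)"
    using reals_Archimedean3[of "1 - m"] small by (auto simp: m_def)
  \<comment> \<open>Integer parts of the scaled flow are bounded integers, so \<open>h s\<close> has
    finite range and can be integrated.\<close>
  define h where "h s x = real_of_int \<lfloor>N * \<theta> (x, s)\<rfloor>" for s x
  let ?i = "\<lambda>s. inv_into UNIV (act s)"
  have fin_h: "finite (range (h s))" for s
  proof -
    have "range (h s) \<subseteq> real_of_int ` {0..\<lfloor>N * M\<rfloor>}"
    proof
      fix v assume "v \<in> range (h s)"
      then obtain x where v: "v = h s x" by blast
      have "0 \<le> N * \<theta> (x, s)" "N * \<theta> (x, s) \<le> N * M"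
        using \<theta>[of "(x, s)"] by (simp_all add: mult_left_mono)
      then show "v \<in> real_of_int ` {0..\<lfloor>N * M\<rfloor>}"
        unfolding v h_def by (intro imageI) (simp add: floor_mono)
    qed
    then show ?thesis by (rule finite_subset) simp
  qed
  have fin_hi: "finite (range (\<lambda>x. h s (?i s x)))" for s
    by (rule finite_subset[OF _ fin_h[of s]]) auto
  have fin_c: "finite (range (\<lambda>x. w i * indicat_real (Y i) x))" for i
    by (rule finite_subset[of _ "{0, w i}"]) (auto simp: indicator_def)
  let ?f = "\<lambda>x. (N * c x + card S) + (\<Sum>s\<in>S. h s (?i s x) - h s x)"
  have fin1: "finite (range c)"
    unfolding c_def[abs_def] using I fin_c by (rule finite_range_sum)
  have fin2: "finite (range (\<lambda>x. N * c x + card S))"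
    using finite_imageI[OF fin1, of "\<lambda>v. N * v + card S"] by (simp add: image_image)
  have fin3: "finite (range (\<lambda>x. h s (?i s x) - h s x))" for s
    by (rule finite_subset[of _ "(\<lambda>(a, b). a - b) ` (range (\<lambda>x. h s (?i s x)) \<times> range (h s))"])
      (auto intro!: fin_h fin_hi simp: image_iff)
  have fin4: "finite (range (\<lambda>x. \<Sum>s\<in>S. h s (?i s x) - h s x))"
    using finite_S fin3 by (rule finite_range_sum)
  have le: "real N \<le> ?f x" for x
  proof -
    have "real N * (\<Sum>s\<in>S. \<theta> (?i s x, s) - \<theta> (x, s)) = (\<Sum>s\<in>S. N * \<theta> (?i s x, s) - N * \<theta> (x, s))"
      by (simp add: sum_distrib_left right_diff_distrib)
    also have "\<dots> \<le> (\<Sum>s\<in>S. (h s (?i s x) - h s x) + 1)"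
      unfolding h_def by (intro sum_mono) linarith
    also have "\<dots> = (\<Sum>s\<in>S. h s (?i s x) - h s x) + card S"
      by (simp add: sum.distrib)
    finally have *: "real N * (\<Sum>s\<in>S. \<theta> (?i s x, s) - \<theta> (x, s)) \<le> (\<Sum>s\<in>S. h s (?i s x) - h s x) + card S" .
    have "0 \<le> real N * flow_excess act S c \<theta> x" using ex by simp
    then show ?thesis using * unfolding flow_excess_def by (simp add: algebra_simps)
  qed
  have "real N = mean_int \<mu> (\<lambda>x. real N)" by (simp add: mean_int_const[OF \<mu>])
  also have "\<dots> \<le> mean_int \<mu> ?f"
  proof (rule mean_int_mono[OF \<mu>])
    show "finite (range ?f)"
      by (rule finite_subset[of _ "(\<lambda>(a, b). a + b) ` (range (\<lambda>x. N * c x + card S) \<times> range (\<lambda>x. \<Sum>s\<in>S. h s (?i s x) - h s x))"])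
        (use fin2 fin4 in \<open>auto simp: image_iff\<close>)
  qed (simp, rule le)
  also have "\<dots> = mean_int \<mu> (\<lambda>x. N * c x + card S) + mean_int \<mu> (\<lambda>x. \<Sum>s\<in>S. h s (?i s x) - h s x)"
    by (rule mean_int_add[OF \<mu> fin2 fin4])
  also have "mean_int \<mu> (\<lambda>x. \<Sum>s\<in>S. h s (?i s x) - h s x) = 0"
  proof -
    have "mean_int \<mu> (\<lambda>x. h s (?i s x) - h s x) = 0" if s: "s \<in> S" for s
    proof -
      have "\<mu> (?i s ` A) = \<mu> A" for A
        using inv[OF s, of "?i s ` A"] bij_act[OF s] by (simp add: image_f_inv_f bij_is_surj)
      then have "mean_int \<mu> (\<lambda>x. h s (?i s x)) = mean_int \<mu> (h s)"
        by (rule mean_int_comp_bij[OF bij_imp_bij_inv[OF bij_act[OF s]]])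
      then show ?thesis
        by (simp add: mean_int_diff[OF \<mu> fin_hi fin_h])
    qed
    then show ?thesis
      by (simp add: mean_int_sum[OF \<mu> finite_S fin3])
  qed
  also have "mean_int \<mu> (\<lambda>x. N * c x + card S) = N * m + card S"
  proof -
    have "mean_int \<mu> (\<lambda>x. N * c x + card S) = mean_int \<mu> (\<lambda>x. N * c x) + mean_int \<mu> (\<lambda>x. card S)"
      using finite_imageI[OF fin1, of "\<lambda>v. N * v"]
      by (intro mean_int_add[OF \<mu>]) (auto simp: image_image)
    also have "mean_int \<mu> (\<lambda>x. N * c x) = N * mean_int \<mu> c"
      by (rule mean_int_cmult[OF \<mu> fin1])
    also have "mean_int \<mu> c = m"
    proof -
      have "finite (range (indicat_real (Y i)))" for i
        by (rule finite_subset[of _ "{0, 1}"]) (auto simp: indicator_def)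
      then show ?thesis
        unfolding c_def[abs_def] mean_int_sum[OF \<mu> I fin_c] m_def
        by (simp add: mean_int_cmult[OF \<mu>] mean_int_indicator[OF \<mu>])
    qed
    finally show ?thesis by (simp add: mean_int_const[OF \<mu>])
  qed
  finally show False using N by (simp add: algebra_simps)
qed

proposition folner_of_mean:
  assumes hm: "hyperfinite_mean \<mu>"
    and X: "countable (UNIV :: 'x set)" "infinite (UNIV :: 'x set)"
  shows "\<exists>F. folner_sequence E F \<and> hyperfinite_graph_seq E F"
proof -
  note \<mu> = hyperfinite_meanD(1)[OF hm] and inv = hyperfinite_meanD(2)[OF hm]
    and hyp = hyperfinite_meanD(3)[OF hm]
  \<comment> \<open>The bound (1/4)^(k+1) leaves room for the weight 2^k: the weighted means add up
    to less than 1/2. In turn the weight forces the set \<open>F n\<close> to meet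
    \<open>Y k\<close> in less than the fraction 2^-k of its points whenever k < n.\<close>
  have "\<forall>k::nat. \<exists>Y K. \<mu> Y < (1/4)^Suc k \<and> K > (0::nat) \<and>
      (\<forall>x\<in>- Y. finite (induced_component E (- Y) x) \<and> card (induced_component E (- Y) x) \<le> K)"
    by (intro allI hyp) simp
  then obtain Y K where Y: "\<And>k. \<mu> (Y k) < (1/4)^Suc k" and K0: "\<And>k. K k > (0::nat)"
    and K: "\<And>k x. x \<in> - Y k \<Longrightarrow> finite (induced_component E (- Y k) x) \<and> card (induced_component E (- Y k) x) \<le> K k"
    by metis
  have small: "(\<Sum>k<n. 2^k * \<mu> (Y k)) < 1" for n
  proof -
    have "(\<Sum>k<n. 2^k * \<mu> (Y k)) \<le> (\<Sum>k<n. 2^k * (1/4)^Suc k)"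
      using Y by (intro sum_mono mult_left_mono less_imp_le) auto
    also have "\<dots> = (\<Sum>k<n. (1/2)^k / 4 :: real)"
    proof (rule sum.cong)
      show "2^k * (1/4)^Suc k = (1/2)^k / (4::real)" for k by (induction k) simp_all
    qed simp
    also have "\<dots> = (1 - (1/2)^n) / 2"
      by (induction n) (simp_all add: field_simps)
    also have "\<dots> < 1"
    proof -
      have *: "(1 - a) / 2 < 1" if "0 < a" for a :: real using that by simp
      show ?thesis by (rule *) simp
    qed
    finally show ?thesis .
  qed
  define ok where "ok n F \<longleftrightarrow> finite F \<and> F \<noteq> {} \<and>
    real (Suc n) * (\<Sum>s\<in>S. real (card (exits s F))) + (\<Sum>k<n. 2^k * real (card (F \<inter> Y k))) < real (card F)" for n F
  have "\<exists>F. ok n F" for n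
    unfolding ok_def
  proof (rule exists_almost_invariant_set[OF \<mu> _ X, where w = "\<lambda>k. 2^k" and I = "{..<n}" and Y = Y and M = "real (Suc n)"])
    show "\<And>s A. s \<in> S \<Longrightarrow> \<mu> (act s ` A) = \<mu> A" by (rule inv)
  qed (use small in simp_all)
  then obtain F where "\<And>n. ok n (F n)" by metis
  then have F: "\<And>n. finite (F n)" "\<And>n. F n \<noteq> {}"
    "\<And>n. real (Suc n) * (\<Sum>s\<in>S. real (card (exits s (F n)))) + (\<Sum>k<n. 2^k * real (card (F n \<inter> Y k))) < real (card (F n))"
    by (simp_all add: ok_def)
  have cF: "0 < card (F n)" for n using F(1,2) by (simp add: card_gt_0_iff)
  have "folner_sequence E F"
    unfolding folner_sequence_def
  proof (intro conjI allI)
    show "(\<lambda>n. iso_const E (F n)) \<longlonglongrightarrow> 0"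
    proof (rule tendsto_sandwich[OF _ _ tendsto_const LIMSEQ_inverse_real_of_nat])
      show "\<forall>\<^sub>F n in sequentially. 0 \<le> iso_const E (F n)"
        by (simp add: iso_const_def)
      have "iso_const E (F n) \<le> inverse (real (Suc n))" for n
      proof -
        have "0 \<le> (\<Sum>k<n. 2^k * real (card (F n \<inter> Y k)))" by (intro sum_nonneg) auto
        then have "real (Suc n) * (\<Sum>s\<in>S. real (card (exits s (F n)))) < card (F n)"
          using F(3)[of n] by linarith
        moreover have "real (card (boundary (F n))) \<le> (\<Sum>s\<in>S. real (card (exits s (F n))))"
          using card_boundary_le[OF F(1)[of n]] by (simp flip: of_nat_sum)
        ultimately have "real (Suc n) * card (boundary (F n)) \<le> card (F n)"
          by (meson less_imp_le mult_left_mono of_nat_0_le_iff order_trans)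
        then show ?thesis
          using cF[of n] unfolding iso_const_def by (simp add: field_simps)
      qed
      then show "\<forall>\<^sub>F n in sequentially. iso_const E (F n) \<le> inverse (real (Suc n))" by simp
    qed
  qed (use F in auto)
  moreover have "hyperfinite_graph_seq E F"
    unfolding hyperfinite_graph_seq_def
  proof (intro allI impI)
    fix \<epsilon> :: real assume "\<epsilon> > 0"
    then obtain k where k: "(1/2)^k < \<epsilon>" using real_arch_pow_inv[of \<epsilon> "1/2"] by auto
    \<comment> \<open>For n \<le> k the choice of \<open>F n\<close> says nothing about
      \<open>Y k\<close>. These finitely many sets are left whole, and their sizes are added to the
      component bound \<open>L\<close>.\<close>
    define Z where "Z n = (if n \<le> k then {} else F n \<inter> Y k)" for n
    define L where "L = K k + (\<Sum>n\<le>k. card (F n))"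
    have "Z n \<subseteq> F n \<and> real (card (Z n)) < \<epsilon> * real (card (F n)) \<and>
      (\<forall>x\<in>F n - Z n. finite (induced_component E (F n - Z n) x) \<and> card (induced_component E (F n - Z n) x) \<le> L)" for n
    proof (cases "n \<le> k")
      case True
      have "card (F n) \<le> L"
        using True member_le_sum[of n "{..k}" "\<lambda>n. card (F n)"] by (simp add: L_def)
      moreover have "finite (induced_component E (F n) x) \<and> card (induced_component E (F n) x) \<le> card (F n)"
        if "x \<in> F n" for x
        using induced_component_subset[OF that, of E] F(1)[of n] by (auto intro: finite_subset card_mono)
      ultimately show ?thesis
        using True cF[of n] \<open>\<epsilon> > 0\<close> by (auto simp: Z_def intro: order_trans)
    next
      case False
      have "2^k * real (card (F n \<inter> Y k)) \<le> (\<Sum>k<n. 2^k * real (card (F n \<inter> Y k)))"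
        using False by (intro member_le_sum[of k "{..<n}" "\<lambda>k. 2^k * real (card (F n \<inter> Y k))"]) auto
      moreover have "0 \<le> real (Suc n) * (\<Sum>s\<in>S. real (card (exits s (F n))))"
        by (intro mult_nonneg_nonneg sum_nonneg) auto
      ultimately have "2^k * real (card (F n \<inter> Y k)) < card (F n)"
        using F(3)[of n] by linarith
      then have "real (card (F n \<inter> Y k)) < (1/2)^k * card (F n)"
        by (simp add: field_simps)
      also have "\<dots> \<le> \<epsilon> * card (F n)" using k by (intro mult_right_mono) auto
      finally have "real (card (F n \<inter> Y k)) < \<epsilon> * card (F n)" .
      moreover have "finite (induced_component E (F n - F n \<inter> Y k) x) \<and> card (induced_component E (F n - F n \<inter> Y k) x) \<le> L"
        if "x \<in> F n - F n \<inter> Y k" for x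
      proof -
        have sub: "induced_component E (F n - F n \<inter> Y k) x \<subseteq> induced_component E (- Y k) x"
          by (rule induced_component_mono) auto
        have "x \<in> - Y k" using that by auto
        then have "finite (induced_component E (- Y k) x)" "card (induced_component E (- Y k) x) \<le> K k"
          using K by blast+
        then show ?thesis
          using card_mono[OF _ sub] finite_subset[OF sub] by (simp add: L_def)
      qed
      ultimately show ?thesis using False by (simp add: Z_def)
    qed
    moreover have "L > 0" using K0 by (simp add: L_def add_pos_nonneg)
    ultimately show "\<exists>K>0. \<exists>Y. \<forall>n. Y n \<subseteq> F n \<and> real (card (Y n)) < \<epsilon> * real (card (F n)) \<and>
      (\<forall>x\<in>F n - Y n. finite (induced_component E (F n - Y n) x) \<and> card (induced_component E (F n - Y n) x) \<le> K)"
      by blast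
  qed
  ultimately show ?thesis by blast
qed

end

section \<open>From Foelner sequences to means\<close>

text \<open>The cube of functions on all subsets of the space is compact but need not be
  sequentially compact, so the limit is taken along a filter finer than \<open>sequentially\<close>
  instead of a subsequence.\<close>

lemma mean_limit:
  assumes m: "\<And>n::nat. mean (m n)"
  shows "\<exists>\<mu> H. mean \<mu> \<and> H \<noteq> bot \<and> H \<le> sequentially \<and> (\<forall>A. ((\<lambda>n. m n A) \<longlongrightarrow> \<mu> A) H)"
proof -
  let ?K = "PiE UNIV (\<lambda>_. {0..1}) :: ('a set \<Rightarrow> real) set"
  let ?F = "filtermap m sequentially"
  have "?F \<noteq> bot" by (simp add: filtermap_bot_iff)
  moreover have "m n \<in> ?K" for n
    using mean_nonneg[OF m] mean_le_1[OF m] by auto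
  then have "eventually (\<lambda>x. x \<in> ?K) ?F" by (simp add: eventually_filtermap)
  ultimately obtain \<mu> where \<mu>: "inf (nhds \<mu>) ?F \<noteq> bot"
    using compact_PiE_Icc[of 1] unfolding compact_filter by metis
  \<comment> \<open>Neighbourhoods of the cluster point are pulled back along \<open>m\<close>; this
    filter is proper exactly because \<open>\<mu>\<close> is a cluster point.\<close>
  define H where "H = inf sequentially (filtercomap m (nhds \<mu>))"
  have H: "H \<noteq> bot"
  proof
    assume "H = bot"
    then have "eventually (\<lambda>_. False) H" by simp
    then obtain P Q where P: "eventually P sequentially" and Q: "eventually Q (filtercomap m (nhds \<mu>))"
      and PQ: "\<And>n. P n \<Longrightarrow> Q n \<Longrightarrow> False"
      unfolding H_def eventually_inf by blast
    obtain Q' where Q': "eventually Q' (nhds \<mu>)" "\<And>n. Q' (m n) \<Longrightarrow> Q n"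
      using Q unfolding eventually_filtercomap by blast
    have "eventually (\<lambda>x. \<not> Q' x) ?F"
      unfolding eventually_filtermap using P by (rule eventually_mono) (use PQ Q' in blast)
    then have "eventually (\<lambda>_. False) (inf (nhds \<mu>) ?F)"
      unfolding eventually_inf using Q'(1) by blast
    then show False using \<mu> by (simp add: trivial_limit_def)
  qed
  have Hs: "H \<le> sequentially" by (simp add: H_def)
  have "(m \<longlongrightarrow> \<mu>) (filtercomap m (nhds \<mu>))"
    by (rule filterlim_filtercomap)
  then have tends: "(m \<longlongrightarrow> \<mu>) H" by (rule tendsto_mono[rotated]) (simp add: H_def)
  have lim: "((\<lambda>n. m n A) \<longlongrightarrow> \<mu> A) H" for A
    by (rule continuous_on_tendsto_compose[OF continuous_on_product_coordinates[of A] tends]) auto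
  have "mean \<mu>"
    unfolding mean_def
  proof (intro conjI allI impI)
    fix A B :: "'a set"
    show "0 \<le> \<mu> A"
      by (rule tendsto_lowerbound[OF lim[of A] _ H]) (simp add: mean_nonneg[OF m])
    show "\<mu> A \<le> 1"
      by (rule tendsto_upperbound[OF lim[of A] _ H]) (simp add: mean_le_1[OF m])
    show "\<mu> UNIV = 1"
      using tendsto_unique[OF H lim[of UNIV], of 1] by (simp add: mean_UNIV[OF m])
    assume "A \<inter> B = {}"
    then have "m n (A \<union> B) = m n A + m n B" for n by (rule mean_Un[OF m])
    then show "\<mu> (A \<union> B) = \<mu> A + \<mu> B"
      using tendsto_add[OF lim[of A] lim[of B]] lim[of "A \<union> B"] by (intro tendsto_unique[OF H]) simp_all
  qed
  then show ?thesis using H Hs lim by blast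
qed

lemma mean_uniform:
  assumes "finite F" "F \<noteq> {}"
  shows "mean (\<lambda>A. real (card (A \<inter> F)) / real (card F))"
  unfolding mean_def
proof (intro conjI allI impI)
  have F: "0 < card F" using assms by (simp add: card_gt_0_iff)
  fix A B :: "'a set"
  show "real (card (A \<inter> F)) / real (card F) \<le> 1"
    using F assms(1) by (simp add: card_mono)
  show "real (card (UNIV \<inter> F)) / real (card F) = 1" using F by simp
  assume "A \<inter> B = {}"
  then have "card ((A \<union> B) \<inter> F) = card (A \<inter> F) + card (B \<inter> F)"
    using assms(1) by (subst card_Un_disjoint[symmetric]) (auto intro: arg_cong[where f = card])
  then show "real (card ((A \<union> B) \<inter> F)) / real (card F)
      = real (card (A \<inter> F)) / real (card F) + real (card (B \<inter> F)) / real (card F)"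
    by (simp add: add_divide_distrib)
qed simp

context symmetric_generators begin

lemma E_sym: "E x y \<Longrightarrow> E y x"
  unfolding schreier_edge_def using inverse_act by metis

text \<open>Points of \<open>A\<close> in \<open>F\<close> that do not exit are mapped injectively
  into the translate within \<open>F\<close>; the exits are paid for by the boundary.\<close>

lemma card_Int_le_translate:
  assumes F: "finite F" and s: "s \<in> S"
  shows "card (A \<inter> F) \<le> card (act s ` A \<inter> F) + card (boundary F)"
proof -
  have inj: "inj (act s)" using bij_act[OF s] by (rule bij_is_inj)
  have "card (A \<inter> F) \<le> card ((A \<inter> F - exits s F) \<union> exits s F)"
    using F by (intro card_mono) auto
  also have "\<dots> \<le> card (A \<inter> F - exits s F) + card (exits s F)" by (rule card_Un_le)
  also have "card (A \<inter> F - exits s F) = card (act s ` (A \<inter> F - exits s F))"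
    using inj by (intro card_image[symmetric]) (auto intro: inj_on_subset)
  also have "\<dots> \<le> card (act s ` A \<inter> F)" using F by (intro card_mono) auto
  finally show ?thesis using card_exits_le[OF F s] by linarith
qed

text \<open>Applying the inequality to the translate and the inverse generator gives the reverse
  one.\<close>

lemma mean_invariantI:
  assumes le: "\<And>s A. s \<in> S \<Longrightarrow> \<mu> A \<le> \<mu> (act s ` A)" and s: "s \<in> S"
  shows "\<mu> (act s ` A) = (\<mu> A :: real)"
proof -
  obtain t where t: "t \<in> S" "\<forall>x. act t (act s x) = x" using inverse_act[OF s] by blast
  then have "act t ` act s ` A = A" by (simp add: image_image)
  then show ?thesis using le[OF s, of A] le[OF t(1), of "act s ` A"] by simp
qed

text \<open>The complement of \<open>F\<close> has mean 0 and can serve as the exceptional set for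
  every \<open>\<epsilon>\<close>. The case is separate because Foelner sets need not grow here, for
  instance in a constant sequence.\<close>

proposition mean_of_invariant_set:
  assumes F: "finite F" "F \<noteq> {}" and b: "boundary F = {}"
  shows "\<exists>\<mu>. hyperfinite_mean \<mu>"
proof -
  define \<mu> where "\<mu> A = real (card (A \<inter> F)) / real (card F)" for A
  have "mean \<mu>" unfolding \<mu>_def[abs_def] by (rule mean_uniform[OF F])
  moreover have "\<mu> (act s ` A) = \<mu> A" if "s \<in> S" for s A
  proof (rule mean_invariantI[OF _ that])
    fix s A assume "s \<in> S"
    have "card (A \<inter> F) \<le> card (act s ` A \<inter> F)"
      using card_Int_le_translate[OF F(1) \<open>s \<in> S\<close>, of A] unfolding b by simp
    then show "\<mu> A \<le> \<mu> (act s ` A)" by (simp add: \<mu>_def divide_right_mono)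
  qed
  moreover have "\<exists>Y K. \<mu> Y < \<epsilon> \<and> K > (0::nat) \<and>
      (\<forall>x\<in>- Y. finite (induced_component E (- Y) x) \<and> card (induced_component E (- Y) x) \<le> K)"
    if "\<epsilon> > 0" for \<epsilon>
  proof (intro exI conjI ballI)
    show "\<mu> (- F) < \<epsilon>" using that by (simp add: \<mu>_def)
    show "card F > 0" using F by (simp add: card_gt_0_iff)
    fix x assume "x \<in> - (- F)"
    then have "induced_component E (- (- F)) x \<subseteq> F" using induced_component_subset[of x F E] by simp
    then show "finite (induced_component E (- (- F)) x)" "card (induced_component E (- (- F)) x) \<le> card F"
      using F(1) by (auto intro: finite_subset card_mono)
  qed
  ultimately show ?thesis unfolding hyperfinite_mean_def by blast
qed

section \<open>Gluing a Foelner sequence along a sparse subsequence\<close>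

abbreviation nbhd :: "'x set \<Rightarrow> 'x set" where
  "nbhd B \<equiv> B \<union> (\<Union>s\<in>S. act s ` B)"

text \<open>Without finite invariant sets every \<open>F n\<close> has at least one boundary edge,
  so its isoperimetric constant is at least the reciprocal of its size.\<close>

lemma eventually_card_folner_ge:
  assumes fol: "folner_sequence E F" and b: "\<And>F. finite F \<Longrightarrow> F \<noteq> {} \<Longrightarrow> boundary F \<noteq> {}"
  shows "eventually (\<lambda>n. N \<le> card (F n)) sequentially"
proof -
  have "eventually (\<lambda>n. iso_const E (F n) < 1 / real (Suc N)) sequentially"
    using fol by (intro order_tendstoD) (auto simp: folner_sequence_def)
  then show ?thesis
  proof (rule eventually_mono)
    fix n assume n: "iso_const E (F n) < 1 / real (Suc N)"
    have F: "finite (F n)" "F n \<noteq> {}" using fol by (auto simp: folner_sequence_def)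
    have "0 < card (boundary (F n))"
      using b[OF F] finite_boundary[OF F(1)] card_gt_0_iff by blast
    then have 1: "1 \<le> real (card (boundary (F n)))" by linarith
    have 2: "0 < real (card (F n))" using F by (simp add: card_gt_0_iff)
    have "1 / real (card (F n)) \<le> iso_const E (F n)"
      unfolding iso_const_def using 1 2 by (intro divide_right_mono) auto
    then have "1 / real (card (F n)) < 1 / real (Suc N)" using n by linarith
    then have "real (Suc N) < real (card (F n))" using 2 by (simp add: divide_simps split: if_splits)
    then show "N \<le> card (F n)" by linarith
  qed
qed

text \<open>The sets of a Foelner sequence may overlap. Along a rapidly growing subsequence, removing from
  each set the neighbourhood of its predecessors costs little and separates the sets.\<close>

proposition mean_of_folner:
  assumes fol: "folner_sequence E F" and hyp: "hyperfinite_graph_seq E F"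
  shows "\<exists>\<mu>. hyperfinite_mean \<mu>"
proof (cases "\<exists>F. finite F \<and> F \<noteq> {} \<and> boundary F = {}")
  case True
  then obtain F where "finite F" "F \<noteq> {}" "boundary F = {}" by (elim exE conjE)
  then show ?thesis by (rule mean_of_invariant_set)
next
  case False
  have b: "boundary A \<noteq> {}" if "finite A" "A \<noteq> {}" for A
  proof
    assume "boundary A = {}"
    with that have "finite A \<and> A \<noteq> {} \<and> boundary A = {}" by (intro conjI)
    with False show False by (elim notE exI)
  qed
  have F: "finite (F n)" "F n \<noteq> {}" for n using fol by (auto simp: folner_sequence_def)
  have cF: "0 < card (F n)" for n using F by (simp add: card_gt_0_iff)
  define T where "T a = (\<Union>j\<le>a. F j)" for a
  \<comment> \<open>The neighbourhood of all sets up to index \<open>r n\<close> is at most the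
    fraction 1/(n+1) of the next chosen set.\<close>
  have "\<exists>r. \<forall>n::nat. True \<and> (r n < r (Suc n) \<and> Suc n * card (nbhd (T (r n))) \<le> card (F (r (Suc n))))"
  proof (rule dependent_nat_choice)
    fix a n :: nat
    have "eventually (\<lambda>b. Suc n * card (nbhd (T a)) \<le> card (F b) \<and> a < b) sequentially"
      using eventually_card_folner_ge[OF fol b] eventually_gt_at_top by (rule eventually_conj)
    then show "\<exists>b. True \<and> a < b \<and> Suc n * card (nbhd (T a)) \<le> card (F b)"
      by (auto simp: eventually_sequentially)
  qed simp
  then obtain r where r: "\<And>n. r n < r (Suc n)"
    and big: "\<And>n. Suc n * card (nbhd (T (r n))) \<le> card (F (r (Suc n)))" by blast
  have mono: "strict_mono r" using r by (simp add: strict_mono_Suc_iff)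
  define m where "m n A = real (card (A \<inter> F (r n))) / real (card (F (r n)))" for n A
  have "mean (m n)" for n unfolding m_def[abs_def] by (rule mean_uniform[OF F])
  from mean_limit[of m, OF this] obtain \<mu> H where \<mu>: "mean \<mu>" and H: "H \<noteq> bot" "H \<le> sequentially"
    and lim: "\<And>A. ((\<lambda>n. m n A) \<longlongrightarrow> \<mu> A) H" by blast
  have iso: "((\<lambda>n. iso_const E (F (r n))) \<longlongrightarrow> 0) H"
    using fol LIMSEQ_subseq_LIMSEQ[OF _ mono, of "\<lambda>n. iso_const E (F n)" 0] tendsto_mono[OF H(2)]
    by (auto simp: folner_sequence_def comp_def)
  have "\<mu> (act s ` A) = \<mu> A" if "s \<in> S" for s A
  proof (rule mean_invariantI[OF _ that])
    fix s A assume s: "s \<in> S"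
    have "m n A \<le> m n (act s ` A) + iso_const E (F (r n))" for n
    proof -
      have "real (card (A \<inter> F (r n))) \<le> real (card (act s ` A \<inter> F (r n))) + real (card (boundary (F (r n))))"
        using card_Int_le_translate[OF F(1) s, of A "r n"] by linarith
      then show ?thesis
        unfolding m_def iso_const_def add_divide_distrib[symmetric] by (rule divide_right_mono) simp
    qed
    then have "\<mu> A \<le> \<mu> (act s ` A) + 0"
      by (intro tendsto_le[OF H(1) tendsto_add[OF lim iso] lim]) simp
    then show "\<mu> A \<le> \<mu> (act s ` A)" by simp
  qed
  moreover have "\<exists>Y K. \<mu> Y < \<epsilon> \<and> K > (0::nat) \<and>
      (\<forall>x\<in>- Y. finite (induced_component E (- Y) x) \<and> card (induced_component E (- Y) x) \<le> K)"
    if \<epsilon>: "\<epsilon> > 0" for \<epsilon>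
  proof -
    from hyp \<epsilon> obtain K Y where "K > 0" and Y: "\<And>n. Y n \<subseteq> F n"
        "\<And>n. real (card (Y n)) < \<epsilon> / 2 * real (card (F n))"
      and K: "\<And>n x. x \<in> F n - Y n \<Longrightarrow> finite (induced_component E (F n - Y n) x) \<and>
        card (induced_component E (F n - Y n) x) \<le> K"
      unfolding hyperfinite_graph_seq_def by (metis half_gt_zero)
    define P where "P n = (\<Union>j<n. F (r j))" for n
    \<comment> \<open>The part of \<open>F (r n)\<close> that survives the deletion of its own
      exceptional set and of everything adjacent to its predecessors. The common exceptional set
      \<open>V\<close> is what no \<open>Z n\<close> contains.\<close>
    define Z where "Z n = F (r n) - Y (r n) - nbhd (P n)" for n
    define V where "V = - (\<Union>n. Z n)"
    have "m n V \<le> \<epsilon> / 2 + 1 / real n" if "n > 0" for n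
    proof -
      have "\<exists>k. n = Suc k" using that by (rule gr0_implies_Suc)
      then obtain k where n: "n = Suc k" by (elim exE)
      have "P n \<subseteq> T (r k)"
      proof
        fix x assume "x \<in> P n"
        then obtain j where "j \<le> k" "x \<in> F (r j)" by (auto simp: P_def n less_Suc_eq_le)
        then show "x \<in> T (r k)" using strict_mono_less_eq[OF mono] by (auto simp: T_def)
      qed
      then have sub: "nbhd (P n) \<subseteq> nbhd (T (r k))" by auto
      have fT: "finite (nbhd (T (r k)))" using F(1) finite_S by (auto simp: T_def)
      have c: "card (nbhd (P n)) \<le> card (nbhd (T (r k)))" by (rule card_mono[OF fT sub])
      have fP: "finite (nbhd (P n))" by (rule finite_subset[OF sub fT])
      have "n * card (nbhd (P n)) \<le> n * card (nbhd (T (r k)))" using c by (rule mult_le_mono2)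
      also have "\<dots> \<le> card (F (r n))" using big[of k] by (simp only: n)
      finally have "real n * real (card (nbhd (P n))) \<le> real (card (F (r n)))"
        by (metis of_nat_le_iff of_nat_mult)
      then have 1: "real (card (nbhd (P n))) \<le> 1 / real n * real (card (F (r n)))"
        using that by (simp add: field_simps)
      have "V \<inter> F (r n) \<subseteq> Y (r n) \<union> nbhd (P n)" by (auto simp: V_def Z_def)
      moreover have "finite (Y (r n))" using Y(1) F(1) by (rule finite_subset)
      ultimately have "card (V \<inter> F (r n)) \<le> card (Y (r n) \<union> nbhd (P n))"
        using fP by (intro card_mono) auto
      also have "\<dots> \<le> card (Y (r n)) + card (nbhd (P n))" by (rule card_Un_le)
      finally have "real (card (V \<inter> F (r n))) \<le> (\<epsilon> / 2 + 1 / real n) * real (card (F (r n)))"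
        using 1 Y(2)[of "r n"] by (simp add: distrib_right)
      then show ?thesis using cF[of "r n"] by (simp add: m_def pos_divide_le_eq)
    qed
    then have "eventually (\<lambda>n. m n V \<le> \<epsilon> / 2 + 1 / real n) sequentially"
      by (auto intro: eventually_mono[OF eventually_gt_at_top[of 0]])
    then have "eventually (\<lambda>n. m n V \<le> \<epsilon> / 2 + 1 / real n) H"
      using H(2) by (simp add: le_filter_def)
    moreover have "((\<lambda>n. \<epsilon> / 2 + 1 / real n) \<longlongrightarrow> \<epsilon> / 2 + 0) H"
      by (intro tendsto_add tendsto_const tendsto_mono[OF H(2)] lim_1_over_n)
    ultimately have "\<mu> V \<le> \<epsilon> / 2 + 0"
      by (intro tendsto_le[OF H(1) _ lim])
    then have "\<mu> V < \<epsilon>" using \<epsilon> by simp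
    moreover have "finite (induced_component E (- V) x) \<and> card (induced_component E (- V) x) \<le> K"
      if "x \<in> - V" for x
    proof -
      obtain n where n: "x \<in> Z n" using \<open>x \<in> - V\<close> by (auto simp: V_def)
      \<comment> \<open>A neighbour of an earlier piece has been removed from every later one;
        symmetry of the edges covers the opposite order. Hence a path avoiding \<open>V\<close>
        stays in one piece.\<close>
      have sep: "j = i" if "y \<in> Z i" "z \<in> Z j" "E y z" for y z i j
      proof -
        have *: "\<not> i < j" if "y \<in> Z i" "z \<in> Z j" "E y z" for y z i j
        proof
          assume "i < j"
          then have "y \<in> P j" using \<open>y \<in> Z i\<close> by (auto simp: Z_def P_def)
          then have "z \<in> nbhd (P j)" using \<open>E y z\<close> by (auto simp: schreier_edge_def)
          then show False using \<open>z \<in> Z j\<close> by (simp add: Z_def)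
        qed
        show ?thesis using *[OF that] *[OF that(2,1) E_sym[OF that(3)]] by simp
      qed
      have "y \<in> Z n \<and> (x, y) \<in> {(a, b). a \<in> F (r n) - Y (r n) \<and> b \<in> F (r n) - Y (r n) \<and> E a b}\<^sup>*"
        if "(x, y) \<in> {(a, b). a \<in> - V \<and> b \<in> - V \<and> E a b}\<^sup>*" for y
        using that
      proof (induction rule: rtrancl_induct)
        case base then show ?case using n by simp
      next
        case (step y z)
        then obtain j where j: "z \<in> Z j" by (auto simp: V_def)
        then have "z \<in> Z n" using sep[of y n z j] step by auto
        moreover have "(y, z) \<in> {(a, b). a \<in> F (r n) - Y (r n) \<and> b \<in> F (r n) - Y (r n) \<and> E a b}"
          using step \<open>z \<in> Z n\<close> by (auto simp: Z_def)
        ultimately show ?case using step.IH by (meson rtrancl.rtrancl_into_rtrancl)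
      qed
      then have sub: "induced_component E (- V) x \<subseteq> induced_component E (F (r n) - Y (r n)) x"
        unfolding induced_component_def by blast
      have "x \<in> F (r n) - Y (r n)" using n by (auto simp: Z_def)
      from K[OF this] show ?thesis
        using sub card_mono[OF _ sub] by (auto intro: finite_subset)
    qed
    ultimately show ?thesis using \<open>K > 0\<close> by blast
  qed
  ultimately show ?thesis unfolding hyperfinite_mean_def using \<mu> by blast
qed

end

section \<open>From means to hyperfinite measures\<close>

lemma closedin_imp_borel_sets:
  assumes "closedin T C"
  shows "C \<in> borel_sets T"
proof -
  interpret sigma_algebra "topspace T" "borel_sets T" by (rule sigma_algebra_borel_sets)
  have "openin T (topspace T - C)" using assms by (simp add: closedin_def)
  then have "topspace T - (topspace T - C) \<in> borel_sets T"
    by (intro compl_sets openin_imp_borel_sets)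
  moreover have "topspace T - (topspace T - C) = C"
    using closedin_subset[OF assms] by (simp add: double_diff)
  ultimately show ?thesis by simp
qed

lemma borel_sets_preimage:
  assumes f: "continuous_map T T' f" and V: "V \<in> borel_sets T'"
  shows "{x \<in> topspace T. f x \<in> V} \<in> borel_sets T"
proof -
  interpret sigma_algebra "topspace T" "borel_sets T" by (rule sigma_algebra_borel_sets)
  have ft: "f x \<in> topspace T'" if "x \<in> topspace T" for x
    using f that by (auto simp: continuous_map_def)
  show ?thesis
    using V unfolding borel_sets_def[of T']
  proof (induction rule: sigma_sets.induct)
    case (Basic a)
    then show ?case
      using openin_continuous_map_preimage[OF f] by (intro openin_imp_borel_sets) simp
  next
    case Empty
    show ?case by simp
  next
    case (Compl a)
    have "{x \<in> topspace T. f x \<in> topspace T' - a} = topspace T - {x \<in> topspace T. f x \<in> a}"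
      using ft by auto
    then show ?case using Compl.IH by (simp add: compl_sets)
  next
    case (Union a)
    have "{x \<in> topspace T. f x \<in> (\<Union>i. a i)} = (\<Union>i. {x \<in> topspace T. f x \<in> a i})" by auto
    moreover have "(\<Union>i. {x \<in> topspace T. f x \<in> a i}) \<in> borel_sets T"
      using Union.IH by (intro countable_UN) auto
    ultimately show ?case by simp
  qed
qed

text \<open>The graph is the equaliser of two continuous maps into a Hausdorff space.\<close>

lemma closedin_beta_graph:
  assumes s: "bij s"
  shows "closedin (prod_topology beta_topology beta_topology)
    {p \<in> betaX \<times> betaX. ext_map s (fst p) = snd p}"
proof -
  have "continuous_map (prod_topology beta_topology beta_topology) beta_topology (ext_map s \<circ> fst)"
    by (rule continuous_map_compose[OF continuous_map_fst continuous_map_ext_map[OF s]])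
  from closedin_continuous_maps_eq[OF Hausdorff_space_beta this continuous_map_snd]
  show ?thesis by (simp add: topspace_beta)
qed

lemma closedin_basic_clopen: "closedin beta_topology (basic_clopen A)"
  unfolding closedin_def topspace_beta
  using openin_basic_clopen[of "- A"] basic_clopen_subset_betaX by (simp add: basic_clopen_Compl)

section \<open>The subgraph of the graphing inside a clopen set\<close>

context symmetric_generators begin

abbreviation ext :: "'g \<Rightarrow> 'x set set \<Rightarrow> 'x set set" where
  "ext s \<equiv> ext_map (act s)"

lemma ext_inverse:
  assumes "s \<in> S"
  shows "\<exists>t\<in>S. \<forall>\<omega>. ext t (ext s \<omega>) = \<omega>"
proof -
  obtain t where t: "t \<in> S" "\<forall>x. act t (act s x) = x" using inverse_act[OF assms] by (elim bexE)
  then have "act t \<circ> act s = id" by auto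
  then have "ext t (ext s \<omega>) = \<omega>" for \<omega> by (simp add: ext_map_comp ext_map_id)
  with t(1) show ?thesis by (intro bexI allI)
qed

lemma ext_in_betaX: "s \<in> S \<Longrightarrow> \<omega> \<in> betaX \<Longrightarrow> ext s \<omega> \<in> betaX"
  by (rule ext_map_in_betaX[OF bij_act])

lemma graphing_edges_iff:
  "(\<omega>, \<omega>') \<in> graphing_edges act S \<longleftrightarrow> \<omega> \<in> betaX \<and> \<omega> \<noteq> \<omega>' \<and> (\<exists>s\<in>S. ext s \<omega> = \<omega>')"
  unfolding graphing_edges_def using ext_in_betaX by auto

text \<open>The condition \<open>C \<in> fst p\<close> says that the first endpoint lies in
  \<open>basic_clopen C\<close>, and likewise for the second.\<close>

definition cut_edges :: "'x set \<Rightarrow> ('x set set \<times> 'x set set) set" where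
  "cut_edges C = {p \<in> graphing_edges act S. C \<in> fst p \<and> C \<in> snd p}"

lemma sym_cut_edges: "sym (cut_edges C)"
proof (rule symI)
  fix \<omega> \<omega>' assume "(\<omega>, \<omega>') \<in> cut_edges C"
  then have w: "\<omega> \<in> betaX" "\<omega> \<noteq> \<omega>'" "C \<in> \<omega>" "C \<in> \<omega>'" and "\<exists>s\<in>S. ext s \<omega> = \<omega>'"
    by (simp_all add: cut_edges_def graphing_edges_iff)
  then obtain s where s: "s \<in> S" "ext s \<omega> = \<omega>'" by (elim bexE)
  obtain t where t: "t \<in> S" "\<forall>\<omega>. ext t (ext s \<omega>) = \<omega>" using ext_inverse[OF s(1)] by (elim bexE)
  have "ext t \<omega>' = \<omega>" using t(2) s(2) by metis
  then have "\<exists>s\<in>S. ext s \<omega>' = \<omega>" using t(1) by (rule bexI)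
  moreover have "\<omega>' \<in> betaX" using ext_in_betaX[OF s(1) w(1)] s(2) by simp
  ultimately show "(\<omega>', \<omega>) \<in> cut_edges C"
    using w by (simp add: cut_edges_def graphing_edges_iff)
qed

text \<open>Borel sets here are those of the product topology, so graphs enter as closed sets.
  Subtracting the diagonal \<open>?G id\<close> removes the loops.\<close>

lemma cut_edges_borel: "cut_edges C \<in> borel_sets (prod_topology beta_topology beta_topology)"
proof -
  let ?T = "prod_topology beta_topology beta_topology :: ('x set set \<times> 'x set set) topology"
  interpret sigma_algebra "topspace ?T" "borel_sets ?T" by (rule sigma_algebra_borel_sets)
  let ?G = "\<lambda>s. {p \<in> betaX \<times> betaX. ext_map s (fst p) = snd p} :: ('x set set \<times> 'x set set) set"
  let ?C = "basic_clopen C \<times> basic_clopen C"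
  have G: "?G s \<in> borel_sets ?T" if "bij s" for s
    by (rule closedin_imp_borel_sets[OF closedin_beta_graph[OF that]])
  have C: "?C \<in> borel_sets ?T"
    by (rule closedin_imp_borel_sets) (simp add: closedin_prod_Times_iff closedin_basic_clopen)
  have "(\<Union>s\<in>S. (?G (act s) - ?G id) \<inter> ?C) \<in> borel_sets ?T"
    using finite_S by (intro finite_UN Int Diff G C bij_act bij_id)
  moreover have "cut_edges C = (\<Union>s\<in>S. (?G (act s) - ?G id) \<inter> ?C)"
  proof (rule Set.set_eqI)
    fix p :: "'x set set \<times> 'x set set"
    obtain \<omega> \<omega>' where p: "p = (\<omega>, \<omega>')" by (rule prod.exhaust)
    show "p \<in> cut_edges C \<longleftrightarrow> p \<in> (\<Union>s\<in>S. (?G (act s) - ?G id) \<inter> ?C)"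
      unfolding p cut_edges_def using ext_in_betaX
      by (auto simp: graphing_edges_iff mem_basic_clopen ext_map_id)
  qed
  ultimately show ?thesis by simp
qed

text \<open>A deleted edge from \<open>\<omega>\<close> along \<open>s\<close> has \<open>Y\<close>
  in \<open>\<omega>\<close> or in its image, and the latter means that the preimage of
  \<open>Y\<close> is in \<open>\<omega>\<close>. Both clopen sets have measure
  \<open>\<mu> Y\<close>, and the factor 2 disappears in the edge measure.\<close>

lemma cut_edges_measure:
  fixes \<mu> :: "'x set \<Rightarrow> real"
  assumes \<mu>: "mean \<mu>" and inv: "\<And>s A. s \<in> S \<Longrightarrow> \<mu> (act s ` A) = \<mu> A"
  shows "edge_measure (beta_measure \<mu>) (graphing_edges act S - cut_edges (- Y)) \<le> ennreal (card S * \<mu> Y)"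
proof -
  let ?\<nu> = "beta_measure \<mu>"
  let ?D = "graphing_edges act S - cut_edges (- Y)"
  let ?b = "\<lambda>A. indicator (basic_clopen A) :: 'x set set \<Rightarrow> ennreal"
  have meas: "basic_clopen A \<in> sets ?\<nu>" for A
    by (simp add: sets_beta_measure openin_imp_borel_sets openin_basic_clopen)
  have deg: "ennreal (real (degree_in ?D \<omega>)) \<le> (\<Sum>s\<in>S. ?b Y \<omega> + ?b (act s -` Y) \<omega>)"
    if w: "\<omega> \<in> space ?\<nu>" for \<omega>
  proof -
    have wX: "\<omega> \<in> betaX" using w by (simp add: space_beta_measure)
    let ?S = "{s\<in>S. Y \<in> \<omega> \<or> act s -` Y \<in> \<omega>}"
    have "{\<omega>'. (\<omega>, \<omega>') \<in> ?D} \<subseteq> (\<lambda>s. ext s \<omega>) ` ?S"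
    proof
      fix \<omega>' assume "\<omega>' \<in> {\<omega>'. (\<omega>, \<omega>') \<in> ?D}"
      then have 1: "(\<omega>, \<omega>') \<in> graphing_edges act S" and 2: "\<not> (- Y \<in> \<omega> \<and> - Y \<in> \<omega>')"
        by (simp_all add: cut_edges_def)
      from 1 obtain s where s: "s \<in> S" "\<omega>' = ext s \<omega>" by (auto simp: graphing_edges_iff)
      have "Y \<in> \<omega> \<or> Y \<in> \<omega>'"
        using 2 betaX_Compl_iff[OF wX, of Y] betaX_Compl_iff[OF ext_in_betaX[OF s(1) wX], of Y] s(2) by simp
      then have "s \<in> ?S" using s by (simp add: mem_ext_map[OF bij_act[OF s(1)]])
      then show "\<omega>' \<in> (\<lambda>s. ext s \<omega>) ` ?S" unfolding s(2) by (rule imageI)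
    qed
    then have "degree_in ?D \<omega> \<le> card ?S"
      unfolding degree_in_def using finite_S by (intro surj_card_le) auto
    also have "\<dots> = (\<Sum>s\<in>S. of_bool (Y \<in> \<omega> \<or> act s -` Y \<in> \<omega>))"
      using finite_S by (simp add: Int_def)
    finally have "ennreal (real (degree_in ?D \<omega>)) \<le> of_nat (\<Sum>s\<in>S. of_bool (Y \<in> \<omega> \<or> act s -` Y \<in> \<omega>))"
      by (simp only: ennreal_of_nat_eq_real_of_nat[symmetric] of_nat_le_iff)
    also have "\<dots> \<le> (\<Sum>s\<in>S. ?b Y \<omega> + ?b (act s -` Y) \<omega>)"
      unfolding of_nat_sum using wX by (intro sum_mono) (auto simp: indicator_def mem_basic_clopen)
    finally show ?thesis .
  qed
  have "(\<integral>\<^sup>+ \<omega>. ennreal (real (degree_in ?D \<omega>)) \<partial>?\<nu>) \<le> (\<integral>\<^sup>+ \<omega>. (\<Sum>s\<in>S. ?b Y \<omega> + ?b (act s -` Y) \<omega>) \<partial>?\<nu>)"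
    by (rule nn_integral_mono) (rule deg)
  also have "\<dots> = (\<Sum>s\<in>S. emeasure ?\<nu> (basic_clopen Y) + emeasure ?\<nu> (basic_clopen (act s -` Y)))"
    using meas by (simp add: nn_integral_sum nn_integral_add)
  also have "\<dots> = (\<Sum>s\<in>S. ennreal (\<mu> Y) + ennreal (\<mu> Y))"
  proof (rule sum.cong)
    fix s assume s: "s \<in> S"
    have "\<mu> (act s -` Y) = \<mu> Y"
      using inv[OF s, of "act s -` Y"] surj_image_vimage_eq[OF bij_is_surj[OF bij_act[OF s]], of Y] by simp
    then show "emeasure ?\<nu> (basic_clopen Y) + emeasure ?\<nu> (basic_clopen (act s -` Y)) = ennreal (\<mu> Y) + ennreal (\<mu> Y)"
      by (simp add: emeasure_beta_measure_basic_clopen[OF \<mu>])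
  qed simp
  also have "\<dots> = ennreal (2 * (card S * \<mu> Y))"
    using mean_nonneg[OF \<mu>, of Y]
    by (simp add: ennreal_of_nat_eq_real_of_nat flip: ennreal_plus ennreal_mult)
  finally have "edge_measure ?\<nu> ?D \<le> (1/2) * ennreal (2 * (card S * \<mu> Y))"
    unfolding edge_measure_def by (rule mult_left_mono) simp
  also have "\<dots> = ennreal (1/2) * ennreal (2 * (card S * \<mu> Y))"
    using divide_ennreal[of 1 2] by simp
  also have "\<dots> = ennreal (card S * \<mu> Y)"
    using mean_nonneg[OF \<mu>, of Y] by (subst ennreal_mult[symmetric]) auto
  finally show ?thesis .
qed

text \<open>A path from \<open>\<omega>\<close> is recorded as a composition \<open>g\<close> of
  generators. Every step leaves and enters \<open>basic_clopen C\<close> and moves the current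
  ultrafilter, so on a member of \<open>\<omega>\<close> the same steps trace a path of genuine
  edges inside \<open>C\<close>.\<close>

lemma cut_edges_component_generic:
  assumes w: "\<omega> \<in> betaX" and path: "(\<omega>, \<omega>') \<in> (cut_edges C)\<^sup>*"
  shows "\<exists>g. bij g \<and> \<omega>' = ext_map g \<omega> \<and> {x. g x \<in> induced_component E C x} \<in> \<omega>"
  using path
proof (induction rule: rtrancl_induct)
  case base
  have "{x. id x \<in> induced_component E C x} = UNIV" by (simp add: induced_component_def)
  with betaX_UNIV[OF w] have "{x. id x \<in> induced_component E C x} \<in> \<omega>" by (simp only:)
  then show ?case using ext_map_id[of \<omega>] bij_id by metis
next
  case (step \<omega>1 \<omega>2)
  from step.IH obtain g where g: "bij g" "\<omega>1 = ext_map g \<omega>" "{x. g x \<in> induced_component E C x} \<in> \<omega>"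
    by (elim exE conjE)
  from step.hyps(2) have C: "C \<in> \<omega>1" "C \<in> \<omega>2" and ne: "\<omega>1 \<noteq> \<omega>2" and "\<exists>s\<in>S. ext s \<omega>1 = \<omega>2"
    by (simp_all add: cut_edges_def graphing_edges_iff)
  then obtain s where s: "s \<in> S" "ext s \<omega>1 = \<omega>2" by (elim bexE)
  let ?h = "act s \<circ> g"
  have bs: "bij (act s)" by (rule bij_act[OF s(1)])
  have h: "bij ?h" using g(1) bs by (rule bij_comp)
  have w2: "\<omega>2 = ext_map ?h \<omega>" using s(2) g(2) by (simp add: ext_map_comp)
  have w1X: "\<omega>1 \<in> betaX" unfolding g(2) by (rule ext_map_in_betaX[OF g(1) w])
  have "{y. act s y = y} \<notin> \<omega>1"
    using ext_map_fixed_iff[OF bs w1X] ne s(2) by simp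
  then have "- {y. act s y = y} \<in> \<omega>1" by (simp add: betaX_Compl_iff[OF w1X])
  then have 1: "g -` (- {y. act s y = y}) \<in> \<omega>" unfolding g(2) by (simp only: mem_ext_map[OF g(1)])
  have 2: "g -` C \<in> \<omega>" using C(1) unfolding g(2) by (simp only: mem_ext_map[OF g(1)])
  have 3: "?h -` C \<in> \<omega>" using C(2) unfolding w2 by (simp only: mem_ext_map[OF h])
  have "{x. g x \<in> induced_component E C x} \<inter> (g -` (- {y. act s y = y}) \<inter> (g -` C \<inter> ?h -` C)) \<in> \<omega>"
    by (intro betaX_Int[OF w] 1 2 3 g(3))
  moreover have "{x. g x \<in> induced_component E C x} \<inter> (g -` (- {y. act s y = y}) \<inter> (g -` C \<inter> ?h -` C))
      \<subseteq> {x. ?h x \<in> induced_component E C x}"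
  proof
    fix x assume "x \<in> {x. g x \<in> induced_component E C x} \<inter> (g -` (- {y. act s y = y}) \<inter> (g -` C \<inter> ?h -` C))"
    then have x: "(x, g x) \<in> {(a, b). a \<in> C \<and> b \<in> C \<and> E a b}\<^sup>*" "g x \<in> C" "act s (g x) \<in> C" "act s (g x) \<noteq> g x"
      by (simp_all add: induced_component_def)
    have "E (g x) (act s (g x))" using x(4) s(1) by (auto simp: schreier_edge_def)
    then have "(g x, act s (g x)) \<in> {(a, b). a \<in> C \<and> b \<in> C \<and> E a b}" using x by simp
    with x(1) show "x \<in> {x. ?h x \<in> induced_component E C x}"
      by (simp add: induced_component_def rtrancl.rtrancl_into_rtrancl)
  qed
  ultimately have "{x. ?h x \<in> induced_component E C x} \<in> \<omega>" by (rule betaX_mono[OF w])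
  with h w2 show ?case by (intro exI[of _ ?h] conjI)
qed

text \<open>Finitely many distinct points of the component come from maps that differ pairwise on
  members of \<open>\<omega>\<close>. At a common generic \<open>x\<close> their values are distinct
  points of one component in \<open>C\<close>, so every finite subset of the component obeys the
  bound.\<close>

lemma cut_edges_component_card:
  assumes w: "\<omega> \<in> betaX" and "K > 0"
    and K: "\<And>x. x \<in> C \<Longrightarrow> finite (induced_component E C x) \<and> card (induced_component E C x) \<le> K"
  shows "finite {\<omega>'. (\<omega>, \<omega>') \<in> (cut_edges C)\<^sup>*} \<and> card {\<omega>'. (\<omega>, \<omega>') \<in> (cut_edges C)\<^sup>*} \<le> K"
proof (rule finite_if_finite_subsets_card_bdd)
  fix D assume D: "D \<subseteq> {\<omega>'. (\<omega>, \<omega>') \<in> (cut_edges C)\<^sup>*}" "finite D"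
  \<comment> \<open>The generic point is not known to lie in \<open>C\<close>; outside
    \<open>C\<close> the component is a singleton, which is why \<open>K > 0\<close> is
    assumed.\<close>
  have comp: "finite (induced_component E C x) \<and> card (induced_component E C x) \<le> K" for x
  proof (cases "x \<in> C")
    case False
    have "y = x" if "(x, y) \<in> {(a, b). a \<in> C \<and> b \<in> C \<and> E a b}\<^sup>*" for y
      using that by (induction rule: rtrancl_induct) (use False in auto)
    then have "induced_component E C x = {x}" by (auto simp: induced_component_def)
    then show ?thesis using \<open>K > 0\<close> by simp
  qed (rule K)
  have "\<exists>g. bij g \<and> d = ext_map g \<omega> \<and> {x. g x \<in> induced_component E C x} \<in> \<omega>" if "d \<in> D" for d
    using cut_edges_component_generic[OF w] subsetD[OF D(1) that] by simp
  then obtain g where g: "\<And>d. d \<in> D \<Longrightarrow> bij (g d)" "\<And>d. d \<in> D \<Longrightarrow> d = ext_map (g d) \<omega>"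
    "\<And>d. d \<in> D \<Longrightarrow> {x. g d x \<in> induced_component E C x} \<in> \<omega>" by metis
  define P where "P = {p \<in> D \<times> D. fst p \<noteq> snd p}"
  have "{x. g (fst p) x \<noteq> g (snd p) x} \<in> \<omega>" if "p \<in> P" for p
  proof -
    have p: "fst p \<in> D" "snd p \<in> D" "fst p \<noteq> snd p" using that by (auto simp: P_def)
    then have "ext_map (g (fst p)) \<omega> \<noteq> ext_map (g (snd p)) \<omega>" using g(2) by metis
    then have "{x. g (fst p) x = g (snd p) x} \<notin> \<omega>"
      using ext_map_cong_set[OF g(1)[OF p(1)] g(1)[OF p(2)] w] by (elim contrapos_nn)
    then show ?thesis using betaX_Compl_iff[OF w, of "{x. g (fst p) x = g (snd p) x}"] by (simp add: Compl_eq)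
  qed
  moreover have "finite P" unfolding P_def using D(2) by auto
  ultimately have "(\<Inter>p\<in>P. {x. g (fst p) x \<noteq> g (snd p) x}) \<in> \<omega>"
    by (intro betaX_INT[OF w])
  moreover have "(\<Inter>d\<in>D. {x. g d x \<in> induced_component E C x}) \<in> \<omega>"
    using D(2) g(3) by (intro betaX_INT[OF w])
  ultimately have "(\<Inter>p\<in>P. {x. g (fst p) x \<noteq> g (snd p) x}) \<inter> (\<Inter>d\<in>D. {x. g d x \<in> induced_component E C x}) \<in> \<omega>"
    by (rule betaX_Int[OF w])
  from betaX_nonempty_mem[OF w this] obtain x where
    x1: "\<And>p. p \<in> P \<Longrightarrow> g (fst p) x \<noteq> g (snd p) x" and x2: "\<And>d. d \<in> D \<Longrightarrow> g d x \<in> induced_component E C x"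
    by auto
  have "inj_on (\<lambda>d. g d x) D"
  proof (rule inj_onI, rule ccontr)
    fix d d' assume "d \<in> D" "d' \<in> D" "g d x = g d' x" "d \<noteq> d'"
    then show False using x1[of "(d, d')"] by (simp add: P_def)
  qed
  then have "card D \<le> card (induced_component E C x)"
    using x2 comp[of x] by (intro card_inj_on_le) auto
  then show "card D \<le> K" using comp[of x] by linarith
qed

proposition hyperfinite_of_mean:
  assumes hm: "hyperfinite_mean \<mu>"
  shows "ext_hyperfinite act S (beta_measure \<mu>)"
  unfolding ext_hyperfinite_def
proof (intro allI impI)
  note \<mu> = hyperfinite_meanD(1)[OF hm] and inv = hyperfinite_meanD(2)[OF hm]
    and hyp = hyperfinite_meanD(3)[OF hm]
  fix \<epsilon> :: real assume \<epsilon>: "\<epsilon> > 0"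
  \<comment> \<open>The added 1 keeps the denominator positive even when \<open>S\<close> is
    empty.\<close>
  then have "\<epsilon> / (card S + 1) > 0" by simp
  from hyp[OF this] obtain Y K where Y: "\<mu> Y < \<epsilon> / (card S + 1)" and K0: "K > (0::nat)"
    and all: "\<forall>x\<in>- Y. finite (induced_component E (- Y) x) \<and> card (induced_component E (- Y) x) \<le> K"
    by (elim exE conjE)
  have K: "finite (induced_component E (- Y) x) \<and> card (induced_component E (- Y) x) \<le> K" if "x \<in> - Y" for x
    using all that by (rule bspec)
  have "card S * \<mu> Y \<le> (card S + 1) * \<mu> Y"
    using mean_nonneg[OF \<mu>, of Y] by (intro mult_right_mono) auto
  also have "\<dots> < \<epsilon>" using Y by (simp add: pos_less_divide_eq mult.commute)
  finally have "ennreal (card S * \<mu> Y) < ennreal \<epsilon>" using \<epsilon> by (rule ennreal_lessI[rotated])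
  moreover have "edge_measure (beta_measure \<mu>) (graphing_edges act S - cut_edges (- Y)) \<le> ennreal (card S * \<mu> Y)"
    using \<mu> inv by (rule cut_edges_measure)
  ultimately have "edge_measure (beta_measure \<mu>) (graphing_edges act S - cut_edges (- Y)) < ennreal \<epsilon>"
    by (rule le_less_trans[rotated])
  moreover have "cut_edges (- Y) \<subseteq> graphing_edges act S" by (auto simp: cut_edges_def)
  ultimately show "\<exists>K W. W \<subseteq> graphing_edges act S \<and> sym W \<and>
      W \<in> borel_sets (prod_topology beta_topology beta_topology) \<and>
      edge_measure (beta_measure \<mu>) (graphing_edges act S - W) < ennreal \<epsilon> \<and>
      (\<forall>\<omega>\<in>betaX. finite {\<omega>'. (\<omega>, \<omega>') \<in> W\<^sup>*} \<and> card {\<omega>'. (\<omega>, \<omega>') \<in> W\<^sup>*} \<le> K)"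
    using sym_cut_edges cut_edges_borel cut_edges_component_card[OF _ K0 K] by blast
qed

end

section \<open>From hyperfinite measures to means\<close>

text \<open>The ball of radius k around \<open>x\<close> in the subgraph on \<open>A\<close>, for
  \<open>x\<close> in \<open>A\<close>. The action is a parameter because balls in X are compared
  with balls in \<open>betaX\<close>.\<close>

fun reach :: "('g \<Rightarrow> 'a \<Rightarrow> 'a) \<Rightarrow> 'g set \<Rightarrow> 'a set \<Rightarrow> nat \<Rightarrow> 'a \<Rightarrow> 'a set" where
  "reach act S A 0 x = {x}"
| "reach act S A (Suc k) x = reach act S A k x \<union> {y \<in> A. \<exists>s\<in>S. \<exists>z\<in>reach act S A k x. y = act s z}"

fun words :: "('g \<Rightarrow> 'a \<Rightarrow> 'a) \<Rightarrow> 'g set \<Rightarrow> nat \<Rightarrow> ('a \<Rightarrow> 'a) set" where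
  "words act S 0 = {id}"
| "words act S (Suc k) = words act S k \<union> (\<lambda>(s, g). act s \<circ> g) ` (S \<times> words act S k)"

lemma reach_subset: "x \<in> A \<Longrightarrow> reach act S A k x \<subseteq> A"
  by (induction k) auto

lemma self_in_reach: "x \<in> reach act S A k x"
  by (induction k) auto

lemma finite_words: "finite S \<Longrightarrow> finite (words act S k)"
  by (induction k) auto

lemma finite_reach:
  assumes "finite S"
  shows "finite (reach act S A k x)"
proof (induction k)
  case (Suc k)
  have "{y \<in> A. \<exists>s\<in>S. \<exists>z\<in>reach act S A k x. y = act s z} \<subseteq> (\<lambda>(s, z). act s z) ` (S \<times> reach act S A k x)"
    by auto
  then have "finite {y \<in> A. \<exists>s\<in>S. \<exists>z\<in>reach act S A k x. y = act s z}"
    by (rule finite_subset) (use assms Suc in simp)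
  then show ?case using Suc by simp
qed simp

context symmetric_generators begin

lemma bij_words: "g \<in> words act S k \<Longrightarrow> bij g"
  by (induction k arbitrary: g) (auto intro: bij_comp bij_act)

text \<open>A ball gains at least one point per step until it stabilises, and then it contains the
  whole component. Hence a ball of radius \<open>K\<close> with at most \<open>K\<close> points
  already contains the component.\<close>

lemma card_reach:
  assumes "x \<in> A"
  shows "Suc k \<le> card (reach act S A k x) \<or> induced_component E A x \<subseteq> reach act S A k x"
proof (induction k)
  case (Suc k)
  let ?R = "reach act S A k x" and ?R' = "reach act S A (Suc k) x"
  have sub: "?R \<subseteq> ?R'" by auto
  show ?case
  proof (cases "?R' = ?R")
    case True
    have "y \<in> ?R" if "(x, y) \<in> {(a, b). a \<in> A \<and> b \<in> A \<and> E a b}\<^sup>*" for y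
      using that
    proof (induction rule: rtrancl_induct)
      case base show ?case by (rule self_in_reach)
    next
      case (step y z)
      then have "z \<in> A" "\<exists>s\<in>S. z = act s y" by (auto simp: schreier_edge_def)
      with step.IH have "z \<in> ?R'" by auto
      then show ?case using True by blast
    qed
    then have "induced_component E A x \<subseteq> ?R'" unfolding True by (auto simp: induced_component_def)
    then show ?thesis by blast
  next
    case False
    then have "?R \<subset> ?R'" using sub by blast
    then have "card ?R < card ?R'" by (rule psubset_card_mono[OF finite_reach[OF finite_S]])
    then show ?thesis using Suc sub by fastforce
  qed
qed (simp)

text \<open>At a point \<open>x\<close> that is generic for \<open>\<omega>\<close>, the ball around \<open>x\<close> embeds into the ball around \<open>\<omega>\<close>.\<close>

lemma card_reach_transfer:
  assumes w: "\<omega> \<in> betaX"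
    and inj: "\<And>g h. g \<in> words act S k \<Longrightarrow> h \<in> words act S k \<Longrightarrow> g x \<noteq> h x \<Longrightarrow> ext_map g \<omega> \<noteq> ext_map h \<omega>"
    and mem: "\<And>g. g \<in> words act S k \<Longrightarrow> g x \<in> A \<Longrightarrow> ext_map g \<omega> \<in> C"
  shows "card (reach act S A k x) \<le> card (reach ext S C k \<omega>)"
proof -
  \<comment> \<open>One word traces a path from \<open>x\<close> in \<open>A\<close> and, by
    \<open>mem\<close>, a path from \<open>\<omega>\<close> in \<open>C\<close>. Then
    \<open>inj\<close> keeps distinct endpoints in X distinct in \<open>betaX\<close>.\<close>
  have ex: "\<exists>g\<in>words act S j. y = g x \<and> ext_map g \<omega> \<in> reach ext S C j \<omega>"
    if "y \<in> reach act S A j x" "j \<le> k" for y j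
    using that
  proof (induction j arbitrary: y)
    case 0 then show ?case by (simp add: ext_map_id[unfolded id_def])
  next
    case (Suc j)
    have words_mono: "words act S j \<subseteq> words act S i" if "j \<le> i" for i j
      using that by (induction rule: dec_induct) auto
    show ?case
    proof (cases "y \<in> reach act S A j x")
      case True
      then obtain g where "g \<in> words act S j" "y = g x" "ext_map g \<omega> \<in> reach ext S C j \<omega>"
        using Suc by auto
      then show ?thesis by (intro bexI[of _ g]) auto
    next
      case False
      then obtain s z where s: "s \<in> S" "z \<in> reach act S A j x" "y = act s z" "y \<in> A"
        using Suc.prems(1) by auto
      obtain g where g: "g \<in> words act S j" "z = g x" "ext_map g \<omega> \<in> reach ext S C j \<omega>"
        using Suc.IH[OF s(2)] Suc.prems(2) by auto
      have h: "act s \<circ> g \<in> words act S (Suc j)" using s(1) g(1) by force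
      then have "act s \<circ> g \<in> words act S k" using words_mono[OF Suc.prems(2)] by blast
      moreover have "(act s \<circ> g) x \<in> A" using s(3,4) g(2) by simp
      ultimately have "ext_map (act s \<circ> g) \<omega> \<in> C" by (rule mem)
      then have "ext s (ext_map g \<omega>) \<in> C" by (simp add: ext_map_comp)
      then have "ext s (ext_map g \<omega>) \<in> reach ext S C (Suc j) \<omega>" using s(1) g(3) by auto
      then have "ext_map (act s \<circ> g) \<omega> \<in> reach ext S C (Suc j) \<omega>" by (simp only: ext_map_comp)
      moreover have "y = (act s \<circ> g) x" using s(3) g(2) by simp
      ultimately show ?thesis using h by blast
    qed
  qed
  have "\<forall>y\<in>reach act S A k x. \<exists>g. g \<in> words act S k \<and> y = g x \<and> ext_map g \<omega> \<in> reach ext S C k \<omega>"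
    using ex by blast
  then obtain g where g: "\<And>y. y \<in> reach act S A k x \<Longrightarrow> g y \<in> words act S k"
    "\<And>y. y \<in> reach act S A k x \<Longrightarrow> y = g y x"
    "\<And>y. y \<in> reach act S A k x \<Longrightarrow> ext_map (g y) \<omega> \<in> reach ext S C k \<omega>" by metis
  have "inj_on (\<lambda>y. ext_map (g y) \<omega>) (reach act S A k x)"
  proof (rule inj_onI, rule ccontr)
    fix y z assume yz: "y \<in> reach act S A k x" "z \<in> reach act S A k x"
      "ext_map (g y) \<omega> = ext_map (g z) \<omega>" "y \<noteq> z"
    then have "g y x \<noteq> g z x" using g(2) by metis
    then show False using inj[OF g(1)[OF yz(1)] g(1)[OF yz(2)]] yz(3) by simp
  qed
  then show ?thesis
    using g(3) finite_reach[OF finite_S] by (intro card_inj_on_le) auto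
qed

text \<open>Compactness: if every clopen neighbourhood of a closed set \<open>C\<close> had large components, an
  ultrafilter of points in large components would lie in a large component of \<open>C\<close>.\<close>

lemma clopen_neighbourhood_small_components:
  assumes Q: "openin beta_topology Q"
    and small: "\<And>\<omega>. \<omega> \<in> betaX - Q \<Longrightarrow> card (reach ext S (betaX - Q) K \<omega>) \<le> K"
  shows "\<exists>A. betaX - Q \<subseteq> basic_clopen A \<and>
    (\<forall>x\<in>A. finite (induced_component E A x) \<and> card (induced_component E A x) \<le> K)"
proof (rule ccontr)
  assume neg: "\<not> ?thesis"
  define \<A> where "\<A> = {A. betaX - Q \<subseteq> basic_clopen A}"
  define big where "big A = {x\<in>A. \<not> (finite (induced_component E A x) \<and> card (induced_component E A x) \<le> K)}" for A
  have big_ne: "big A \<noteq> {}" if "A \<in> \<A>" for A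
    using neg that unfolding \<A>_def big_def by blast
  have big_mono: "big A \<subseteq> big B" if "A \<subseteq> B" for A B
  proof
    fix x assume x: "x \<in> big A"
    have sub: "induced_component E A x \<subseteq> induced_component E B x" by (rule induced_component_mono[OF that])
    show "x \<in> big B"
      using x that finite_subset[OF sub] card_mono[OF _ sub] unfolding big_def by force
  qed
  \<comment> \<open>As \<open>big\<close> is monotone, closure of \<open>\<A>\<close> under finite
    intersections gives its values the finite intersection property.\<close>
  have Inter: "\<Inter>F \<in> \<A>" if F: "finite F" "F \<subseteq> \<A>" for F
    unfolding \<A>_def
  proof (rule CollectI, rule subsetI)
    fix \<omega> assume w: "\<omega> \<in> betaX - Q"
    then have wX: "\<omega> \<in> betaX" by simp
    have "B \<in> \<omega>" if "B \<in> F" for B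
    proof -
      have "betaX - Q \<subseteq> basic_clopen B" using subsetD[OF F(2) that] by (simp add: \<A>_def)
      from subsetD[OF this w] show ?thesis by (simp add: mem_basic_clopen)
    qed
    then have "(\<Inter>B\<in>F. B) \<in> \<omega>" by (intro betaX_INT[OF wX F(1)])
    then show "\<omega> \<in> basic_clopen (\<Inter>F)" using wX by (simp add: mem_basic_clopen)
  qed
  have "\<exists>\<omega>\<in>betaX. big ` \<A> \<subseteq> \<omega>"
  proof (rule ultrafilter_extends)
    fix F assume "finite F" "F \<subseteq> big ` \<A>"
    then obtain B where B: "B \<subseteq> \<A>" "finite B" "F = big ` B" using finite_subset_image[of F big \<A>] by auto
    have "big (\<Inter>B) \<subseteq> \<Inter>F"
      unfolding B(3) by (intro INT_greatest big_mono Inter_lower)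
    then show "\<Inter>F \<noteq> {}" using big_ne[OF Inter[OF B(2,1)]] by auto
  qed
  then obtain \<omega> where w: "\<omega> \<in> betaX" and bw: "big ` \<A> \<subseteq> \<omega>" by (elim bexE)
  \<comment> \<open>The closed set is the intersection of its clopen neighbourhoods.\<close>
  have escape: "\<exists>A\<in>\<A>. A \<notin> \<omega>'" if w': "\<omega>' \<in> betaX" "\<omega>' \<in> Q" for \<omega>'
  proof -
    obtain B where B: "B \<in> \<omega>'" "basic_clopen B \<subseteq> Q" using openin_beta_nbhd[OF Q w'(2)] by (elim bexE)
    have "- B \<in> \<A>" using B(2) by (auto simp: \<A>_def basic_clopen_Compl)
    moreover have "- B \<notin> \<omega>'" using B(1) betaX_Compl_iff[OF w'(1)] by simp
    ultimately show ?thesis by (rule bexI[rotated])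
  qed
  have in_big: "big A \<in> \<omega>" if "A \<in> \<A>" for A using subsetD[OF bw imageI[OF that]] .
  have A_in: "A \<in> \<omega>" if "A \<in> \<A>" for A
    using in_big[OF that] by (rule betaX_mono[OF w]) (auto simp: big_def)
  have wQ: "\<omega> \<in> betaX - Q" using escape[OF w] A_in w by auto
  let ?W = "words act S K"
  have fW: "finite ?W" by (rule finite_words[OF finite_S])
  let ?WQ = "{g\<in>?W. ext_map g \<omega> \<in> Q}"
  have gX: "ext_map g \<omega> \<in> betaX" if "g \<in> ?W" for g by (rule ext_map_in_betaX[OF bij_words[OF that] w])
  have "\<exists>A. A \<in> \<A> \<and> A \<notin> ext_map g \<omega>" if "g \<in> ?WQ" for g
    using escape[OF gX, of g] that by auto
  then obtain B where B: "\<And>g. g \<in> ?WQ \<Longrightarrow> B g \<in> \<A> \<and> B g \<notin> ext_map g \<omega>" by metis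
  \<comment> \<open>Only finitely many words have length at most \<open>K\<close>, so one clopen
    neighbourhood excludes all the points of \<open>Q\<close> that they reach from
    \<open>\<omega>\<close>.\<close>
  define A where "A = \<Inter>(B ` ?WQ)"
  have "A \<in> \<A>" unfolding A_def using fW B by (intro Inter) auto
  have sep: "A \<notin> ext_map g \<omega>" if "g \<in> ?W" "ext_map g \<omega> \<in> Q" for g
  proof
    assume "A \<in> ext_map g \<omega>"
    then have "B g \<in> ext_map g \<omega>"
      using that by (elim betaX_mono[OF gX[OF that(1)]]) (auto simp: A_def)
    then show False using B[of g] that by simp
  qed
  \<comment> \<open>Words that coincide at \<open>\<omega>\<close> must coincide at the generic
    point, or the ball around it could be larger than the ball around \<open>\<omega>\<close>. This
    is where clopenness of fixed points enters.\<close>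
  define P where "P = {p \<in> ?W \<times> ?W. ext_map (fst p) \<omega> = ext_map (snd p) \<omega>}"
  have "(\<Inter>p\<in>P. {x. fst p x = snd p x}) \<in> \<omega>"
  proof (rule betaX_INT[OF w])
    show "finite P" unfolding P_def using fW by auto
    fix p assume "p \<in> P"
    then have p: "fst p \<in> ?W" "snd p \<in> ?W" "ext_map (fst p) \<omega> = ext_map (snd p) \<omega>" by (auto simp: P_def)
    then show "{x. fst p x = snd p x} \<in> \<omega>"
      using ext_map_eq_iff[OF bij_words[OF p(1)] bij_words[OF p(2)] w] by simp
  qed
  moreover have "(\<Inter>g\<in>?WQ. - (g -` A)) \<in> \<omega>"
  proof (rule betaX_INT[OF w])
    show "finite ?WQ" using fW by simp
    fix g assume g: "g \<in> ?WQ"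
    then have "g -` A \<notin> \<omega>" using sep[of g] mem_ext_map[OF bij_words[of g K], of A \<omega>] by simp
    then show "- (g -` A) \<in> \<omega>" by (simp add: betaX_Compl_iff[OF w])
  qed
  ultimately have "(\<Inter>p\<in>P. {x. fst p x = snd p x}) \<inter> (\<Inter>g\<in>?WQ. - (g -` A)) \<in> \<omega>" by (rule betaX_Int[OF w])
  then have "big A \<inter> ((\<Inter>p\<in>P. {x. fst p x = snd p x}) \<inter> (\<Inter>g\<in>?WQ. - (g -` A))) \<in> \<omega>"
    by (rule betaX_Int[OF w in_big[OF \<open>A \<in> \<A>\<close>]])
  from betaX_nonempty_mem[OF w this] obtain x where
    x: "x \<in> big A" "\<And>p. p \<in> P \<Longrightarrow> fst p x = snd p x" "\<And>g. g \<in> ?WQ \<Longrightarrow> g x \<notin> A" by auto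
  have "card (reach act S A K x) \<le> card (reach ext S (betaX - Q) K \<omega>)"
  proof (rule card_reach_transfer[OF w])
    fix g h assume gh: "g \<in> ?W" "h \<in> ?W" "g x \<noteq> h x"
    then show "ext_map g \<omega> \<noteq> ext_map h \<omega>" using x(2)[of "(g, h)"] by (auto simp: P_def)
  next
    fix g assume g: "g \<in> ?W" "g x \<in> A"
    then show "ext_map g \<omega> \<in> betaX - Q" using x(3)[of g] gX[OF g(1)] by auto
  qed
  also have "\<dots> \<le> K" by (rule small[OF wQ])
  finally have le: "card (reach act S A K x) \<le> K" .
  have "x \<in> A" using x(1) by (simp add: big_def)
  then have sub: "induced_component E A x \<subseteq> reach act S A K x" using card_reach[of x A K] le by auto
  then have "finite (induced_component E A x)" by (rule finite_subset[OF _ finite_reach[OF finite_S]])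
  moreover have "card (induced_component E A x) \<le> K"
    using card_mono[OF finite_reach[OF finite_S] sub] le by linarith
  ultimately show False using x(1) by (simp add: big_def)
qed

proposition mean_of_hyperfinite:
  assumes \<nu>: "beta_borel_prob \<nu>"
    and inv: "\<forall>s\<in>S. \<forall>A\<in>sets \<nu>. emeasure \<nu> (ext s ` A) = emeasure \<nu> A"
    and hyp: "ext_hyperfinite act S \<nu>"
  shows "\<exists>\<mu>. hyperfinite_mean \<mu>"
proof -
  interpret prob_space \<nu> using \<nu> by (simp add: beta_borel_prob_def)
  have sp: "space \<nu> = betaX" and se: "sets \<nu> = borel_sets beta_topology"
    and reg: "regular_measure beta_topology \<nu>"
    using \<nu> by (simp_all add: beta_borel_prob_def)
  have bc: "basic_clopen A \<in> sets \<nu>" for A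
    unfolding se by (rule openin_imp_borel_sets[OF openin_basic_clopen])
  define \<mu> where "\<mu> A = measure \<nu> (basic_clopen A)" for A
  have "mean \<mu>"
    unfolding mean_def
  proof (intro conjI allI impI)
    fix A B :: "'x set"
    show "0 \<le> \<mu> A" "\<mu> A \<le> 1" by (simp_all add: \<mu>_def)
    show "\<mu> UNIV = 1" using prob_space by (simp add: \<mu>_def basic_clopen_UNIV sp)
    assume "A \<inter> B = {}"
    then have "basic_clopen A \<inter> basic_clopen B = {}"
      by (simp add: basic_clopen_empty flip: basic_clopen_Int)
    then show "\<mu> (A \<union> B) = \<mu> A + \<mu> B"
      unfolding \<mu>_def basic_clopen_Un by (intro finite_measure_Union bc)
  qed
  moreover have "\<mu> (act s ` A) = \<mu> A" if "s \<in> S" for s A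
    using inv[rule_format, OF that bc[of A]] unfolding \<mu>_def measure_def
    by (simp add: ext_map_image_basic_clopen[OF bij_act[OF that]])
  moreover have "\<exists>Y K. \<mu> Y < \<epsilon> \<and> K > (0::nat) \<and>
      (\<forall>x\<in>- Y. finite (induced_component E (- Y) x) \<and> card (induced_component E (- Y) x) \<le> K)"
    if \<epsilon>: "\<epsilon> > 0" for \<epsilon>
  proof -
    from \<epsilon> have "\<epsilon> / 2 > 0" by simp
    from hyp[unfolded ext_hyperfinite_def, rule_format, OF this] obtain K W where
      W: "W \<in> borel_sets (prod_topology beta_topology beta_topology)"
      and me: "edge_measure \<nu> (graphing_edges act S - W) < ennreal (\<epsilon> / 2)"
      and comp: "\<forall>\<omega>\<in>betaX. finite {\<omega>'. (\<omega>, \<omega>') \<in> W\<^sup>*} \<and> card {\<omega>'. (\<omega>, \<omega>') \<in> W\<^sup>*} \<le> K"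
      by (elim exE conjE)
    \<comment> \<open>The points from which some generator moves along an edge missing from
      \<open>W\<close>. Clopenness of fixed points makes the set of moved points measurable.\<close>
    define B where "B = (\<Union>s\<in>S. basic_clopen {x. act s x \<noteq> x} - {\<omega> \<in> betaX. (\<omega>, ext s \<omega>) \<in> W})"
    have Bs: "B \<in> sets \<nu>"
      unfolding B_def
    proof (intro sets.finite_UN finite_S sets.Diff bc)
      fix s assume "s \<in> S"
      have "continuous_map beta_topology (prod_topology beta_topology beta_topology) (\<lambda>\<omega>. (\<omega>, ext s \<omega>))"
        using continuous_map_ext_map[OF bij_act[OF \<open>s \<in> S\<close>]]
        by (intro continuous_map_pairedI continuous_map_id[unfolded id_def])
      from borel_sets_preimage[OF this W]
      show "{\<omega> \<in> betaX. (\<omega>, ext s \<omega>) \<in> W} \<in> sets \<nu>" by (simp add: se topspace_beta)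
    qed
    have moved: "\<omega> \<in> basic_clopen {x. act s x \<noteq> x} \<longleftrightarrow> ext s \<omega> \<noteq> \<omega>" if "\<omega> \<in> betaX" "s \<in> S" for \<omega> s
      using ext_map_fixed_iff[OF bij_act[OF that(2)] that(1)] betaX_Compl_iff[OF that(1), of "{x. act s x = x}"] that(1)
      by (simp add: mem_basic_clopen Compl_eq)
    let ?D = "graphing_edges act S - W"
    \<comment> \<open>Every point of \<open>B\<close> has degree at least 1 among the missing edges,
      so \<open>B\<close> has at most twice their edge measure; hence the choice of
      \<open>\<epsilon> / 2\<close>.\<close>
    have "emeasure \<nu> B \<le> (\<integral>\<^sup>+ \<omega>. ennreal (real (degree_in ?D \<omega>)) \<partial>\<nu>)"
      unfolding nn_integral_indicator[OF Bs, symmetric]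
    proof (rule nn_integral_mono)
      fix \<omega> assume "\<omega> \<in> space \<nu>"
      then have w: "\<omega> \<in> betaX" by (simp add: sp)
      show "indicator B \<omega> \<le> ennreal (real (degree_in ?D \<omega>))"
      proof (cases "\<omega> \<in> B")
        case True
        then obtain s where s: "s \<in> S" "\<omega> \<in> basic_clopen {x. act s x \<noteq> x}" "(\<omega>, ext s \<omega>) \<notin> W"
          using w by (auto simp: B_def)
        then have "(\<omega>, ext s \<omega>) \<in> graphing_edges act S"
          using moved[OF w s(1)] w by (auto simp: graphing_edges_iff)
        then have "ext s \<omega> \<in> {\<omega>'. (\<omega>, \<omega>') \<in> ?D}" using s(3) by simp
        moreover have "{\<omega>'. (\<omega>, \<omega>') \<in> ?D} \<subseteq> (\<lambda>s. ext s \<omega>) ` S"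
          by (auto simp: graphing_edges_iff)
        then have "finite {\<omega>'. (\<omega>, \<omega>') \<in> ?D}" by (rule finite_subset) (simp add: finite_S)
        ultimately have "0 < degree_in ?D \<omega>"
          unfolding degree_in_def card_gt_0_iff by auto
        then have "1 \<le> real (degree_in ?D \<omega>)" by linarith
        then show ?thesis using True by simp
      qed simp
    qed
    also have "\<dots> = 2 * edge_measure \<nu> ?D"
    proof -
      have "2 * (1/2 :: ennreal) = 1"
        using divide_ennreal[of 1 2] ennreal_mult[of 2 "1/2"] by simp
      then show ?thesis unfolding edge_measure_def by (simp only: mult.assoc[symmetric] mult_1)
    qed
    also have "\<dots> < 2 * ennreal (\<epsilon> / 2)"
      using me by (intro ennreal_mult_strict_left_mono) auto
    also have "\<dots> = ennreal \<epsilon>"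
      using \<epsilon> ennreal_mult[of 2 "\<epsilon> / 2"] by simp
    finally have "emeasure \<nu> B < ennreal \<epsilon>" .
    \<comment> \<open>Outer regularity passes from the Borel set \<open>B\<close> to an open one, so
      that the remaining set is closed and compactness applies.\<close>
    then obtain Q where Q: "openin beta_topology Q" "B \<subseteq> Q" "emeasure \<nu> Q < ennreal \<epsilon>"
      using reg Bs unfolding regular_measure_def INF_less_iff[symmetric]
      by (metis (mono_tags, lifting) INF_less_iff mem_Collect_eq)
    have card_K: "card (reach ext S (betaX - Q) K \<omega>) \<le> K" if w: "\<omega> \<in> betaX - Q" for \<omega>
    proof -
      \<comment> \<open>Outside \<open>Q\<close> each generator either fixes the point or moves it
        along an edge of \<open>W\<close>, so balls stay inside components of
        \<open>W\<close>.\<close>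
      have "reach ext S (betaX - Q) k \<omega> \<subseteq> {\<omega>'. (\<omega>, \<omega>') \<in> W\<^sup>*}" for k
      proof (induction k)
        case (Suc k)
        have "(\<omega>, \<omega>2) \<in> W\<^sup>*" if "\<omega>2 \<in> betaX - Q" "s \<in> S" "\<omega>1 \<in> reach ext S (betaX - Q) k \<omega>" "\<omega>2 = ext s \<omega>1" for \<omega>1 \<omega>2 s
        proof -
          have w1: "\<omega>1 \<in> betaX" "\<omega>1 \<notin> Q" using reach_subset[OF w, of ext S k] that(3) by auto
          have 1: "(\<omega>, \<omega>1) \<in> W\<^sup>*" using Suc that(3) by auto
          have "\<omega>1 \<notin> B" using w1(2) Q(2) by auto
          then have "ext s \<omega>1 = \<omega>1 \<or> (\<omega>1, ext s \<omega>1) \<in> W"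
            using moved[OF w1(1) that(2)] w1(1) that(2) by (auto simp: B_def)
          then show ?thesis using 1 that(4) by (auto intro: rtrancl.rtrancl_into_rtrancl)
        qed
        then show ?case using Suc by auto
      qed simp
      moreover have "finite {\<omega>'. (\<omega>, \<omega>') \<in> W\<^sup>*} \<and> card {\<omega>'. (\<omega>, \<omega>') \<in> W\<^sup>*} \<le> K"
        using comp w by blast
      ultimately show ?thesis using card_mono order_trans by metis
    qed
    have "\<exists>A. betaX - Q \<subseteq> basic_clopen A \<and>
        (\<forall>x\<in>A. finite (induced_component E A x) \<and> card (induced_component E A x) \<le> K)"
      by (rule clopen_neighbourhood_small_components[OF Q(1)]) (rule card_K)
    then obtain A where A: "betaX - Q \<subseteq> basic_clopen A"
      and small: "\<forall>x\<in>A. finite (induced_component E A x) \<and> card (induced_component E A x) \<le> K"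
      by (elim exE conjE)
    have "basic_clopen (- A) \<subseteq> Q" using A unfolding basic_clopen_Compl by auto
    then have "emeasure \<nu> (basic_clopen (- A)) \<le> emeasure \<nu> Q"
      using Q(1) by (intro emeasure_mono) (simp_all add: se openin_imp_borel_sets)
    then have "ennreal (\<mu> (- A)) < ennreal \<epsilon>"
      using Q(3) unfolding \<mu>_def emeasure_eq_measure by (rule le_less_trans)
    then have "\<mu> (- A) < \<epsilon>" using \<epsilon> by (simp add: ennreal_less_iff \<mu>_def)
    \<comment> \<open>\<open>Suc K\<close> makes the positivity of the bound immediate.\<close>
    then show ?thesis using small by (intro exI[of _ "- A"] exI[of _ "Suc K"]) auto
  qed
  ultimately show ?thesis unfolding hyperfinite_mean_def by blast
qed

end

section \<open>Group actions\<close>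

lemma group_action_inverse:
  fixes G (structure)
  assumes "group G" "group_action G UNIV phi" "g \<in> carrier G"
  shows "phi (inv g) (phi g x) = x" "phi g (phi (inv g) x) = x"
proof -
  interpret group G by fact
  interpret group_action G UNIV phi by fact
  have one: "phi \<one> x = x" using id_eq_one by (metis UNIV_I restrict_apply')
  show "phi (inv g) (phi g x) = x"
    using composition_rule[of x "inv g" g] assms(3) one by simp
  show "phi g (phi (inv g) x) = x"
    using composition_rule[of x g "inv g"] assms(3) one by simp
qed

lemma invariant_on_generated:
  fixes G (structure)
  assumes G: "group G" "group_action G UNIV phi" and S: "S \<subseteq> carrier G" "generate G S = carrier G"
    and inv: "\<And>s A. s \<in> S \<Longrightarrow> \<mu> (phi s ` A) = \<mu> A" and g: "g \<in> carrier G"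
  shows "\<mu> (phi g ` A) = \<mu> A"
proof -
  interpret group G by fact
  interpret group_action G UNIV phi by fact
  have "g \<in> generate G S" using g S(2) by simp
  then show ?thesis
  proof (induction arbitrary: A rule: generate.induct)
    case one
    have "phi \<one> = (\<lambda>x. x)" using id_eq_one by (simp add: fun_eq_iff restrict_def)
    then show ?case by simp
  next
    case (incl h) then show ?case by (rule inv)
  next
    case (inv h)
    have "phi h ` phi (inv h) ` A = A"
      using group_action_inverse(2)[OF G, of h] inv S(1) by (auto simp: image_image)
    then show ?case using assms(5)[OF inv, of "phi (inv h) ` A"] by simp
  next
    case (eng h1 h2)
    have "h1 \<in> carrier G" "h2 \<in> carrier G" using eng.hyps S(2) by auto
    then have "phi (h1 \<otimes> h2) ` A = phi h1 ` phi h2 ` A"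
      using composition_rule by (simp add: image_image)
    then show ?case using eng.IH by simp
  qed
qed

theorem theoremA:
  fixes G :: "('g, 'b) monoid_scheme" (structure)
    and S :: "'g set"
    and phi :: "'g \<Rightarrow> 'x \<Rightarrow> 'x"
  assumes "group G"
    and "S \<subseteq> carrier G" and "finite S" and "\<forall>s\<in>S. inv s \<in> S"
    and "generate G S = carrier G"
    and "group_action G (UNIV :: 'x set) phi"
    and "countable (UNIV :: 'x set)" and "infinite (UNIV :: 'x set)"
  shows "((\<exists>\<nu>. beta_borel_prob \<nu> \<and> ext_invariant G phi \<nu> \<and> ext_hyperfinite phi S \<nu>)
          \<longleftrightarrow> (\<exists>F. folner_sequence (schreier_edge phi S) F \<and>
                    hyperfinite_graph_seq (schreier_edge phi S) F))
       \<and> ((\<exists>F. folner_sequence (schreier_edge phi S) F \<and>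
                    hyperfinite_graph_seq (schreier_edge phi S) F)
          \<longleftrightarrow> (\<exists>\<mu>. invariant_mean G phi \<mu> \<and>
                 (\<forall>\<epsilon>>0. \<exists>Y K. \<mu> Y < \<epsilon> \<and> K > (0::nat) \<and>
                    (\<forall>x \<in> - Y. finite (induced_component (schreier_edge phi S) (- Y) x) \<and>
                               card (induced_component (schreier_edge phi S) (- Y) x) \<le> K))))"
    (is "(?one \<longleftrightarrow> ?two) \<and> (?two \<longleftrightarrow> ?three)")
proof -
  interpret group G by fact
  interpret group_action G UNIV phi by fact
  have bij: "bij (phi g)" if "g \<in> carrier G" for g
    using inj_prop[OF that] surj_prop[OF that] by (simp add: bij_def)
  interpret symmetric_generators phi S
  proof
    show "finite S" by fact
    fix s assume s: "s \<in> S"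
    then have sG: "s \<in> carrier G" using assms(2) by auto
    then show "bij (phi s)" by (rule bij)
    show "\<exists>t\<in>S. \<forall>x. phi t (phi s x) = x"
      using assms(4) s group_action_inverse(1)[OF assms(1,6) sG] by (intro bexI[of _ "inv s"]) auto
  qed
  have generators: "invariant_mean G phi \<mu> \<longleftrightarrow> mean \<mu> \<and> (\<forall>s\<in>S. \<forall>A. \<mu> (phi s ` A) = \<mu> A)" for \<mu>
  proof
    assume \<mu>: "mean \<mu> \<and> (\<forall>s\<in>S. \<forall>A. \<mu> (phi s ` A) = \<mu> A)"
    have "\<mu> (phi g ` A) = \<mu> A" if "g \<in> carrier G" for g A
      by (rule invariant_on_generated[OF assms(1,6,2,5) _ that]) (use \<mu> in simp)
    then show "invariant_mean G phi \<mu>" using \<mu> by (simp add: invariant_mean_def)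
  qed (use assms(2) in \<open>auto simp: invariant_mean_def\<close>)
  have three: "?three \<longleftrightarrow> (\<exists>\<mu>. hyperfinite_mean \<mu>)"
    unfolding generators hyperfinite_mean_def conj_assoc ..
  have "?three \<longleftrightarrow> ?two"
    unfolding three
  proof
    assume "\<exists>\<mu>. hyperfinite_mean \<mu>"
    then show ?two using folner_of_mean[OF _ assms(7,8)] by (elim exE)
  next
    assume ?two
    then show "\<exists>\<mu>. hyperfinite_mean \<mu>" using mean_of_folner by (elim exE conjE)
  qed
  moreover have "?three \<longleftrightarrow> ?one"
    unfolding three
  proof
    assume "\<exists>\<mu>. hyperfinite_mean \<mu>"
    then obtain \<mu> where \<mu>: "hyperfinite_mean \<mu>" by (elim exE)
    then have "invariant_mean G phi \<mu>" by (simp add: generators hyperfinite_mean_def)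
    then have m: "mean \<mu>" and inv: "g \<in> carrier G \<Longrightarrow> \<mu> (phi g ` A) = \<mu> A" for g A
      by (simp_all add: invariant_mean_def)
    \<comment> \<open>Measure invariance is required for the whole group, so the invariance of the
      mean is first extended from the generators to all elements.\<close>
    have "ext_invariant G phi (beta_measure \<mu>)"
      unfolding ext_invariant_def sets_beta_measure
    proof (intro ballI)
      fix g and A :: "'x set set set" assume g: "g \<in> carrier G" and A: "A \<in> borel_sets beta_topology"
      show "emeasure (beta_measure \<mu>) (ext_map (phi g) ` A) = emeasure (beta_measure \<mu>) A"
        by (rule emeasure_beta_measure_ext_map[OF m bij[OF g] inv[OF g] A ext_map_image_borel_sets[OF bij[OF g] A]])
    qed
    with beta_borel_prob_beta_measure[OF m] hyperfinite_of_mean[OF \<mu>] show ?one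
      by (intro exI[of _ "beta_measure \<mu>"] conjI)
  next
    assume ?one
    then obtain \<nu> where \<nu>: "beta_borel_prob \<nu>" "ext_invariant G phi \<nu>" "ext_hyperfinite phi S \<nu>"
      by (elim exE conjE)
    then have "\<forall>s\<in>S. \<forall>A\<in>sets \<nu>. emeasure \<nu> (ext_map (phi s) ` A) = emeasure \<nu> A"
      using assms(2) by (auto simp: ext_invariant_def)
    then show "\<exists>\<mu>. hyperfinite_mean \<mu>" by (rule mean_of_hyperfinite[OF \<nu>(1) _ \<nu>(3)])
  qed
  ultimately show ?thesis by argo
qed

end
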